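(* Let $(M,Y)$ be the Markov additive process described in the context. For $i\in S^-$, $j\in S$ and $x\ge0$, $$P\big(M(\tau_0^+)=j,\ Y(\tau_0^+)\le x\,\big|\,M(0)=i\big)=\frac{1}{-v(i)}\left(\int_0^x dw\left[\int_w^\infty e^{(y-w)K^{(-)}}(I^{--},L^{-+})\,D(dy)\right]_{ij}+\mathbb 1(j\in S^+)\,L^{-+}_{ij}\,v(j)\right).$$
   Context: Markov additive process. $S$ is a finite set; $C_{ij}\ge0$ ($i\ne j$) and $D_{ij}\ge 0$ ($i,j\in S$), $c(i)=\sum_{j\ne i}C_{ij}+\sum_{j}D_{ij}>0$, $C_{ii}=-c(i)$. $C+D$ is irreducible with stationary distribution $\pi=(\pi_i)$. $v:S\to\mathbb R\setminus\{0\}$; $S^-=\{v<0\}$, $S^+=\{v>0\}$; $\Delta_v$ is the diagonal matrix with entries $v(i)$. $F^{\rm D}_{ij}$ are distributions on $(0,\infty)$. $M$ is a right-continuous Markov chain on $S$ with transitions $i\to j\neq i$ at rate $C_{ij}$ ("type C") and $i\to j$ ($j=i$ allowed) at rate $D_{ij}$ ("type D"). $Y$ is right-continuous, $Y(0)=0$, moves linearly with slope $v(M(t))$ between transitions, does not jump at type C transitions, and at a type D transition $i\to j$ jumps upward by an amount with distribution $F^{\rm D}_{ij}$ (independent of everything else given the transition). For $x\ge0$, $D_{ij}(x)=D_{ij}F^{\rm D}_{ij}(x)$ and $C_{ij}(x)=C_{ij}$ (all mass at $0$), viewed as matrix-valued measures on $[0,\infty)$. Superscripts $-,+$ denote blocks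 indexed by $S^-,S^+$. $\tau_0^+=\inf\{t>0:Y(t)\ge0\}$; the event $\{M(\tau_0^+)=j\}$ includes $\tau_0^+<\infty$. No drift condition is assumed. A square matrix is ML if its off-diagonal entries are nonnegative. $K^{(-)}$ ($S^-\times S^-$, ML) and $L^{-+}$ ($S^-\times S^+$, nonnegative) are the (entrywise) minimal solutions of $$-K^{(-)}(I^{--},L^{-+})=\int_0^\infty e^{uK^{(-)}}(I^{--},L^{-+})\,(C(du)+D(du))\,\Delta_v^{-1}.$$ Equivalently $K^{(-)}_{ij}=\pi_j\tilde Q^{(-)}_{ji}/\pi_i$ and $L^{-+}_{ij}=\pi_j\tilde R^{+-}_{ji}/\pi_i$, where, for the dual Markov additive process $(\tilde M,\tilde Y)$ with data $\tilde C_{ij}=\pi_jC_{ji}/\pi_i$, $\tilde D_{ij}(x)=\pi_jD_{ji}(x)/\pi_i$ and the same $v$, started from $\tilde Y=0$, and $\tilde\tau^-_{-x}=\inf\{t>0:\tilde Y(t)\le -x\}$, one has $P(\tilde M(\tilde\tau^-_{-x})=j,\tilde\tau^-_{-x}<\infty|\tilde M(0)=i)=[e^{x\tilde Q^{(-)}}]_{ij}$ for $i,j\in S^-$, $x\ge0$, and $\tilde R^{+-}_{ij}=P(\tilde M(\tilde\tau^-_{0})=j,\tilde\tau^-_0<\infty|\tilde M(0)=i)$ for $i\in S^+,j\in S^-$. *)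

theory Defs
  imports "HOL-Probability.Probability"
begin

text \<open>
  The state space is a finite type \<open>'s\<close>. Matrices indexed by subsets of the states are embedded
  into \<open>real^'s^'s\<close> by padding with zeros. The type class multiplication on \<open>real^'s^'s\<close>
  is componentwise, so the class-based power and \<open>exp\<close> are not the matrix ones.
\<close>

definition mat_exp :: "real^'s^'s \<Rightarrow> real^('s::finite)^'s" where
  "mat_exp A = (\<Sum>n. (1 / fact n) *\<^sub>R (((**) A ^^ n) (mat 1)))"

definition diag_mat :: "('s \<Rightarrow> real) \<Rightarrow> real^('s::finite)^'s" where
  "diag_mat d = (\<chi> i j. if i = j then d i else 0)"

definition neg_states :: "('s \<Rightarrow> real) \<Rightarrow> 's set" where
  "neg_states v = {i. v i < 0}"

definition pos_states :: "('s \<Rightarrow> real) \<Rightarrow> 's set" where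
  "pos_states v = {i. v i > 0}"

definition exit_rate :: "real^'s^'s \<Rightarrow> real^'s^'s \<Rightarrow> 's::finite \<Rightarrow> real" where
  "exit_rate C D i = (\<Sum>j\<in>-{i}. C $ i $ j) + (\<Sum>j\<in>UNIV. D $ i $ j)"

definition irreducible_mat :: "real^'s^('s::finite) \<Rightarrow> bool" where
  "irreducible_mat A \<longleftrightarrow> (\<forall>i j. (i, j) \<in> {(k, l). k \<noteq> l \<and> A $ k $ l \<noteq> 0}\<^sup>*)"

definition stationary_distribution :: "real^('s::finite) \<Rightarrow> real^'s^'s \<Rightarrow> bool" where
  "stationary_distribution p A \<longleftrightarrow> (\<forall>i. 0 \<le> p $ i) \<and> (\<Sum>i\<in>UNIV. p $ i) = 1 \<and> p v* A = 0"

locale MAP_data =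
  fixes C D :: "real^'s^('s::finite)"
    and F :: "'s \<Rightarrow> 's \<Rightarrow> real measure"
    and v :: "'s \<Rightarrow> real"
    and p :: "real^'s"
  assumes C_nonneg: "i \<noteq> j \<Longrightarrow> 0 \<le> C $ i $ j"
    and D_nonneg: "0 \<le> D $ i $ j"
    and exit_rate_pos: "0 < exit_rate C D i"
    and C_diag: "C $ i $ i = - exit_rate C D i"
    and irreducible: "irreducible_mat (C + D)"
    and stationary: "stationary_distribution p (C + D)"
    and v_nonzero: "v i \<noteq> 0"
    and F_distribution: "real_distribution (F i j)"
    and F_pos: "AE u in F i j. 0 < u"

datatype trans_type = TypeC | TypeD

fun trans_rate :: "real^'s^'s \<Rightarrow> real^'s^'s \<Rightarrow> trans_type \<Rightarrow> 's \<Rightarrow> 's::finite \<Rightarrow> real" where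
  "trans_rate C D TypeC i j = (if i = j then 0 else C $ i $ j)"
| "trans_rate C D TypeD i j = D $ i $ j"

fun jump_dist :: "('s \<Rightarrow> 's \<Rightarrow> real measure) \<Rightarrow> trans_type \<Rightarrow> 's \<Rightarrow> 's \<Rightarrow> real measure" where
  "jump_dist F TypeC i j = return borel 0"
| "jump_dist F TypeD i j = F i j"

text \<open>
  \<open>X n\<close> is the state after the \<open>n\<close>-th transition, \<open>T n\<close> the time spent in it, and \<open>ty n\<close> and
  \<open>J n\<close> are the type and the jump size of the transition from \<open>X n\<close> to \<open>X (Suc n)\<close>.
  A transition of type D may have \<open>X (Suc n) = X n\<close>, so the transition epochs cannot be read
  off from \<open>M\<close> alone.

  Assumption \<open>law\<close> describes a Markov chain with the given transition rates: in state \<open>i\<close> the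
  process waits an exponential time with parameter \<open>exit_rate C D i\<close>, then moves to \<open>j\<close> by a
  transition of type \<open>k\<close> with probability \<open>trans_rate C D k i j / exit_rate C D i\<close>, and the jump
  has distribution \<open>jump_dist F k i j\<close>, independently of everything else given the transition.
  The distribution of the initial state is arbitrary.
\<close>

locale MAP_process = MAP_data C D F v p + prob_space P
  for C D :: "real^'s^('s::finite)"
    and F :: "'s \<Rightarrow> 's \<Rightarrow> real measure"
    and v :: "'s \<Rightarrow> real"
    and p :: "real^'s"
    and P :: "'w measure" +
  fixes X :: "nat \<Rightarrow> 'w \<Rightarrow> 's"
    and T :: "nat \<Rightarrow> 'w \<Rightarrow> real"
    and ty :: "nat \<Rightarrow> 'w \<Rightarrow> trans_type"
    and J :: "nat \<Rightarrow> 'w \<Rightarrow> real"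
    and M :: "real \<Rightarrow> 'w \<Rightarrow> 's"
    and Y :: "real \<Rightarrow> 'w \<Rightarrow> real"
  assumes X_meas: "X n \<in> measurable P (count_space UNIV)"
    and T_meas: "T n \<in> borel_measurable P"
    and ty_meas: "ty n \<in> measurable P (count_space UNIV)"
    and J_meas: "J n \<in> borel_measurable P"
    and T_pos: "w \<in> space P \<Longrightarrow> 0 < T n w"
    and no_explosion: "w \<in> space P \<Longrightarrow> filterlim (\<lambda>n. \<Sum>m<n. T m w) at_top sequentially"
    and law: "(\<And>m. 0 \<le> s m) \<Longrightarrow> (\<And>m. B m \<in> sets borel) \<Longrightarrow>
      prob {w \<in> space P. X 0 w = x 0 \<and>
          (\<forall>m<n. s m < T m w \<and> ty m w = k m \<and> X (Suc m) w = x (Suc m) \<and> J m w \<in> B m)} =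
      prob {w \<in> space P. X 0 w = x 0} *
        (\<Prod>m<n. exp (- exit_rate C D (x m) * s m) *
          (trans_rate C D (k m) (x m) (x (Suc m)) / exit_rate C D (x m)) *
          measure (jump_dist F (k m) (x m) (x (Suc m))) (B m))"
    and M_path: "w \<in> space P \<Longrightarrow> (\<Sum>m<n. T m w) \<le> t \<Longrightarrow> t < (\<Sum>m<Suc n. T m w) \<Longrightarrow>
      M t w = X n w"
    and Y_path: "w \<in> space P \<Longrightarrow> (\<Sum>m<n. T m w) \<le> t \<Longrightarrow> t < (\<Sum>m<Suc n. T m w) \<Longrightarrow>
      Y t w = (\<Sum>m<n. v (X m w) * T m w + J m w) + v (X n w) * (t - (\<Sum>m<n. T m w))"

definition tau_0_plus :: "(real \<Rightarrow> 'w \<Rightarrow> real) \<Rightarrow> 'w \<Rightarrow> ereal" where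
  "tau_0_plus Y w = Inf (ereal ` {t. 0 < t \<and> 0 \<le> Y t w})"

definition D_meas ::
  "real^'s^'s \<Rightarrow> ('s \<Rightarrow> 's \<Rightarrow> real measure) \<Rightarrow> 's::finite \<Rightarrow> 's \<Rightarrow> real measure" where
  "D_meas D F i j = scale_measure (ennreal (D $ i $ j)) (F i j)"

definition mat_integrable ::
  "real set \<Rightarrow> (real \<Rightarrow> real^'s^'s) \<Rightarrow> ('s::finite \<Rightarrow> 's \<Rightarrow> real measure) \<Rightarrow> bool" where
  "mat_integrable A f \<mu> \<longleftrightarrow> (\<forall>i k j. set_integrable (\<mu> k j) A (\<lambda>u. f u $ i $ k))"

text \<open>The integral of \<open>f(u) \<mu>(du)\<close> over \<open>A\<close>, with matrix multiplication.\<close>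

definition mat_integral ::
  "real set \<Rightarrow> (real \<Rightarrow> real^'s^'s) \<Rightarrow> ('s::finite \<Rightarrow> 's \<Rightarrow> real measure) \<Rightarrow> real^'s^'s" where
  "mat_integral A f \<mu> = (\<chi> i j. \<Sum>k\<in>UNIV. (LINT u:A|\<mu> k j. f u $ i $ k))"

text \<open>The block row \<open>(I, L)\<close>, its rows being indexed by the negative states.\<close>

definition IL :: "('s \<Rightarrow> real) \<Rightarrow> real^'s^'s \<Rightarrow> real^('s::finite)^'s" where
  "IL v L = (\<chi> i j. if i \<in> neg_states v
      then (if j \<in> neg_states v then (if i = j then 1 else 0) else L $ i $ j) else 0)"

text \<open>
  In the equation, \<open>C(du)\<close> is \<open>C\<close> times the unit mass at \<open>0\<close>, so its integral is the integrand
  at \<open>0\<close> times \<open>C\<close>. Integrability is demanded because the Bochner integral of a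
  non-integrable function is \<open>0\<close>, which could create spurious solutions. The first two conjuncts
  are the zero padding outside of the blocks.
\<close>

definition KL_solution ::
  "real^'s^'s \<Rightarrow> real^'s^'s \<Rightarrow> ('s \<Rightarrow> 's \<Rightarrow> real measure) \<Rightarrow> ('s \<Rightarrow> real) \<Rightarrow>
   real^'s^'s \<Rightarrow> real^('s::finite)^'s \<Rightarrow> bool" where
  "KL_solution C D F v K L \<longleftrightarrow>
     (\<forall>i j. \<not> (i \<in> neg_states v \<and> j \<in> neg_states v) \<longrightarrow> K $ i $ j = 0) \<and>
     (\<forall>i j. \<not> (i \<in> neg_states v \<and> j \<in> pos_states v) \<longrightarrow> L $ i $ j = 0) \<and>
     (\<forall>i j. i \<noteq> j \<longrightarrow> 0 \<le> K $ i $ j) \<and>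
     (\<forall>i j. 0 \<le> L $ i $ j) \<and>
     mat_integrable {0..} (\<lambda>u. mat_exp (u *\<^sub>R K) ** IL v L) (D_meas D F) \<and>
     - (K ** IL v L) =
       (mat_exp (0 *\<^sub>R K) ** IL v L ** C +
        mat_integral {0..} (\<lambda>u. mat_exp (u *\<^sub>R K) ** IL v L) (D_meas D F)) **
       matrix_inv (diag_mat v)"

definition KL_minimal_solution ::
  "real^'s^'s \<Rightarrow> real^'s^'s \<Rightarrow> ('s \<Rightarrow> 's \<Rightarrow> real measure) \<Rightarrow> ('s \<Rightarrow> real) \<Rightarrow>
   real^'s^'s \<Rightarrow> real^('s::finite)^'s \<Rightarrow> bool" where
  "KL_minimal_solution C D F v K L \<longleftrightarrow> KL_solution C D F v K L \<and>
     (\<forall>K' L'. KL_solution C D F v K' L' \<longrightarrow>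
       (\<forall>i j. K $ i $ j \<le> K' $ i $ j \<and> L $ i $ j \<le> L' $ i $ j))"

end

theory Submission
  imports Defs
begin

text \<open>
  Start in \<open>i\<close> with \<open>v i < 0\<close> and kill the process when it first reaches \<open>0\<close> from below. Let
  \<open>W i j y / \<bar>v i\<bar>\<close> be the density at level \<open>-y\<close> of the time spent in \<open>j\<close>. First passage in \<open>j\<close> occurs
  either continuously, with probability \<open>v j * W i j 0 / \<bar>v i\<bar>\<close>, or by a jump from some level \<open>-y\<close>, which
  is an integral of \<open>W\<close> against the jump measures. So it suffices to show that \<open>W i j y\<close> is the entry of
  \<open>e\<^bsup>yK\<^esup>(I, L)\<close>. This is usually done by time reversal; here it follows from minimality.

  Summing over the number of transitions, \<open>W\<close> is the minimal nonnegative solution of a linear balance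
  equation in \<open>y\<close>. For every solution \<open>(K, L)\<close> of the matrix equation, \<open>e\<^bsup>yK\<^esup>(I, L)\<close> is a supersolution of
  the balance equation, so it dominates \<open>W\<close>. As \<open>W i (s + \<cdot>)\<close> solves the balance equation with initial
  values \<open>W i k s\<close>, minimality also gives \<open>W i j (s + y) \<ge> (\<Sum>k. W i k s * W k j y)\<close>, the sum over the
  states with negative slope. Let \<open>K'\<close> consist of the rates at which \<open>W\<close> enters level \<open>0\<close> and \<open>L'\<close> of the
  values of \<open>W\<close> there. A Gronwall argument turns the inequality into \<open>W \<ge> e\<^bsup>yK'\<^esup>(I, L')\<close>, and this makes
  \<open>(K', L')\<close> a pre-fixed point of a monotone map whose fixed points are the solutions. By Knaster-Tarski
  there is a solution below \<open>(K', L')\<close>, hence \<open>K \<le> K'\<close> and \<open>L \<le> L'\<close>, and all inequalities are equalities.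
\<close>

section \<open>The matrix exponential\<close>

text \<open>For the two signs of the slope the balance equation is of different nature. A state with
  negative slope is fed from the bounded range between \<open>0\<close> and \<open>-y\<close>, an
  initial value problem in \<open>y\<close> that variation of constants solves exactly. A state with
  positive slope is fed from the unbounded range below \<open>-y\<close>, and what comes from
  infinite depth is not controlled. So a solution of the matrix equation yields only a
  supersolution, and the bound in the other direction has to come from \<open>W\<close> itself. The
  factor \<open>\<bar>v i\<bar>\<close> makes \<open>W\<close> at \<open>y = 0\<close> the identity
  on the negative block, so that \<open>W\<close> starts like a matrix semigroup; it also cancels
  when densities are composed. \<open>W\<close> lives in \<open>ennreal\<close> and is defined
  before anything is known to be finite; finiteness is then inherited from a given solution of the
  matrix equation. Minimality is therefore used in two different senses, for the linear equation in
  \<open>y\<close> and for the pair \<open>(K, L)\<close>.\<close>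

lemma matrix_mult_nth: "(A ** B) $ i $ j = (\<Sum>k\<in>UNIV. A $ i $ k * B $ k $ j)"
  by (simp add: matrix_matrix_mult_def)

lemma matpow_commute: "A ** ((**) A ^^ n) (mat 1) = ((**) A ^^ n) (mat 1) ** (A :: real^'s^('s::finite))"
  by (induction n) (simp, metis funpow.simps(2) o_apply matrix_mul_assoc)

text \<open>The sum of all absolute entries dominates every row sum, so each induction step
  multiplies by at most this factor. The bound compares the exponential series with a scalar
  one.\<close>

lemma abs_matpow_le:
  fixes A :: "real^'s^('s::finite)"
  shows "\<bar>((**) A ^^ n) (mat 1) $ i $ j\<bar> \<le> (\<Sum>k\<in>UNIV. \<Sum>l\<in>UNIV. \<bar>A $ k $ l\<bar>) ^ n"
proof (induction n arbitrary: i j)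
  case 0
  show ?case by (simp add: mat_def)
next
  case (Suc n)
  let ?s = "\<Sum>k\<in>UNIV. \<Sum>l\<in>UNIV. \<bar>A $ k $ l\<bar>"
  have s0: "0 \<le> ?s ^ n" by (intro zero_le_power sum_nonneg) auto
  have "\<bar>((**) A ^^ Suc n) (mat 1) $ i $ j\<bar> \<le> (\<Sum>k\<in>UNIV. \<bar>A $ i $ k\<bar> * \<bar>((**) A ^^ n) (mat 1) $ k $ j\<bar>)"
    unfolding funpow.simps o_apply matrix_mult_nth
    by (rule order_trans[OF sum_abs]) (simp add: abs_mult)
  also have "\<dots> \<le> (\<Sum>k\<in>UNIV. \<bar>A $ i $ k\<bar> * ?s ^ n)"
    by (intro sum_mono mult_left_mono Suc) auto
  also have "\<dots> = (\<Sum>k\<in>UNIV. \<bar>A $ i $ k\<bar>) * ?s ^ n" by (simp add: sum_distrib_right)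
  also have "\<dots> \<le> ?s * ?s ^ n"
    by (intro mult_right_mono s0 member_le_sum[of i UNIV "\<lambda>k. \<Sum>l\<in>UNIV. \<bar>A $ k $ l\<bar>"]) (auto intro: sum_nonneg)
  finally show ?case by simp
qed

text \<open>The coefficients of the power series of a single entry. Entrywise, the results on real
  power series apply, including termwise differentiation.\<close>

definition exp_coeff :: "real^'s^('s::finite) \<Rightarrow> nat \<Rightarrow> 's \<Rightarrow> 's \<Rightarrow> real" where
  "exp_coeff A n i j = ((**) A ^^ n) (mat 1) $ i $ j / fact n"

lemma exp_coeff_0: "exp_coeff A 0 i j = (if i = j then 1 else 0)"
  by (simp add: exp_coeff_def mat_def)

lemma exp_coeff_Suc:
  "of_nat (Suc n) * exp_coeff A (Suc n) i j = (\<Sum>k\<in>UNIV. A $ i $ k * exp_coeff A n k j)"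
proof -
  have "of_nat (Suc n) * exp_coeff A (Suc n) i j
      = (A ** ((**) A ^^ n) (mat 1)) $ i $ j * (of_nat (Suc n) / fact (Suc n))"
    by (simp add: exp_coeff_def)
  also have "of_nat (Suc n) / fact (Suc n) = 1 / (fact n :: real)"
    by (simp add: divide_simps)
  finally show ?thesis by (simp add: matrix_mult_nth sum_divide_distrib exp_coeff_def)
qed

lemma exp_coeff_commute:
  "(\<Sum>k\<in>UNIV. A $ i $ k * exp_coeff A n k j) = (\<Sum>k\<in>UNIV. exp_coeff A n i k * A $ k $ j)"
proof -
  have "(A ** ((**) A ^^ n) (mat 1)) $ i $ j / fact n = (((**) A ^^ n) (mat 1) ** A) $ i $ j / fact n"
    by (simp only: matpow_commute)
  then show ?thesis by (simp add: matrix_mult_nth sum_divide_distrib exp_coeff_def)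
qed

lemma summable_exp_coeff:
  fixes A :: "real^'s^('s::finite)"
  shows "summable (\<lambda>n. exp_coeff A n i j * y ^ n)"
proof (rule summable_comparison_test)
  let ?s = "\<Sum>k\<in>UNIV. \<Sum>l\<in>UNIV. \<bar>A $ k $ l\<bar>"
  show "summable (\<lambda>n. inverse (fact n) * (?s * \<bar>y\<bar>) ^ n)"
    using summable_exp[of "?s * \<bar>y\<bar>"] by simp
  have "norm (exp_coeff A n i j * y ^ n) \<le> inverse (fact n) * (?s * \<bar>y\<bar>) ^ n" for n
  proof -
    have "norm (exp_coeff A n i j * y ^ n)
        = inverse (fact n) * (\<bar>((**) A ^^ n) (mat 1) $ i $ j\<bar> * \<bar>y\<bar> ^ n)"
      by (simp add: exp_coeff_def abs_mult power_abs divide_inverse)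
    also have "\<dots> \<le> inverse (fact n) * (?s ^ n * \<bar>y\<bar> ^ n)"
      by (intro mult_left_mono mult_right_mono abs_matpow_le) auto
    finally show ?thesis by (simp add: power_mult_distrib)
  qed
  then show "\<exists>N. \<forall>n\<ge>N. norm (exp_coeff A n i j * y ^ n) \<le> inverse (fact n) * (?s * \<bar>y\<bar>) ^ n"
    by blast
qed

lemma mat_exp_nth:
  fixes A :: "real^'s^('s::finite)"
  shows "mat_exp (y *\<^sub>R A) $ i $ j = (\<Sum>n. exp_coeff A n i j * y ^ n)"
proof -
  have scale: "((**) (y *\<^sub>R A) ^^ n) (mat 1) = y ^ n *\<^sub>R ((**) A ^^ n) (mat 1)" for n
    by (induction n) (simp_all add: vec_eq_iff matrix_mult_nth sum_distrib_left mult_ac)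
  have "(\<lambda>n. (\<chi> k l. exp_coeff A n k l * y ^ n)) sums (\<chi> k l. \<Sum>n. exp_coeff A n k l * y ^ n)"
    using summable_sums[OF summable_exp_coeff, unfolded sums_def]
    unfolding sums_def by (intro vec_tendstoI) simp
  also have "(\<lambda>n. (\<chi> k l. exp_coeff A n k l * y ^ n)) = (\<lambda>n. (1 / fact n) *\<^sub>R (((**) (y *\<^sub>R A) ^^ n) (mat 1)))"
    by (simp add: fun_eq_iff vec_eq_iff scale exp_coeff_def)
  finally show ?thesis by (simp add: mat_exp_def sums_iff)
qed

lemma mat_exp_zero [simp]: "mat_exp (0 :: real^'s^('s::finite)) = mat 1"
proof -
  have "(\<Sum>n. exp_coeff A n i j * 0 ^ n) = (mat 1 :: real^'s^'s) $ i $ j" for A :: "real^'s^'s" and i j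
    by (simp add: exp_coeff_0 mat_def)
  then have "mat_exp (0 *\<^sub>R A) $ i $ j = (mat 1 :: real^'s^'s) $ i $ j" for A :: "real^'s^'s" and i j
    by (simp only: mat_exp_nth)
  then show ?thesis by (simp add: vec_eq_iff)
qed

lemma matrix_mult_minus_left: "(- A) ** B = - (A ** (B :: real^'s^('s::finite)))"
  by (simp add: vec_eq_iff matrix_mult_nth sum_negf)

lemma mat_exp_commute:
  fixes A :: "real^'s^('s::finite)"
  shows "A ** mat_exp (y *\<^sub>R A) = mat_exp (y *\<^sub>R A) ** A"
proof -
  have "(A ** mat_exp (y *\<^sub>R A)) $ i $ j = (mat_exp (y *\<^sub>R A) ** A) $ i $ j" for i j
  proof -
    have "(A ** mat_exp (y *\<^sub>R A)) $ i $ j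
        = (\<Sum>n. \<Sum>k\<in>UNIV. A $ i $ k * (exp_coeff A n k j * y ^ n))"
      unfolding matrix_mult_nth mat_exp_nth
      by (simp add: suminf_mult[symmetric] suminf_sum summable_mult summable_exp_coeff)
    also have "\<dots> = (\<Sum>n. \<Sum>k\<in>UNIV. (exp_coeff A n i k * y ^ n) * A $ k $ j)"
    proof (intro suminf_cong)
      fix n
      have "(\<Sum>k\<in>UNIV. A $ i $ k * exp_coeff A n k j) * y ^ n = (\<Sum>k\<in>UNIV. exp_coeff A n i k * A $ k $ j) * y ^ n"
        by (simp only: exp_coeff_commute)
      then show "(\<Sum>k\<in>UNIV. A $ i $ k * (exp_coeff A n k j * y ^ n))
          = (\<Sum>k\<in>UNIV. (exp_coeff A n i k * y ^ n) * A $ k $ j)"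
        unfolding sum_distrib_right by (simp only: mult_ac)
    qed
    also have "\<dots> = (mat_exp (y *\<^sub>R A) ** A) $ i $ j"
      unfolding matrix_mult_nth mat_exp_nth
      by (simp add: suminf_mult2 suminf_sum summable_mult2 summable_exp_coeff)
    finally show ?thesis .
  qed
  then show ?thesis by (simp add: vec_eq_iff)
qed

lemma mat_exp_has_derivative:
  fixes A :: "real^'s^('s::finite)"
  shows "((\<lambda>y. mat_exp (y *\<^sub>R A) $ i $ j) has_real_derivative (mat_exp (y *\<^sub>R A) ** A) $ i $ j) (at y)"
proof -
  let ?c = "\<lambda>n. exp_coeff A n i j"
  have "((\<lambda>x. \<Sum>n. ?c n * x ^ n) has_real_derivative (\<Sum>n. diffs ?c n * y ^ n)) (at y)"
    by (intro termdiffs_strong_converges_everywhere summable_exp_coeff)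
  moreover have "(\<Sum>n. diffs ?c n * y ^ n) = (A ** mat_exp (y *\<^sub>R A)) $ i $ j"
  proof -
    have "diffs ?c n * y ^ n = (\<Sum>k\<in>UNIV. A $ i $ k * (exp_coeff A n k j * y ^ n))" for n
      unfolding diffs_def exp_coeff_Suc sum_distrib_right by (simp only: mult_ac)
    then show ?thesis
      unfolding matrix_mult_nth mat_exp_nth
      by (simp add: suminf_mult[symmetric] suminf_sum summable_mult summable_exp_coeff)
  qed
  ultimately show ?thesis by (simp add: mat_exp_nth mat_exp_commute)
qed

lemma mat_exp_has_derivative':
  fixes A :: "real^'s^('s::finite)"
  assumes "(g has_real_derivative d) (at y)"
  shows "((\<lambda>y. mat_exp (g y *\<^sub>R A) $ i $ j) has_real_derivative (mat_exp (g y *\<^sub>R A) ** A) $ i $ j * d) (at y)"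
  using DERIV_chain2[OF mat_exp_has_derivative assms] .

text \<open>The product rule in the order forced by noncommutativity; it is applied to products in
  which one exponential runs backwards.\<close>

lemma mat_mult_const:
  fixes f g :: "real \<Rightarrow> real^'s^('s::finite)"
  assumes "\<And>i j y. ((\<lambda>y. f y $ i $ j) has_real_derivative f' y $ i $ j) (at y)"
    and "\<And>i j y. ((\<lambda>y. g y $ i $ j) has_real_derivative g' y $ i $ j) (at y)"
    and "\<And>y. f' y ** g y + f y ** g' y = 0"
  shows "f y ** g y = f z ** g z"
proof -
  have "((\<lambda>y. (f y ** g y) $ i $ j) has_real_derivative 0) (at y)" for i j y
  proof -
    have "((\<lambda>y. (f y ** g y) $ i $ j) has_real_derivative (f' y ** g y + f y ** g' y) $ i $ j) (at y)"
      unfolding matrix_mult_nth vector_add_component sum.distrib[symmetric]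
      by (intro DERIV_sum DERIV_cong[OF DERIV_mult[OF assms(1,2)]]) simp
    then show ?thesis by (simp add: assms(3))
  qed
  then have "(f y ** g y) $ i $ j = (f z ** g z) $ i $ j" for i j
    using DERIV_isconst_all[of "\<lambda>y. (f y ** g y) $ i $ j" y z] by blast
  then show ?thesis by (simp add: vec_eq_iff)
qed

lemma mat_exp_add:
  fixes A :: "real^'s^('s::finite)"
  shows "mat_exp ((s + t) *\<^sub>R A) = mat_exp (s *\<^sub>R A) ** mat_exp (t *\<^sub>R A)"
proof -
  have d: "((\<lambda>y. mat_exp ((s + t - y) *\<^sub>R A) $ i $ j) has_real_derivative
      (- (mat_exp ((s + t - y) *\<^sub>R A) ** A)) $ i $ j) (at y)" for i j y
    by (rule DERIV_cong[OF mat_exp_has_derivative'[where d = "-1"]]) (auto intro!: derivative_eq_intros)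
  \<comment> \<open>The product \<open>e^((s+t-y)A) e^(yA)\<close> does not depend on
    \<open>y\<close>; compare \<open>y = t\<close> with \<open>y = 0\<close>.\<close>
  have "mat_exp ((s + t - t) *\<^sub>R A) ** mat_exp (t *\<^sub>R A) = mat_exp ((s + t - 0) *\<^sub>R A) ** mat_exp (0 *\<^sub>R A)"
    by (rule mat_mult_const[OF d mat_exp_has_derivative])
      (simp add: matrix_mult_minus_left matrix_mul_assoc[symmetric] mat_exp_commute)
  then show ?thesis by simp
qed

text \<open>Multiplying \<open>V y\<close> by the inverse \<open>e^(-yA)\<close> gives a constant,
  which the value at \<open>0\<close> identifies.\<close>

lemma mat_exp_unique:
  fixes A :: "real^'s^('s::finite)"
  assumes "\<And>i j y. ((\<lambda>y. V y $ i $ j) has_real_derivative (A ** V y) $ i $ j) (at y)" "V 0 = mat 1"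
  shows "V y = mat_exp (y *\<^sub>R A)"
proof -
  have d: "((\<lambda>y. mat_exp ((- y) *\<^sub>R A) $ i $ j) has_real_derivative
      (- (mat_exp ((- y) *\<^sub>R A) ** A)) $ i $ j) (at y)" for i j y
    by (rule DERIV_cong[OF mat_exp_has_derivative'[where d = "-1"]]) (auto intro!: derivative_eq_intros)
  have "mat_exp ((- y) *\<^sub>R A) ** V y = mat_exp ((- 0) *\<^sub>R A) ** V 0"
    by (rule mat_mult_const[OF d assms(1)])
      (simp add: matrix_mult_minus_left matrix_mul_assoc)
  then have "mat_exp ((- y) *\<^sub>R A) ** V y = mat 1" by (simp add: assms(2))
  then have "mat_exp (y *\<^sub>R A) ** (mat_exp ((- y) *\<^sub>R A) ** V y) = mat_exp (y *\<^sub>R A)" by simp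
  moreover have "mat_exp (y *\<^sub>R A) ** mat_exp ((- y) *\<^sub>R A) = mat 1"
    unfolding mat_exp_add[symmetric] by simp
  ultimately show ?thesis
    by (simp only: matrix_mul_assoc matrix_mul_lid)
qed

text \<open>A multiple of the identity commutes with \<open>A\<close>, so it only contributes a
  scalar factor. This reduces ML matrices to nonnegative ones.\<close>

lemma mat_exp_shift:
  fixes A :: "real^'s^('s::finite)"
  shows "mat_exp (y *\<^sub>R (A + mat a)) = exp (a * y) *\<^sub>R mat_exp (y *\<^sub>R A)"
proof (rule mat_exp_unique[symmetric])
  have d: "((\<lambda>y. exp (a * y) * mat_exp (y *\<^sub>R A) $ i $ j) has_real_derivative
      exp (a * y) * a * mat_exp (y *\<^sub>R A) $ i $ j + exp (a * y) * (A ** mat_exp (y *\<^sub>R A)) $ i $ j) (at y)" for i j y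
    unfolding mat_exp_commute
    by (auto intro!: derivative_eq_intros mat_exp_has_derivative)
  have e: "exp (a * y) * a * mat_exp (y *\<^sub>R A) $ i $ j + exp (a * y) * (A ** mat_exp (y *\<^sub>R A)) $ i $ j
      = ((A + mat a) ** (exp (a * y) *\<^sub>R mat_exp (y *\<^sub>R A))) $ i $ j" for i j y
  proof -
    have "((A + mat a) ** B) $ i $ j = (A ** B) $ i $ j + a * B $ i $ j" for B :: "real^'s^'s"
      unfolding matrix_mult_nth vector_add_component distrib_right sum.distrib
      by (simp add: mat_def if_distrib[of "\<lambda>x. x * _"] cong: if_cong)
    moreover have "(A ** (exp (a * y) *\<^sub>R B)) $ i $ j = exp (a * y) * (A ** B) $ i $ j" for B :: "real^'s^'s"
      by (simp add: matrix_mult_nth sum_distrib_left mult_ac)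
    ultimately show ?thesis by simp
  qed
  show "((\<lambda>y. (exp (a * y) *\<^sub>R mat_exp (y *\<^sub>R A)) $ i $ j) has_real_derivative
      ((A + mat a) ** (exp (a * y) *\<^sub>R mat_exp (y *\<^sub>R A))) $ i $ j) (at y)" for i j y
    using d[of i j y] unfolding e by simp
qed simp

lemma matpow_mono:
  fixes A B :: "real^'s^('s::finite)"
  assumes "\<And>i j. 0 \<le> A $ i $ j" "\<And>i j. A $ i $ j \<le> B $ i $ j"
  shows "0 \<le> ((**) A ^^ n) (mat 1) $ i $ j \<and> ((**) A ^^ n) (mat 1) $ i $ j \<le> ((**) B ^^ n) (mat 1) $ i $ j"
proof (induction n arbitrary: i j)
  case 0
  then show ?case by (simp add: mat_def)
next
  case (Suc n)
  have "0 \<le> B $ k $ l" for k l using order_trans[OF assms] .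
  then show ?case using Suc assms
    unfolding funpow.simps o_apply matrix_mult_nth
    by (intro conjI sum_nonneg sum_mono mult_mono mult_nonneg_nonneg) blast+
qed

text \<open>For nonnegative matrices the series is monotone term by term. An ML matrix becomes
  nonnegative after adding a multiple of the identity, and the resulting factor
  \<open>exp (a * y)\<close> is positive and common to both sides.\<close>

lemma mat_exp_mono:
  fixes A B :: "real^'s^('s::finite)"
  assumes offdiag: "\<And>i j. i \<noteq> j \<Longrightarrow> 0 \<le> A $ i $ j" and le: "\<And>i j. A $ i $ j \<le> B $ i $ j" and y: "0 \<le> y"
  shows "0 \<le> mat_exp (y *\<^sub>R A) $ i $ j \<and> mat_exp (y *\<^sub>R A) $ i $ j \<le> mat_exp (y *\<^sub>R B) $ i $ j"
proof -
  define a where "a = (\<Sum>i\<in>UNIV. \<bar>A $ i $ i\<bar>)"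
  have A0: "0 \<le> (A + mat a) $ k $ l" for k l
  proof -
    have "\<bar>A $ k $ k\<bar> \<le> a" unfolding a_def by (rule member_le_sum) auto
    then show ?thesis using offdiag[of k l] by (auto simp: mat_def)
  qed
  have AB: "(A + mat a) $ k $ l \<le> (B + mat a) $ k $ l" for k l using le by simp
  have c: "0 \<le> exp_coeff (A + mat a) n i j \<and> exp_coeff (A + mat a) n i j \<le> exp_coeff (B + mat a) n i j" for n
    using matpow_mono[OF A0 AB] by (auto simp: exp_coeff_def intro!: divide_right_mono)
  have "0 \<le> mat_exp (y *\<^sub>R (A + mat a)) $ i $ j"
    unfolding mat_exp_nth using c y by (intro suminf_nonneg summable_exp_coeff) auto
  moreover have "mat_exp (y *\<^sub>R (A + mat a)) $ i $ j \<le> mat_exp (y *\<^sub>R (B + mat a)) $ i $ j"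
    unfolding mat_exp_nth using c y by (intro suminf_le summable_exp_coeff mult_right_mono) auto
  ultimately show ?thesis by (simp add: mat_exp_shift zero_le_mult_iff)
qed

lemma mat_exp_nonneg:
  fixes A :: "real^'s^('s::finite)"
  assumes "\<And>i j. i \<noteq> j \<Longrightarrow> 0 \<le> A $ i $ j" "0 \<le> y"
  shows "0 \<le> mat_exp (y *\<^sub>R A) $ i $ j"
  using mat_exp_mono[OF assms(1) order_refl assms(2)] by auto

lemma continuous_on_mat_exp_nth:
  "continuous_on UNIV (\<lambda>y. mat_exp (y *\<^sub>R (A :: real^'s^('s::finite))) $ i $ j)"
  by (intro continuous_at_imp_continuous_on ballI DERIV_isCont[OF mat_exp_has_derivative])

text \<open>The zero padding of \<open>K\<close> leaves rows of zeros at the states with positive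
  slope; there the exponential is the identity and does not mix with the block.\<close>

lemma mat_exp_zero_row:
  fixes A :: "real^'s^('s::finite)"
  assumes "\<And>j. A $ i $ j = 0"
  shows "mat_exp (y *\<^sub>R A) $ i $ j = (if i = j then 1 else 0)"
proof -
  have "exp_coeff A n i j = (if n = 0 then if i = j then 1 else 0 else 0)" for n
    by (cases n) (simp_all add: exp_coeff_def matrix_mult_nth assms mat_def)
  then have "(\<lambda>n. exp_coeff A n i j * y ^ n) = (\<lambda>n. if n = 0 then if i = j then 1 else 0 else 0)"
    by (simp add: fun_eq_iff)
  then show ?thesis
    using sums_single[of 0 "\<lambda>_. if i = j then 1 else 0 :: real"] by (simp add: mat_exp_nth sums_iff)
qed

lemma mult_diag_mat_nth: "((A :: real^'s^('s::finite)) ** diag_mat d) $ i $ j = A $ i $ j * d j"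
  by (simp add: diag_mat_def matrix_mult_nth if_distrib[of "\<lambda>x. _ * x"] cong: if_cong)

lemma matrix_inv_diag_mat:
  fixes d :: "'s::finite \<Rightarrow> real"
  assumes "\<And>i. d i \<noteq> 0"
  shows "matrix_inv (diag_mat d) = diag_mat (\<lambda>i. 1 / d i)"
proof -
  have mult: "(diag_mat f ** diag_mat g) = (diag_mat (\<lambda>i. f i * g i) :: real^'s^'s)" for f g
    by (simp add: vec_eq_iff mult_diag_mat_nth) (simp add: diag_mat_def)
  have one: "diag_mat (\<lambda>i. 1) = (mat 1 :: real^'s^'s)" by (simp add: diag_mat_def mat_def)
  have *: "diag_mat d ** diag_mat (\<lambda>i. 1 / d i) = mat 1 \<and> diag_mat (\<lambda>i. 1 / d i) ** diag_mat d = mat 1"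
    using assms by (simp add: mult one)
  have "diag_mat d ** matrix_inv (diag_mat d) = mat 1"
    unfolding matrix_inv_def by (rule someI2) (use * in auto)
  then have "diag_mat (\<lambda>i. 1 / d i) ** (diag_mat d ** matrix_inv (diag_mat d)) = diag_mat (\<lambda>i. 1 / d i)" by simp
  then show ?thesis using * by (simp add: matrix_mul_assoc)
qed

text \<open>Knaster-Tarski for a lattice that may lack top and bottom. The bound \<open>lo\<close>
  makes the infimum exist; the bound \<open>hi\<close> confines monotonicity to a region, since the
  map used later is monotone only where certain integrals are finite.\<close>

lemma conditionally_complete_lfp:
  fixes f :: "'a::conditionally_complete_lattice \<Rightarrow> 'a"
  assumes mono: "\<And>x y. lo \<le> x \<Longrightarrow> x \<le> y \<Longrightarrow> y \<le> hi \<Longrightarrow> f x \<le> f y"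
    and low: "\<And>x. lo \<le> x \<Longrightarrow> x \<le> hi \<Longrightarrow> lo \<le> f x"
    and x: "lo \<le> x" "x \<le> hi" "f x \<le> x"
  shows "\<exists>z. lo \<le> z \<and> z \<le> x \<and> f z = z"
proof -
  let ?S = "{z. lo \<le> z \<and> z \<le> hi \<and> f z \<le> z}"
  define z where "z = Inf ?S"
  have bdd: "bdd_below ?S" by (auto simp: bdd_below_def)
  have xS: "x \<in> ?S" using x by simp
  have zle: "z \<le> y" if "y \<in> ?S" for y unfolding z_def by (rule cInf_lower[OF that bdd])
  have lz: "lo \<le> z" unfolding z_def using xS by (intro cInf_greatest) auto
  have zh: "z \<le> hi" using zle[OF xS] x by simp
  have "f z \<le> y" if y: "y \<in> ?S" for y
    using mono[OF lz zle[OF y]] y by auto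
  then have fz: "f z \<le> z" unfolding z_def using xS by (intro cInf_greatest) auto
  \<comment> \<open>Monotonicity sends the pre-fixed point \<open>z\<close> to a pre-fixed point
    \<open>f z\<close>, so the infimum lies below it.\<close>
  have "f z \<in> ?S" using fz lz zh low[OF lz zh] mono[of "f z" z] by auto
  then have "z \<le> f z" by (rule zle)
  with fz lz zle[OF xS] show ?thesis by (intro exI[of _ z]) auto
qed

section \<open>Occupation densities of the killed process\<close>

context MAP_data
begin

text \<open>The exit rate per unit of level: a sojourn in \<open>j\<close> passes
  \<open>\<bar>v j\<bar>\<close> levels per unit of time.\<close>

definition lam :: "'s \<Rightarrow> real" where
  "lam j = exit_rate C D j / \<bar>v j\<bar>"

text \<open>If \<open>g k\<close> is the density of state \<open>k\<close> as a function of depth,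
  this is the rate of transitions into \<open>j\<close> that end at depth \<open>z\<close>. A jump
  of size \<open>u\<close> ending there started at depth \<open>z + u\<close>.\<close>

definition inflow :: "('s \<Rightarrow> real \<Rightarrow> ennreal) \<Rightarrow> 's \<Rightarrow> real \<Rightarrow> ennreal" where
  "inflow g j z = (\<Sum>k\<in>-{j}. ennreal (C $ k $ j) * g k z) +
     (\<Sum>k\<in>UNIV. ennreal (D $ k $ j) * (\<integral>\<^sup>+u. g k (z + u) \<partial>F k j))"

text \<open>Variation of constants along the level: a state with negative slope at level \<open>-y\<close> is fed
  from the levels between \<open>0\<close> and \<open>-y\<close>, a state with positive slope from the levels below \<open>-y\<close>.\<close>

definition sweep :: "'s \<Rightarrow> (real \<Rightarrow> ennreal) \<Rightarrow> real \<Rightarrow> ennreal" where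
  "sweep j r y = (\<integral>\<^sup>+z. indicator (if v j < 0 then {0..y} else {y..}) z *
     ennreal (exp (- lam j * \<bar>y - z\<bar>) / \<bar>v j\<bar>) * r z \<partial>lborel)"

text \<open>The density at level \<open>-y\<close> of the time spent in \<open>j\<close> during the sojourn after the \<open>n\<close>-th transition,
  for the process started in \<open>i\<close> and killed at its first passage, multiplied by \<open>\<bar>v i\<bar>\<close>.\<close>

primrec occ_n :: "nat \<Rightarrow> 's \<Rightarrow> 's \<Rightarrow> real \<Rightarrow> ennreal" where
  "occ_n 0 = (\<lambda>i j y. if i = j then ennreal (exp (- lam j * y)) else 0)"
| "occ_n (Suc n) = (\<lambda>i j. sweep j (inflow (occ_n n i) j))"

text \<open>This is the \<open>W\<close> of the overview.\<close>

definition occ :: "'s \<Rightarrow> 's \<Rightarrow> real \<Rightarrow> ennreal" where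
  "occ i j y = (\<Sum>n. occ_n n i j y)"

lemma lam_pos: "0 < lam j"
  using exit_rate_pos v_nonzero by (simp add: lam_def)

lemma sets_F [measurable_cong]: "sets (F k j) = sets borel"
  using F_distribution[of k j] by (simp add: real_distribution.events_eq_borel)

lemma prob_space_F: "prob_space (F k j)"
  using F_distribution[of k j] by (simp add: real_distribution_def)

lemma sigma_finite_F: "sigma_finite_measure (F k j)"
  using prob_space_F prob_space_imp_sigma_finite by blast

lemma measurable_inflow [measurable]:
  assumes [measurable]: "\<And>k. g k \<in> borel_measurable borel"
  shows "inflow g j \<in> borel_measurable borel"
proof -
  have [measurable]: "(\<lambda>z. \<integral>\<^sup>+u. g k (z + u) \<partial>F k j) \<in> borel_measurable borel" for k
    by (rule sigma_finite_measure.borel_measurable_nn_integral[OF sigma_finite_F]) measurable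
  show ?thesis unfolding inflow_def[abs_def] by measurable
qed

lemma measurable_sweep [measurable]:
  assumes [measurable]: "r \<in> borel_measurable borel"
  shows "sweep j r \<in> borel_measurable borel"
proof (cases "v j < 0")
  case True
  have "(\<lambda>y. \<integral>\<^sup>+z. (if 0 \<le> z \<and> z \<le> y then 1 else 0) *
     ennreal (exp (- lam j * \<bar>y - z\<bar>) / \<bar>v j\<bar>) * r z \<partial>lborel) \<in> borel_measurable borel"
    by (rule lborel.borel_measurable_nn_integral) measurable
  also have "(\<lambda>y. \<integral>\<^sup>+z. (if 0 \<le> z \<and> z \<le> y then 1 else 0) *
     ennreal (exp (- lam j * \<bar>y - z\<bar>) / \<bar>v j\<bar>) * r z \<partial>lborel) = sweep j r"
    using True by (simp add: sweep_def[abs_def] indicator_def of_bool_def)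
  finally show ?thesis .
next
  case False
  have "(\<lambda>y. \<integral>\<^sup>+z. (if y \<le> z then 1 else 0) *
     ennreal (exp (- lam j * \<bar>y - z\<bar>) / \<bar>v j\<bar>) * r z \<partial>lborel) \<in> borel_measurable borel"
    by (rule lborel.borel_measurable_nn_integral) measurable
  also have "(\<lambda>y. \<integral>\<^sup>+z. (if y \<le> z then 1 else 0) *
     ennreal (exp (- lam j * \<bar>y - z\<bar>) / \<bar>v j\<bar>) * r z \<partial>lborel) = sweep j r"
    using False by (simp add: sweep_def[abs_def] indicator_def of_bool_def)
  finally show ?thesis .
qed

lemma measurable_occ_n [measurable]: "occ_n n i j \<in> borel_measurable borel"
  by (induction n arbitrary: j) (auto intro!: measurable_sweep measurable_inflow)

lemma measurable_occ [measurable]: "occ i j \<in> borel_measurable borel"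
  unfolding occ_def[abs_def] by measurable

lemma AE_F_pos: "AE u in F k j. 0 < u"
  by (rule F_pos)

text \<open>Jumps go upward almost surely, so the inflow at a nonnegative depth only involves
  nonnegative depths.\<close>

lemma inflow_mono:
  assumes "\<And>k y. 0 \<le> y \<Longrightarrow> g k y \<le> h k y" "0 \<le> z"
  shows "inflow g j z \<le> inflow h j z"
  unfolding inflow_def
proof (intro add_mono sum_mono mult_left_mono)
  fix k
  show "(\<integral>\<^sup>+u. g k (z + u) \<partial>F k j) \<le> (\<integral>\<^sup>+u. h k (z + u) \<partial>F k j)"
    using AE_F_pos by (rule nn_integral_mono_AE[OF AE_mp]) (auto intro!: assms add_nonneg_nonneg AE_I2 simp: assms(2))
qed (auto intro: assms)

lemma inflow_cong:
  assumes "\<And>k y. 0 \<le> y \<Longrightarrow> g k y = h k y" "0 \<le> z"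
  shows "inflow g j z = inflow h j z"
  by (intro antisym inflow_mono) (simp_all add: assms)

lemma sweep_mono:
  assumes "\<And>z. 0 \<le> z \<Longrightarrow> r z \<le> s z" "0 \<le> y"
  shows "sweep j r y \<le> sweep j s y"
  unfolding sweep_def using assms
  by (intro nn_integral_mono) (auto simp: indicator_def intro!: mult_left_mono)

lemma sweep_inflow_mono:
  assumes "\<And>k y. 0 \<le> y \<Longrightarrow> g k y \<le> h k y" "0 \<le> y"
  shows "sweep j (inflow g j) y \<le> sweep j (inflow h j) y"
  by (intro sweep_mono inflow_mono assms)

lemma inflow_sum:
  assumes [measurable]: "\<And>a k. f a k \<in> borel_measurable borel"
  shows "inflow (\<lambda>k y. \<Sum>a\<in>A. b a * f a k y) j z = (\<Sum>a\<in>A. b a * inflow (f a) j z)"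
proof -
  have "(\<integral>\<^sup>+u. (\<Sum>a\<in>A. b a * f a k (z + u)) \<partial>F k j) = (\<Sum>a\<in>A. b a * (\<integral>\<^sup>+u. f a k (z + u) \<partial>F k j))" for k
    by (simp add: nn_integral_sum nn_integral_cmult)
  then show ?thesis
    unfolding inflow_def
    by (simp add: sum_distrib_left sum.distrib distrib_left sum.swap[of _ _ A] mult.left_commute)
qed

lemma sweep_sum:
  assumes [measurable]: "\<And>a. r a \<in> borel_measurable borel"
  shows "sweep j (\<lambda>y. \<Sum>a\<in>A. b a * r a y) y = (\<Sum>a\<in>A. b a * sweep j (r a) y)"
  unfolding sweep_def
  by (simp add: nn_integral_sum[symmetric] nn_integral_cmult[symmetric] sum_distrib_left mult.left_commute)

lemma inflow_suminf:
  assumes [measurable]: "\<And>n k. f n k \<in> borel_measurable borel"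
  shows "inflow (\<lambda>k y. \<Sum>n. f n k y) j z = (\<Sum>n. inflow (f n) j z)"
  unfolding inflow_def
  by (simp add: nn_integral_suminf ennreal_suminf_cmult[symmetric] suminf_sum[symmetric] suminf_add summableI
      del: ennreal_suminf_cmult)

lemma sweep_suminf:
  assumes [measurable]: "\<And>n. r n \<in> borel_measurable borel"
  shows "sweep j (\<lambda>y. \<Sum>n. r n y) y = (\<Sum>n. sweep j (r n) y)"
  unfolding sweep_def
  by (subst nn_integral_suminf[symmetric]) (simp_all add: ennreal_suminf_cmult)

text \<open>The balance equation. Term \<open>0\<close> is the first sojourn; the remaining terms
  are one sweep of the inflow of all terms, because both operators commute with countable sums of
  nonnegative functions.\<close>

lemma occ_eq: "occ i j y = occ_n 0 i j y + sweep j (inflow (occ i) j) y"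
proof -
  have "(\<Sum>n. occ_n (Suc n) i j y) = sweep j (inflow (occ i) j) y"
  proof -
    have "inflow (occ i) j = (\<lambda>y. \<Sum>n. inflow (occ_n n i) j y)"
      unfolding occ_def[abs_def] by (intro ext inflow_suminf) measurable
    then show ?thesis by (simp add: sweep_suminf measurable_inflow)
  qed
  then have "(\<lambda>n. occ_n (Suc n) i j y) sums sweep j (inflow (occ i) j) y"
    using summable_sums[OF summableI, of "\<lambda>n. occ_n (Suc n) i j y"] by simp
  then have "(\<lambda>n. occ_n n i j y) sums (sweep j (inflow (occ i) j) y + occ_n 0 i j y)"
    by (rule sums_Suc)
  then show ?thesis by (simp add: occ_def sums_iff add.commute)
qed

text \<open>The weights \<open>a\<close> describe a mixture of initial states. By induction every
  partial sum stays below \<open>G\<close>: one more step of the monotone operator, plus the source,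
  is at most \<open>G\<close> again.\<close>

lemma occ_minimal:
  assumes G: "\<And>j y. 0 \<le> y \<Longrightarrow> (\<Sum>k\<in>UNIV. a k * occ_n 0 k j y) + sweep j (inflow G j) y \<le> G j y"
    and y: "0 \<le> y"
  shows "(\<Sum>k\<in>UNIV. a k * occ k j y) \<le> G j y"
proof -
  define V where "V n j y = (\<Sum>k\<in>UNIV. a k * occ_n n k j y)" for n j y
  have mV [measurable]: "V n j \<in> borel_measurable borel" for n j unfolding V_def by measurable
  have V_Suc: "V (Suc n) j y = sweep j (inflow (V n) j) y" for n j y
  proof -
    have "inflow (V n) j = (\<lambda>z. \<Sum>k\<in>UNIV. a k * inflow (occ_n n k) j z)"
      unfolding V_def[abs_def] by (intro ext inflow_sum) measurable
    then show ?thesis by (simp add: V_def sweep_sum measurable_inflow)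
  qed
  have partial: "(\<Sum>n<N. V n j y) \<le> G j y" if "0 \<le> y" for N j y
    using that
  proof (induction N arbitrary: j y)
    case (Suc N)
    have "(\<Sum>n<Suc N. V n j y) = V 0 j y + (\<Sum>n<N. sweep j (inflow (V n) j) y)"
      unfolding sum.lessThan_Suc_shift V_Suc ..
    also have "(\<Sum>n<N. sweep j (inflow (V n) j) y) = sweep j (inflow (\<lambda>j y. \<Sum>n<N. V n j y) j) y"
    proof -
      have "inflow (\<lambda>j y. \<Sum>n<N. V n j y) j = (\<lambda>z. \<Sum>n<N. inflow (V n) j z)"
        using inflow_sum[of V "\<lambda>_. 1" "{..<N}" j] by (intro ext) simp
      then show ?thesis
        using sweep_sum[of "\<lambda>n. inflow (V n) j" j "\<lambda>_. 1" "{..<N}" y] by (simp add: measurable_inflow)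
    qed
    also have "V 0 j y + \<dots> \<le> V 0 j y + sweep j (inflow G j) y"
      by (intro add_left_mono sweep_inflow_mono Suc) auto
    also have "\<dots> \<le> G j y" using G[OF Suc.prems] by (simp add: V_def)
    finally show ?case .
  qed simp
  have "(\<Sum>k\<in>UNIV. a k * occ k j y) = (\<Sum>n. V n j y)"
    unfolding V_def occ_def by (simp add: suminf_sum summableI)
  also have "\<dots> \<le> G j y" by (intro suminf_le_const summableI partial y)
  finally show ?thesis .
qed

lemma inflow_shift: "inflow (\<lambda>k u. g k (y + u)) j z = inflow g j (y + z)"
  by (simp add: inflow_def add.assoc)

lemma sweep_shift_pos:
  assumes [measurable]: "r \<in> borel_measurable borel" and "0 < v j"
  shows "sweep j (\<lambda>z. r (s + z)) y = sweep j r (s + y)"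
proof -
  have "sweep j r (s + y) = (\<integral>\<^sup>+z. indicator {s + y..} (s + 1 * z) *
     ennreal (exp (- lam j * \<bar>s + y - (s + 1 * z)\<bar>) / \<bar>v j\<bar>) * r (s + 1 * z) \<partial>lborel)"
    using assms(2) unfolding sweep_def by (subst nn_integral_real_affine[of _ 1 s]) auto
  then show ?thesis using assms(2) unfolding sweep_def
    by (auto intro!: nn_integral_cong simp: indicator_def)
qed

text \<open>The range \<open>{0..s + y}\<close> splits at \<open>s\<close>: what has been collected
  up to depth \<open>s\<close> decays by \<open>exp (- lam j * y)\<close>, the rest is the sweep of
  the shifted function.\<close>

lemma sweep_shift_neg:
  assumes [measurable]: "r \<in> borel_measurable borel" and v: "v j < 0" and s: "0 \<le> s" "0 \<le> y"
  shows "sweep j r s * ennreal (exp (- lam j * y)) + sweep j (\<lambda>z. r (s + z)) y \<le> sweep j r (s + y)"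
proof -
  let ?f = "\<lambda>z. ennreal (exp (- lam j * \<bar>s + y - z\<bar>) / \<bar>v j\<bar>) * r z"
  have "sweep j r s * ennreal (exp (- lam j * y)) = (\<integral>\<^sup>+z. indicator {0..s} z * ?f z \<partial>lborel)"
    unfolding sweep_def
  proof (subst nn_integral_multc[symmetric])
    have "indicator {0..s} z * ennreal (exp (- lam j * \<bar>s - z\<bar>) / \<bar>v j\<bar>) * r z * ennreal (exp (- lam j * y))
        = indicator {0..s} z * (ennreal (exp (- lam j * \<bar>s + y - z\<bar>) / \<bar>v j\<bar>) * r z)" for z
    proof (cases "z \<in> {0..s}")
      case True
      then have "exp (- lam j * \<bar>s + y - z\<bar>) / \<bar>v j\<bar> = exp (- lam j * \<bar>s - z\<bar>) / \<bar>v j\<bar> * exp (- lam j * y)"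
      proof -
        have "\<bar>s + y - z\<bar> = (s - z) + y" "\<bar>s - z\<bar> = s - z" using True s by auto
        then show ?thesis by (simp only: distrib_left exp_add times_divide_eq_left)
      qed
      then have "ennreal (exp (- lam j * \<bar>s + y - z\<bar>) / \<bar>v j\<bar>)
          = ennreal (exp (- lam j * \<bar>s - z\<bar>) / \<bar>v j\<bar>) * ennreal (exp (- lam j * y))"
        by (simp only: ennreal_mult'[OF exp_ge_zero] mult.commute)
      then show ?thesis by (simp only: mult_ac)
    qed simp
    then show "(\<integral>\<^sup>+z. indicator (if v j < 0 then {0..s} else {s..}) z * ennreal (exp (- lam j * \<bar>s - z\<bar>) / \<bar>v j\<bar>) *
        r z * ennreal (exp (- lam j * y)) \<partial>lborel) = (\<integral>\<^sup>+z. indicator {0..s} z * ?f z \<partial>lborel)"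
      using v by simp
  qed measurable
  moreover have "sweep j (\<lambda>z. r (s + z)) y = (\<integral>\<^sup>+z. indicator {s..s + y} z * ?f z \<partial>lborel)"
    using v by (subst nn_integral_real_affine[of _ 1 s])
      (auto intro!: nn_integral_cong simp: indicator_def sweep_def mult.assoc)
  moreover have "(\<integral>\<^sup>+z. indicator {0..s} z * ?f z \<partial>lborel) + (\<integral>\<^sup>+z. indicator {s..s + y} z * ?f z \<partial>lborel)
      = (\<integral>\<^sup>+z. indicator {0..s} z * ?f z + indicator {s..s + y} z * ?f z \<partial>lborel)"
    by (rule nn_integral_add[symmetric]) measurable
  moreover have "\<dots> \<le> (\<integral>\<^sup>+z. indicator {0..s + y} z * ?f z \<partial>lborel)"
  proof (rule nn_integral_mono_AE)
    \<comment> \<open>The two ranges overlap in \<open>s\<close> only.\<close>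
    have "AE z in lborel. z \<noteq> s" by (rule AE_lborel_singleton)
    then show "AE z in lborel. indicator {0..s} z * ?f z + indicator {s..s + y} z * ?f z \<le> indicator {0..s + y} z * ?f z"
      by eventually_elim (use s in \<open>auto simp: indicator_def\<close>)
  qed
  ultimately show ?thesis using v by (simp add: sweep_def mult.assoc)
qed

text \<open>The expected number of downward crossings of level \<open>-s\<close> in \<open>k\<close>
  is \<open>\<bar>v k\<bar> / \<bar>v i\<bar>\<close> times \<open>occ i k s\<close>, and the visits
  to \<open>j\<close> before the return to \<open>-s\<close> have density
  \<open>occ k j y / \<bar>v k\<bar>\<close>. The factors \<open>\<bar>v k\<bar>\<close> cancel, so
  no weights appear in the sum.\<close>

lemma occ_supermult:
  assumes s: "0 \<le> s" and y: "0 \<le> y"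
  shows "(\<Sum>k\<in>neg_states v. occ i k s * occ k j y) \<le> occ i j (s + y)"
proof -
  \<comment> \<open>A state with positive slope gets no source: its density is determined from below
    and not by its value at depth \<open>s\<close>.\<close>
  define a where "a k = (if v k < 0 then occ i k s else 0)" for k
  have "(\<Sum>k\<in>UNIV. a k * occ k j y) \<le> occ i j (s + y)"
  proof (rule occ_minimal[OF _ y])
    fix j and y :: real assume y: "0 \<le> y"
    have "(\<Sum>k\<in>UNIV. a k * occ_n 0 k j y) = (\<Sum>k\<in>UNIV. if k = j then a k * ennreal (exp (- lam j * y)) else 0)"
      by (intro sum.cong) auto
    then have src: "(\<Sum>k\<in>UNIV. a k * occ_n 0 k j y) = a j * ennreal (exp (- lam j * y))" by simp
    show "(\<Sum>k\<in>UNIV. a k * occ_n 0 k j y) + sweep j (inflow (\<lambda>j y. occ i j (s + y)) j) y \<le> occ i j (s + y)"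
    proof (cases "v j < 0")
      case True
      have "occ i j s * ennreal (exp (- lam j * y)) + sweep j (\<lambda>z. inflow (occ i) j (s + z)) y
        = occ_n 0 i j s * ennreal (exp (- lam j * y)) +
         (sweep j (inflow (occ i) j) s * ennreal (exp (- lam j * y)) + sweep j (\<lambda>z. inflow (occ i) j (s + z)) y)"
        by (subst occ_eq) (simp add: distrib_right add.assoc)
      also have "\<dots> \<le> occ_n 0 i j s * ennreal (exp (- lam j * y)) + sweep j (inflow (occ i) j) (s + y)"
        by (intro add_left_mono sweep_shift_neg True s y measurable_inflow measurable_occ)
      also have "occ_n 0 i j s * ennreal (exp (- lam j * y)) = occ_n 0 i j (s + y)"
        by (simp add: ennreal_mult'[symmetric] exp_add[symmetric] algebra_simps)
      finally show ?thesis using True unfolding src occ_eq[of i j "s + y", symmetric] by (simp add: a_def inflow_shift[abs_def])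
    next
      case False
      then have "0 < v j" using v_nonzero[of j] by auto
      then show ?thesis using False unfolding src
        by (subst occ_eq) (simp add: a_def inflow_shift[abs_def] sweep_shift_pos measurable_inflow)
    qed
  qed
  also have "(\<Sum>k\<in>UNIV. a k * occ k j y) = (\<Sum>k\<in>neg_states v. occ i k s * occ k j y)"
    by (intro sum.mono_neutral_cong_right) (auto simp: a_def neg_states_def)
  finally show ?thesis .
qed

text \<open>The previous bound passed through the linear operator \<open>inflow\<close>, which at
  depth \<open>z\<close> looks only at depths from \<open>z\<close> on.\<close>

lemma inflow_occ_ge:
  assumes z: "0 \<le> z"
  shows "(\<Sum>k\<in>neg_states v. occ i k z * inflow (occ k) j 0) \<le> inflow (occ i) j z"
proof -
  have "(\<Sum>k\<in>neg_states v. occ i k z * inflow (occ k) j 0)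
      = inflow (\<lambda>j y. \<Sum>k\<in>neg_states v. occ i k z * occ k j y) j 0"
    by (rule inflow_sum[symmetric]) measurable
  also have "\<dots> \<le> inflow (\<lambda>j y. occ i j (z + y)) j 0"
    by (intro inflow_mono occ_supermult z) auto
  finally show ?thesis by (simp add: inflow_shift)
qed

end

section \<open>A Gronwall inequality for extended nonnegative functions\<close>

lemma nn_integral_power_Icc:
  assumes "0 \<le> (y::real)"
  shows "(\<integral>\<^sup>+z. ennreal (z ^ n) * indicator {0..y} z \<partial>lborel) = ennreal (y ^ Suc n / real (Suc n))"
proof -
  have "(\<integral>\<^sup>+z. ennreal (z ^ n) * indicator {0..y} z \<partial>lborel) = ennreal (y ^ Suc n / real (Suc n) - 0 ^ Suc n / real (Suc n))"
  proof (rule nn_integral_FTC_Icc)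
    show "((\<lambda>z. z ^ Suc n / real (Suc n)) has_real_derivative z ^ n) (at z)" for z :: real
      by (rule DERIV_cong[OF DERIV_cdivide[OF DERIV_pow]]) simp
  qed (use assms in auto)
  then show ?thesis by simp
qed

text \<open>Iteration improves the bound \<open>B\<close> to
  \<open>B * (b * z) ^ n / fact n\<close>. Boundedness excludes functions that are infinite at all
  positive arguments and satisfy the integral inequality trivially as soon as \<open>b\<close> is
  positive.\<close>

lemma gronwall_ennreal:
  fixes m :: "real \<Rightarrow> ennreal"
  assumes bound: "\<And>z. 0 \<le> z \<Longrightarrow> z \<le> t \<Longrightarrow> m z \<le> ennreal B"
    and step: "\<And>z. 0 \<le> z \<Longrightarrow> z \<le> t \<Longrightarrow> m z \<le> ennreal b * (\<integral>\<^sup>+x. m x * indicator {0..z} x \<partial>lborel)"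
    and B: "0 \<le> B" and b: "0 \<le> b" and t: "0 \<le> t"
  shows "m t = 0"
proof -
  have "m z \<le> ennreal (B * b ^ n / fact n * z ^ n)" if "0 \<le> z" "z \<le> t" for n z
    using that
  proof (induction n arbitrary: z)
    case 0
    then show ?case using bound by simp
  next
    case (Suc n)
    have "m z \<le> ennreal b * (\<integral>\<^sup>+x. m x * indicator {0..z} x \<partial>lborel)" by (rule step[OF Suc.prems])
    also have "\<dots> \<le> ennreal b * (\<integral>\<^sup>+x. ennreal (B * b ^ n / fact n) * (ennreal (x ^ n) * indicator {0..z} x) \<partial>lborel)"
    proof (intro mult_left_mono nn_integral_mono)
      fix x :: real
      show "m x * indicator {0..z} x \<le> ennreal (B * b ^ n / fact n) * (ennreal (x ^ n) * indicator {0..z} x)"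
        using Suc.IH[of x] Suc.prems B b
        by (cases "x \<in> {0..z}") (auto simp: ennreal_mult'[symmetric])
    qed simp
    also have "\<dots> = ennreal b * (ennreal (B * b ^ n / fact n) * ennreal (z ^ Suc n / real (Suc n)))"
      by (subst nn_integral_cmult) (simp_all add: nn_integral_power_Icc Suc.prems)
    also have "\<dots> = ennreal (b * (B * b ^ n / fact n * (z ^ Suc n / real (Suc n))))"
    proof -
      have "ennreal p * (ennreal q * ennreal r) = ennreal (p * (q * r))" if "0 \<le> p" "0 \<le> q" "0 \<le> r" for p q r
        using that by (simp add: ennreal_mult)
      then show ?thesis using B b Suc.prems by simp
    qed
    also have "b * (B * b ^ n / fact n * (z ^ Suc n / real (Suc n))) = B * b ^ Suc n / fact (Suc n) * z ^ Suc n"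
      by (simp add: field_simps)
    finally show ?case .
  qed
  then have le: "m t \<le> ennreal (B * b ^ n / fact n * t ^ n)" for n using t by simp
  have "(\<lambda>n. B * (inverse (fact n) * (b * t) ^ n)) \<longlonglongrightarrow> B * 0"
    by (intro tendsto_mult tendsto_const summable_LIMSEQ_zero summable_exp)
  then have "(\<lambda>n. ennreal (B * b ^ n / fact n * t ^ n)) \<longlonglongrightarrow> ennreal 0"
    by (intro tendsto_ennrealI) (simp add: field_simps power_mult_distrib)
  then have "m t \<le> ennreal 0" by (rule LIMSEQ_le_const) (intro exI allI impI le)
  then show ?thesis by simp
qed

section \<open>Solutions of the matrix equation\<close>

context MAP_data
begin

text \<open>Bottom of the interval in which fixed points are sought. Only the diagonal of
  \<open>C\<close> can make an entry of \<open>K\<close> negative, and it contributes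
  \<open>- lam i\<close>.\<close>

definition lower :: "real^'s^'s" where
  "lower = (\<chi> i j. if i = j \<and> v i < 0 then - lam i else 0)"

text \<open>A single matrix \<open>N = K + L\<close> encodes the pair of unknowns, which occupy disjoint blocks. So the
  minimal pair becomes a least fixed point in one complete lattice interval.\<close>

definition negblock :: "real^'s^'s \<Rightarrow> real^'s^'s" where
  "negblock N = (\<chi> i j. if v i < 0 \<and> v j < 0 then N $ i $ j else 0)"

definition posblock :: "real^'s^'s \<Rightarrow> real^'s^'s" where
  "posblock N = (\<chi> i j. if v i < 0 \<and> 0 < v j then N $ i $ j else 0)"

definition flow :: "real^'s^'s \<Rightarrow> real \<Rightarrow> 's \<Rightarrow> 's \<Rightarrow> real" where
  "flow N y i j = (mat_exp (y *\<^sub>R negblock N) ** IL v (posblock N)) $ i $ j"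

text \<open>The derivative of \<open>flow N\<close> at \<open>0\<close>.\<close>

definition gen :: "real^'s^'s \<Rightarrow> 's \<Rightarrow> 's \<Rightarrow> real" where
  "gen N i j = (negblock N ** IL v (posblock N)) $ i $ j"

text \<open>The right-hand side of the matrix equation before division by the slopes, without the
  diagonal of \<open>C\<close>. In \<open>ennreal\<close> a divergent integral stays
  visible.\<close>

definition theta :: "real^'s^'s \<Rightarrow> 's \<Rightarrow> 's \<Rightarrow> ennreal" where
  "theta N i j = inflow (\<lambda>k y. ennreal (flow N y i k)) j 0"

text \<open>The matrix equation multiplied by the slope of the column state, with the diagonal of
  \<open>C\<close> turned into the term with \<open>exit_rate\<close>. Finiteness of
  \<open>theta\<close> is the integrability demand.\<close>

definition solves :: "real^'s^'s \<Rightarrow> bool" where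
  "solves N \<longleftrightarrow> lower \<le> N \<and> (\<forall>i j. \<not> v i < 0 \<longrightarrow> N $ i $ j = 0) \<and> (\<forall>i j. theta N i j < \<infinity>) \<and>
     (\<forall>i j. gen N i j * v j = exit_rate C D j * flow N 0 i j - enn2real (theta N i j))"

lemma pos_iff: "0 < v j \<longleftrightarrow> \<not> v j < 0"
  using v_nonzero[of j] by auto

lemma IL_nth: "IL v (posblock N) $ i $ j =
    (if v i < 0 then if v j < 0 then if i = j then 1 else 0 else N $ i $ j else 0)"
  by (simp add: IL_def posblock_def neg_states_def pos_iff)

lemma flow_0: "flow N 0 i j =
    (if v i < 0 then if v j < 0 then if i = j then 1 else 0 else N $ i $ j else 0)"
  by (simp add: flow_def IL_nth)

lemma vec_le_iff: "(A :: real^'s^'s) \<le> B \<longleftrightarrow> (\<forall>i j. A $ i $ j \<le> B $ i $ j)"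
  by (simp add: less_eq_vec_def)

lemma lower_le_iff: "lower \<le> N \<longleftrightarrow> (\<forall>i j. (if i = j \<and> v i < 0 then - lam i else 0) \<le> N $ i $ j)"
  by (simp add: vec_le_iff lower_def)

lemma lower_leD: "lower \<le> N \<Longrightarrow> (if i = j \<and> v i < 0 then - lam i else 0) \<le> N $ i $ j"
  by (simp only: lower_le_iff)

lemma IL_nonneg: "lower \<le> N \<Longrightarrow> 0 \<le> IL v (posblock N) $ i $ j"
  using lower_leD[of N i j] by (auto simp: IL_nth split: if_splits)

lemma flow_zero_row: "\<not> v i < 0 \<Longrightarrow> flow N y i j = 0"
  unfolding flow_def matrix_mult_nth
  by (subst mat_exp_zero_row) (simp_all add: negblock_def IL_nth if_distrib[of "\<lambda>x. x * _"] cong: if_cong)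

lemma flow_add: "flow N (z + u) i j = (\<Sum>l\<in>UNIV. mat_exp (z *\<^sub>R negblock N) $ i $ l * flow N u l j)"
  unfolding flow_def by (simp only: mat_exp_add matrix_mul_assoc[symmetric] matrix_mult_nth[of "mat_exp (z *\<^sub>R negblock N)" "_ ** _"])

lemma negblock_offdiag: "lower \<le> N \<Longrightarrow> i \<noteq> j \<Longrightarrow> 0 \<le> negblock N $ i $ j"
  by (auto simp: negblock_def lower_le_iff split: if_splits)

lemma mat_exp_neg_nonneg: "lower \<le> N \<Longrightarrow> 0 \<le> y \<Longrightarrow> 0 \<le> mat_exp (y *\<^sub>R negblock N) $ i $ j"
  by (intro mat_exp_nonneg negblock_offdiag)

lemma flow_nonneg: "lower \<le> N \<Longrightarrow> 0 \<le> y \<Longrightarrow> 0 \<le> flow N y i j"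
  unfolding flow_def matrix_mult_nth
  by (intro sum_nonneg mult_nonneg_nonneg mat_exp_neg_nonneg IL_nonneg)

lemma flow_mono:
  assumes "lower \<le> N" "N \<le> N'" "0 \<le> y"
  shows "flow N y i j \<le> flow N' y i j"
proof -
  have "mat_exp (y *\<^sub>R negblock N) $ i $ k \<le> mat_exp (y *\<^sub>R negblock N') $ i $ k" for k
    using mat_exp_mono[of "negblock N" "negblock N'" y i k] assms
    by (auto simp: negblock_offdiag) (auto simp: negblock_def vec_le_iff)
  moreover have "IL v (posblock N) $ k $ j \<le> IL v (posblock N') $ k $ j" for k
    using assms by (auto simp: IL_nth vec_le_iff)
  moreover have "lower \<le> N'" using assms by auto
  ultimately show ?thesis
    unfolding flow_def matrix_mult_nth using assms
    by (intro sum_mono mult_mono) (auto intro: mat_exp_neg_nonneg IL_nonneg)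
qed

lemma flow_has_derivative:
  "((\<lambda>y. flow N y i j) has_real_derivative (\<Sum>l\<in>UNIV. mat_exp (y *\<^sub>R negblock N) $ i $ l * gen N l j)) (at y)"
proof -
  have "((\<lambda>y. flow N y i j) has_real_derivative
      (\<Sum>k\<in>UNIV. (mat_exp (y *\<^sub>R negblock N) ** negblock N) $ i $ k * IL v (posblock N) $ k $ j)) (at y)"
    unfolding flow_def matrix_mult_nth[of "mat_exp _" "IL v _"]
    by (intro DERIV_sum DERIV_cmult_right mat_exp_has_derivative)
  also have "(\<Sum>k\<in>UNIV. (mat_exp (y *\<^sub>R negblock N) ** negblock N) $ i $ k * IL v (posblock N) $ k $ j)
      = (mat_exp (y *\<^sub>R negblock N) ** (negblock N ** IL v (posblock N))) $ i $ j"
    by (simp only: matrix_mul_assoc matrix_mult_nth[of "_ ** _" "IL v _"])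
  finally show ?thesis by (simp only: gen_def matrix_mult_nth[of "mat_exp _" "_ ** _"])
qed

lemma continuous_on_flow: "continuous_on UNIV (\<lambda>y. flow N y i j)"
  by (intro continuous_at_imp_continuous_on ballI DERIV_isCont[OF flow_has_derivative])

lemma measurable_flow [measurable]: "(\<lambda>y. flow N y i j) \<in> borel_measurable borel"
  by (rule borel_measurable_continuous_onI[OF continuous_on_flow])

lemma measurable_mat_exp_nth [measurable]: "(\<lambda>y. mat_exp (y *\<^sub>R A) $ i $ j) \<in> borel_measurable borel"
  for A :: "real^'s^'s"
  by (rule borel_measurable_continuous_onI[OF continuous_on_mat_exp_nth])

text \<open>By the semigroup property, shifting the depth by \<open>z\<close> multiplies by
  \<open>e^(zK)\<close> from the left, and the inflow at depth \<open>0\<close> of what remains is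
  \<open>theta\<close>.\<close>

lemma inflow_flow:
  assumes "lower \<le> N" "0 \<le> z"
  shows "inflow (\<lambda>k y. ennreal (flow N y i k)) j z =
    (\<Sum>l\<in>UNIV. ennreal (mat_exp (z *\<^sub>R negblock N) $ i $ l) * theta N l j)"
proof -
  have "inflow (\<lambda>k y. ennreal (flow N y i k)) j z = inflow (\<lambda>k u. ennreal (flow N (z + u) i k)) j 0"
    by (simp add: inflow_shift[of "\<lambda>k y. ennreal (flow N y i k)"])
  also have "\<dots> = inflow (\<lambda>k u. \<Sum>l\<in>UNIV. ennreal (mat_exp (z *\<^sub>R negblock N) $ i $ l) * ennreal (flow N u l k)) j 0"
    by (intro inflow_cong) (simp_all add: flow_add sum_ennreal[symmetric] ennreal_mult mat_exp_neg_nonneg flow_nonneg assms)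
  also have "\<dots> = (\<Sum>l\<in>UNIV. ennreal (mat_exp (z *\<^sub>R negblock N) $ i $ l) * theta N l j)"
    unfolding theta_def by (intro inflow_sum) measurable
  finally show ?thesis .
qed

lemma theta_zero_row: "\<not> v i < 0 \<Longrightarrow> theta N i j = 0"
  by (simp add: theta_def inflow_def flow_zero_row)

lemma theta_mono:
  assumes "lower \<le> N" "N \<le> N'"
  shows "theta N i j \<le> theta N' i j"
  unfolding theta_def using assms by (intro inflow_mono) (auto intro!: ennreal_leI flow_mono)

text \<open>The condition on \<open>f'\<close> is a linear differential equation with source
  \<open>r\<close>. An integrating factor makes the integrand of \<open>sweep\<close> a derivative,
  so the integral is a difference of boundary values.\<close>

lemma sweep_neg:
  assumes v: "v j < 0" and y: "0 \<le> y"
    and f: "\<And>z. (f has_real_derivative f' z) (at z)"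
    and f': "\<And>z. f' z * v j = exit_rate C D j * f z - r z"
    and [measurable]: "r \<in> borel_measurable borel" and r0: "\<And>z. 0 \<le> z \<Longrightarrow> 0 \<le> r z"
    and f0: "\<And>z. 0 \<le> z \<Longrightarrow> 0 \<le> f z"
  shows "ennreal (f y) = ennreal (exp (- lam j * y) * f 0) + sweep j (\<lambda>z. ennreal (r z)) y"
proof -
  have D: "((\<lambda>z. exp (- lam j * (y - z)) * f z) has_real_derivative exp (- lam j * (y - z)) / \<bar>v j\<bar> * r z) (at z)" for z
  proof -
    have "((\<lambda>z. exp (- lam j * (y - z)) * f z) has_real_derivative exp (- lam j * (y - z)) * (f' z + lam j * f z)) (at z)"
      by (auto intro!: derivative_eq_intros f simp: algebra_simps)
    also have "f' z = (exit_rate C D j * f z - r z) / v j"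
      using f'[of z] v by (simp add: field_simps)
    also have "\<dots> + lam j * f z = r z / \<bar>v j\<bar>"
      using v by (simp add: lam_def diff_divide_distrib)
    finally show ?thesis by simp
  qed
  have "sweep j (\<lambda>z. ennreal (r z)) y = (\<integral>\<^sup>+z. ennreal (exp (- lam j * (y - z)) / \<bar>v j\<bar> * r z) * indicator {0..y} z \<partial>lborel)"
  proof -
    have "indicator {0..y} z * ennreal (exp (- lam j * \<bar>y - z\<bar>) / \<bar>v j\<bar>) * ennreal (r z)
        = ennreal (exp (- lam j * (y - z)) / \<bar>v j\<bar> * r z) * indicator {0..y} z" for z
    proof (cases "z \<in> {0..y}")
      case True
      then have "\<bar>y - z\<bar> = y - z" by simp
      then show ?thesis using True by (subst ennreal_mult') simp_all
    qed simp
    then show ?thesis using v by (simp add: sweep_def)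
  qed
  also have "\<dots> = ennreal (exp (- lam j * (y - y)) * f y - exp (- lam j * (y - 0)) * f 0)"
    using D by (rule nn_integral_FTC_Icc[rotated]) (use y r0 in auto)
  finally have s: "sweep j (\<lambda>z. ennreal (r z)) y = ennreal (f y - exp (- lam j * y) * f 0)" by simp
  \<comment> \<open>The subtraction in \<open>ennreal\<close> truncates nothing, because the
    function with the integrating factor increases.\<close>
  have "exp (- lam j * (y - 0)) * f 0 \<le> exp (- lam j * (y - y)) * f y"
    by (rule DERIV_nonneg_imp_nondecreasing[OF y]) (use D r0 in \<open>auto intro!: exI conjI\<close>)
  then have "exp (- lam j * y) * f 0 \<le> f y" by simp
  then show ?thesis unfolding s using f0[of 0] by (subst ennreal_plus[symmetric]) auto
qed

text \<open>The analogous integrating factor, integrated from \<open>y\<close> to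
  \<open>y + n\<close>. The boundary term at the upper end enters with a minus sign and is dropped;
  this is the only loss and the reason for an inequality.\<close>

lemma sweep_pos:
  assumes v: "0 < v j" and y: "0 \<le> y"
    and f: "\<And>z. (f has_real_derivative f' z) (at z)"
    and f': "\<And>z. f' z * v j = exit_rate C D j * f z - r z"
    and [measurable]: "r \<in> borel_measurable borel" and r0: "\<And>z. 0 \<le> z \<Longrightarrow> 0 \<le> r z"
    and f0: "\<And>z. 0 \<le> z \<Longrightarrow> 0 \<le> f z"
  shows "sweep j (\<lambda>z. ennreal (r z)) y \<le> ennreal (f y)"
proof -
  let ?g = "\<lambda>z. ennreal (exp (- lam j * (z - y)) / \<bar>v j\<bar> * r z)"
  have D: "((\<lambda>z. - (exp (- lam j * (z - y)) * f z)) has_real_derivative exp (- lam j * (z - y)) / \<bar>v j\<bar> * r z) (at z)" for z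
  proof -
    have "((\<lambda>z. - (exp (- lam j * (z - y)) * f z)) has_real_derivative exp (- lam j * (z - y)) * (lam j * f z - f' z)) (at z)"
      by (auto intro!: derivative_eq_intros f simp: algebra_simps)
    also have "lam j * f z - f' z = r z / \<bar>v j\<bar>"
      using f'[of z] v by (simp add: lam_def field_simps)
    finally show ?thesis by simp
  qed
  have "sweep j (\<lambda>z. ennreal (r z)) y = emeasure (density lborel ?g) {y..}"
  proof -
    have "indicator {y..} z * ennreal (exp (- lam j * \<bar>y - z\<bar>) / \<bar>v j\<bar>) * ennreal (r z) = ?g z * indicator {y..} z" for z
    proof (cases "z \<in> {y..}")
      case True
      then have "\<bar>y - z\<bar> = z - y" by simp
      then show ?thesis using True by (subst ennreal_mult') simp_all
    qed simp
    then show ?thesis using v by (simp add: sweep_def emeasure_density)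
  qed
  also have "{y..} = (\<Union>n. {y..y + real n})"
  proof -
    have "\<exists>n. z \<le> y + real n" for z
      using real_arch_simple[of "z - y"] by (auto simp: algebra_simps)
    then show ?thesis by auto
  qed
  also have "emeasure (density lborel ?g) (\<Union>n. {y..y + real n}) = (SUP n. emeasure (density lborel ?g) {y..y + real n})"
    by (intro SUP_emeasure_incseq[symmetric]) (auto simp: incseq_def)
  also have "\<dots> \<le> ennreal (f y)"
  proof (rule SUP_least)
    fix n
    have "emeasure (density lborel ?g) {y..y + real n} = (\<integral>\<^sup>+z. ?g z * indicator {y..y + real n} z \<partial>lborel)"
      by (simp add: emeasure_density)
    also have "\<dots> = ennreal (- (exp (- lam j * (y + real n - y)) * f (y + real n)) - - (exp (- lam j * (y - y)) * f y))"
      using D by (rule nn_integral_FTC_Icc[rotated]) (use r0 y in auto)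
    also have "\<dots> \<le> ennreal (f y)" using f0[of "y + real n"] y by (intro ennreal_leI) simp
    finally show "emeasure (density lborel ?g) {y..y + real n} \<le> ennreal (f y)" .
  qed
  finally show ?thesis .
qed

lemma sweep_cong: "(\<And>z. 0 \<le> z \<Longrightarrow> r z = s z) \<Longrightarrow> 0 \<le> y \<Longrightarrow> sweep j r y = sweep j s y"
  by (intro antisym sweep_mono) auto

lemma occ_le_flow:
  assumes sol: "solves N" and i: "v i < 0" and y: "0 \<le> y"
  shows "occ i j y \<le> ennreal (flow N y i j)"
proof -
  have low: "lower \<le> N" using sol by (simp add: solves_def)
  have "(\<Sum>k\<in>UNIV. (if k = i then 1 else 0) * occ k j y) \<le> ennreal (flow N y i j)"
  proof (rule occ_minimal[OF _ y])
    fix j and y :: real assume y: "0 \<le> y"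
    define r where "r z = (\<Sum>l\<in>UNIV. mat_exp (z *\<^sub>R negblock N) $ i $ l * enn2real (theta N l j))" for z
    have r0: "0 \<le> r z" if "0 \<le> z" for z
      unfolding r_def using that low by (intro sum_nonneg mult_nonneg_nonneg mat_exp_neg_nonneg) auto
    have mr [measurable]: "r \<in> borel_measurable borel" unfolding r_def by measurable
    have "inflow (\<lambda>k y. ennreal (flow N y i k)) j z = ennreal (r z)" if "0 \<le> z" for z
      unfolding inflow_flow[OF low that] r_def using sol that low
      by (simp add: sum_ennreal[symmetric] mat_exp_neg_nonneg ennreal_mult solves_def)
    then have sw: "sweep j (inflow (\<lambda>k y. ennreal (flow N y i k)) j) y = sweep j (\<lambda>z. ennreal (r z)) y"
      using y by (intro sweep_cong) auto
    \<comment> \<open>The equation for \<open>N\<close> multiplied by \<open>e^(zK)\<close> from the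
      left, where \<open>K\<close> is the negative block of \<open>N\<close>.\<close>
    have f': "(\<Sum>l\<in>UNIV. mat_exp (z *\<^sub>R negblock N) $ i $ l * gen N l j) * v j = exit_rate C D j * flow N z i j - r z" for z
    proof -
      have "(\<Sum>l\<in>UNIV. mat_exp (z *\<^sub>R negblock N) $ i $ l * gen N l j) * v j
          = (\<Sum>l\<in>UNIV. mat_exp (z *\<^sub>R negblock N) $ i $ l * (exit_rate C D j * flow N 0 l j - enn2real (theta N l j)))"
        using sol by (simp add: solves_def sum_distrib_right mult.assoc)
      also have "\<dots> = exit_rate C D j * flow N (z + 0) i j - r z"
        unfolding flow_add by (simp add: r_def right_diff_distrib sum_subtractf sum_distrib_left mult_ac)
      finally show ?thesis by simp
    qed
    have src: "(\<Sum>k\<in>UNIV. (if k = i then 1 else 0) * occ_n 0 k j y) = occ_n 0 i j y"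
      by (simp add: if_distrib[of "\<lambda>x. x * _"] cong: if_cong del: occ_n.simps)
    show "(\<Sum>k\<in>UNIV. (if k = i then 1 else 0) * occ_n 0 k j y) + sweep j (inflow (\<lambda>j y. ennreal (flow N y i j)) j) y
        \<le> ennreal (flow N y i j)"
    proof (cases "v j < 0")
      case True
      then show ?thesis
        unfolding src sw using sweep_neg[OF True y flow_has_derivative f' mr r0 flow_nonneg[OF low]] i
        by (simp add: flow_0)
    next
      case False
      then have "0 < v j" "i \<noteq> j" using i by (auto simp: pos_iff)
      then show ?thesis
        unfolding src sw using sweep_pos[OF _ y flow_has_derivative f' mr r0 flow_nonneg[OF low]]
        by simp
    qed
  qed
  then show ?thesis by (simp add: if_distrib[of "\<lambda>x. x * _"] cong: if_cong)
qed

end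

section \<open>The matrix read off from the occupation densities\<close>

lemma le_add_diff_self_ennreal: "a \<le> b + (a - b)" for a b :: ennreal
  unfolding add_diff_self_ennreal by auto

context MAP_data
begin

text \<open>The pair \<open>(K', L')\<close> of the overview. Its negative block is what formal
  differentiation of the balance equation at depth \<open>0\<close> yields. The conversion
  \<open>enn2real\<close> is harmless once a solution exists, because the values are then
  finite.\<close>

definition occ_mat :: "real^'s^'s" where
  "occ_mat = (\<chi> i j. if v i < 0
     then if v j < 0 then enn2real (inflow (occ i) j 0) / \<bar>v j\<bar> - (if i = j then lam i else 0)
          else enn2real (occ i j 0)
     else 0)"

lemma solves_eq:
  "solves N \<Longrightarrow> gen N i j * v j = exit_rate C D j * flow N 0 i j - enn2real (theta N i j)"
  by (simp only: solves_def)

lemma lower_le_occ_mat: "lower \<le> occ_mat"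
proof -
  have "0 \<le> enn2real (inflow (occ i) j 0) / \<bar>v j\<bar>" for i j by simp
  then show ?thesis by (auto simp: lower_le_iff occ_mat_def divide_nonneg_neg)
qed

lemma gen_neg: "v j < 0 \<Longrightarrow> gen N i j = negblock N $ i $ j"
  unfolding gen_def matrix_mult_nth
  by (subst sum.cong[OF refl, of _ _ "\<lambda>k. if k = j then negblock N $ i $ k else 0"])
    (auto simp: IL_nth negblock_def)

lemma gen_pos: "\<not> v j < 0 \<Longrightarrow> gen N i j = (\<Sum>k\<in>neg_states v. negblock N $ i $ k * N $ k $ j)"
  unfolding gen_def matrix_mult_nth
  by (intro sum.mono_neutral_cong_right) (auto simp: IL_nth neg_states_def)

lemma inflow_occ_le_theta:
  assumes "solves H" "v i < 0"
  shows "inflow (occ i) j 0 \<le> theta H i j"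
  unfolding theta_def using occ_le_flow[OF assms] by (intro inflow_mono) auto

lemma inflow_occ_finite:
  assumes "solves H" "v i < 0"
  shows "inflow (occ i) j 0 < \<infinity>"
proof -
  have "theta H i j < \<infinity>" using assms(1) by (simp add: solves_def)
  with inflow_occ_le_theta[OF assms, of j] show ?thesis by (rule le_less_trans)
qed

lemma occ_finite:
  assumes "solves H" "v i < 0" "0 \<le> y"
  shows "occ i j y < \<infinity>"
  using occ_le_flow[OF assms, of j] by (rule le_less_trans) simp

text \<open>A solution has the same form with \<open>theta H\<close> in place of the inflow and
  \<open>flow H 0\<close> in place of \<open>occ\<close>, and \<open>occ\<close> lies below the flow
  of \<open>H\<close>.\<close>

lemma occ_mat_le:
  assumes H: "solves H"
  shows "occ_mat \<le> H"
  unfolding vec_le_iff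
proof (intro allI)
  fix i j
  show "occ_mat $ i $ j \<le> H $ i $ j"
  proof (cases "v i < 0")
    case i: True
    show ?thesis
    proof (cases "v j < 0")
      case True
      have "H $ i $ j * v j = exit_rate C D j * (if i = j then 1 else 0) - enn2real (theta H i j)"
        using solves_eq[OF H, of i j] i True gen_neg[OF True, of H i] by (simp add: flow_0 negblock_def)
      then have "H $ i $ j = enn2real (theta H i j) / \<bar>v j\<bar> - (if i = j then lam i else 0)"
        using True by (auto simp: lam_def field_simps)
      moreover have "enn2real (inflow (occ i) j 0) \<le> enn2real (theta H i j)"
        using H inflow_occ_le_theta[OF H i] by (intro enn2real_mono) (auto simp: solves_def)
      ultimately show ?thesis using i True by (simp add: occ_mat_def divide_right_mono_neg)
    next
      case False
      have "enn2real (occ i j 0) \<le> enn2real (ennreal (flow H 0 i j))"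
        using occ_le_flow[OF H i, of 0 j] by (intro enn2real_mono) auto
      moreover have "0 \<le> H $ i $ j"
      proof -
        have "lower \<le> H" "i \<noteq> j" using H i False by (auto simp: solves_def)
        then show ?thesis using lower_leD[of H i j] by simp
      qed
      ultimately show ?thesis using i False by (simp add: occ_mat_def flow_0)
    qed
  qed (use H in \<open>simp add: occ_mat_def solves_def\<close>)
qed

text \<open>The lower bound of \<open>inflow_occ_ge\<close> with \<open>occ\<close> replaced by the
  semigroup that the negative block of \<open>occ_mat\<close> generates.\<close>

definition occ_rate :: "real \<Rightarrow> 's \<Rightarrow> 's \<Rightarrow> real" where
  "occ_rate z i j = (\<Sum>k\<in>neg_states v. mat_exp (z *\<^sub>R negblock occ_mat) $ i $ k * enn2real (inflow (occ k) j 0))"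

lemma occ_rate_nonneg: "0 \<le> z \<Longrightarrow> 0 \<le> occ_rate z i j"
  unfolding occ_rate_def
  by (intro sum_nonneg mult_nonneg_nonneg mat_exp_neg_nonneg lower_le_occ_mat) auto

lemma continuous_on_occ_rate: "continuous_on UNIV (\<lambda>z. occ_rate z i j)"
  unfolding occ_rate_def by (intro continuous_intros continuous_on_mat_exp_nth)

lemma measurable_occ_rate [measurable]: "(\<lambda>z. occ_rate z i j) \<in> borel_measurable borel"
  by (rule borel_measurable_continuous_onI[OF continuous_on_occ_rate])

lemma ennreal_occ_rate:
  assumes "solves H" "0 \<le> z"
  shows "ennreal (occ_rate z i j) =
    (\<Sum>k\<in>neg_states v. ennreal (mat_exp (z *\<^sub>R negblock occ_mat) $ i $ k) * inflow (occ k) j 0)"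
proof -
  have "ennreal (occ_rate z i j) = (\<Sum>k\<in>neg_states v. ennreal (mat_exp (z *\<^sub>R negblock occ_mat) $ i $ k * enn2real (inflow (occ k) j 0)))"
    unfolding occ_rate_def using assms
    by (subst sum_ennreal) (auto intro!: mult_nonneg_nonneg mat_exp_neg_nonneg lower_le_occ_mat)
  also have "\<dots> = (\<Sum>k\<in>neg_states v. ennreal (mat_exp (z *\<^sub>R negblock occ_mat) $ i $ k) * inflow (occ k) j 0)"
    using inflow_occ_finite[OF assms(1)] assms(2)
    by (intro sum.cong) (auto simp: ennreal_mult mat_exp_neg_nonneg lower_le_occ_mat neg_states_def)
  finally show ?thesis .
qed

text \<open>The diagonal correction in \<open>occ_mat\<close> is chosen so that the equation
  \<open>E' = E K'\<close> of the semigroup becomes the differential equation of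
  \<open>sweep_neg\<close> with source \<open>occ_rate\<close>.\<close>

lemma mat_exp_occ_mat_eq:
  assumes H: "solves H" and i: "v i < 0" and j: "v j < 0" and y: "0 \<le> y"
  shows "ennreal (mat_exp (y *\<^sub>R negblock occ_mat) $ i $ j) =
    occ_n 0 i j y + sweep j (\<lambda>z. ennreal (occ_rate z i j)) y"
proof -
  let ?E = "\<lambda>z. mat_exp (z *\<^sub>R negblock occ_mat)"
  have "(?E z ** negblock occ_mat) $ i $ j * v j = exit_rate C D j * ?E z $ i $ j - occ_rate z i j" for z
  proof -
    have "(?E z ** negblock occ_mat) $ i $ j * v j = (\<Sum>k\<in>neg_states v. ?E z $ i $ k * (occ_mat $ k $ j * v j))"
      unfolding matrix_mult_nth sum_distrib_right using j
      by (intro sum.mono_neutral_cong_right) (auto simp: negblock_def neg_states_def)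
    also have "\<dots> = (\<Sum>k\<in>neg_states v. (if k = j then exit_rate C D j * ?E z $ i $ k else 0)
        - ?E z $ i $ k * enn2real (inflow (occ k) j 0))"
      using j by (intro sum.cong refl) (auto simp: occ_mat_def neg_states_def lam_def field_simps)
    also have "\<dots> = exit_rate C D j * ?E z $ i $ j - occ_rate z i j"
      using j by (simp add: sum_subtractf occ_rate_def neg_states_def)
    finally show ?thesis .
  qed
  from sweep_neg[OF j y mat_exp_has_derivative this measurable_occ_rate occ_rate_nonneg
      mat_exp_neg_nonneg[OF lower_le_occ_mat]]
  show ?thesis by (simp add: mat_def)
qed

text \<open>The semigroup satisfies the balance equation with an inflow that is at most the true one
  plus a finite constant times the total deficit \<open>m\<close>. So the deficit is controlled by
  its own integral and vanishes by Gronwall.\<close>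

lemma mat_exp_le_occ:
  assumes H: "solves H" and i: "v i < 0" and j: "v j < 0" and t: "0 \<le> t"
  shows "ennreal (mat_exp (t *\<^sub>R negblock occ_mat) $ i $ j) \<le> occ i j t"
proof -
  let ?E = "\<lambda>z. mat_exp (z *\<^sub>R negblock occ_mat)"
  \<comment> \<open>A truncated difference: it is \<open>0\<close> where the semigroup is dominated,
    so only the deficit is measured.\<close>
  define d where "d j z = ennreal (?E z $ i $ j) - occ i j z" for j z
  define m where "m z = (\<Sum>j\<in>neg_states v. d j z)" for z
  define R where "R j = (\<Sum>k\<in>neg_states v. inflow (occ k) j 0)" for j
  have md [measurable]: "d j \<in> borel_measurable borel" for j unfolding d_def by measurable
  have mm [measurable]: "m \<in> borel_measurable borel" unfolding m_def by measurable
  have dm: "d j z \<le> m z" if "v j < 0" for j z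
    unfolding m_def using that by (intro member_le_sum) (auto simp: neg_states_def)
  have d_le: "d j z \<le> ennreal (1 / \<bar>v j\<bar>) * R j * (\<integral>\<^sup>+x. m x * indicator {0..z} x \<partial>lborel)"
    if j: "v j < 0" and z: "0 \<le> z" for j z
  proof -
    let ?O = "\<lambda>z. \<Sum>k\<in>neg_states v. occ i k z * inflow (occ k) j 0"
    have "ennreal (?E z $ i $ j) = occ_n 0 i j z + sweep j (\<lambda>z. ennreal (occ_rate z i j)) z"
      by (rule mat_exp_occ_mat_eq[OF H i j z])
    also have "sweep j (\<lambda>z. ennreal (occ_rate z i j)) z \<le> sweep j (\<lambda>x. inflow (occ i) j x + m x * R j) z"
    proof (rule sweep_mono[OF _ z])
      fix x :: real assume x: "0 \<le> x"
      have "ennreal (occ_rate x i j) \<le> (\<Sum>k\<in>neg_states v. (occ i k x + m x) * inflow (occ k) j 0)"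
        unfolding ennreal_occ_rate[OF H x]
      proof (intro sum_mono mult_right_mono)
        fix k assume "k \<in> neg_states v"
        then have k: "v k < 0" by (simp add: neg_states_def)
        have "ennreal (?E x $ i $ k) \<le> occ i k x + d k x" unfolding d_def
          by (rule le_add_diff_self_ennreal)
        also have "\<dots> \<le> occ i k x + m x" using dm[OF k] by (intro add_left_mono)
        finally show "ennreal (?E x $ i $ k) \<le> occ i k x + m x" .
      qed simp
      also have "\<dots> = ?O x + m x * R j"
        by (simp add: distrib_right sum.distrib sum_distrib_left R_def)
      also have "\<dots> \<le> inflow (occ i) j x + m x * R j"
        by (intro add_right_mono inflow_occ_ge x)
      finally show "ennreal (occ_rate x i j) \<le> inflow (occ i) j x + m x * R j" .
    qed
    also have "sweep j (\<lambda>x. inflow (occ i) j x + m x * R j) z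
        = sweep j (inflow (occ i) j) z + sweep j (\<lambda>x. m x * R j) z"
      unfolding sweep_def by (subst nn_integral_add[symmetric]) (auto simp: distrib_left intro!: measurable_inflow)
    also have "occ_n 0 i j z + (sweep j (inflow (occ i) j) z + sweep j (\<lambda>x. m x * R j) z)
        = occ i j z + sweep j (\<lambda>x. m x * R j) z"
      unfolding occ_eq[of i j z] by (simp only: add.assoc)
    finally have "ennreal (?E z $ i $ j) \<le> occ i j z + sweep j (\<lambda>x. m x * R j) z" by (simp add: add_left_mono)
    then have "d j z \<le> sweep j (\<lambda>x. m x * R j) z"
      unfolding d_def using occ_finite[OF H i z, of j]
      by (subst ennreal_minus_le_iff) auto
    also have "\<dots> \<le> (\<integral>\<^sup>+x. ennreal (1 / \<bar>v j\<bar>) * R j * (m x * indicator {0..z} x) \<partial>lborel)"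
      unfolding sweep_def
    proof (rule nn_integral_mono)
      fix x
      \<comment> \<open>The exponential factor only helps and is replaced by
        \<open>1\<close>.\<close>
      have "ennreal (exp (- lam j * \<bar>z - x\<bar>) / \<bar>v j\<bar>) \<le> ennreal (1 / \<bar>v j\<bar>)"
        using lam_pos[of j] by (intro ennreal_leI divide_right_mono) auto
      then have "ennreal (exp (- lam j * \<bar>z - x\<bar>) / \<bar>v j\<bar>) * (m x * R j) \<le> ennreal (1 / \<bar>v j\<bar>) * (m x * R j)"
        by (rule mult_right_mono) simp
      then show "indicator (if v j < 0 then {0..z} else {z..}) x * ennreal (exp (- lam j * \<bar>z - x\<bar>) / \<bar>v j\<bar>) * (m x * R j)
          \<le> ennreal (1 / \<bar>v j\<bar>) * R j * (m x * indicator {0..z} x)"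
        using j by (auto simp: indicator_def mult_ac)
    qed
    also have "\<dots> = ennreal (1 / \<bar>v j\<bar>) * R j * (\<integral>\<^sup>+x. m x * indicator {0..z} x \<partial>lborel)"
      by (rule nn_integral_cmult) measurable
    finally show ?thesis .
  qed
  define b where "b = (\<Sum>j\<in>neg_states v. ennreal (1 / \<bar>v j\<bar>) * R j)"
  have "b < \<infinity>"
    unfolding b_def R_def using inflow_occ_finite[OF H]
    by (auto simp: ennreal_mult_less_top neg_states_def)
  then obtain b' where b': "b = ennreal b'" "0 \<le> b'" by (cases b) auto
  have step: "m z \<le> ennreal b' * (\<integral>\<^sup>+x. m x * indicator {0..z} x \<partial>lborel)" if "0 \<le> z" for z
    unfolding b'(1)[symmetric] b_def sum_distrib_right m_def[of z]
    using d_le[OF _ that] by (intro sum_mono) (auto simp: neg_states_def)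
  \<comment> \<open>The a priori bound for Gronwall: a continuous function on \<open>{0..t}\<close>
    is bounded, and the deficit never exceeds the semigroup.\<close>
  have "compact ((\<lambda>z. \<Sum>j\<in>neg_states v. ?E z $ i $ j) ` {0..t})"
    by (intro compact_continuous_image continuous_intros continuous_on_subset[OF continuous_on_mat_exp_nth]) auto
  then have "bounded ((\<lambda>z. \<Sum>j\<in>neg_states v. ?E z $ i $ j) ` {0..t})"
    by (rule compact_imp_bounded)
  then obtain B where "\<forall>x\<in>(\<lambda>z. \<Sum>j\<in>neg_states v. ?E z $ i $ j) ` {0..t}. norm x \<le> B"
    unfolding bounded_iff ..
  then have B: "norm (\<Sum>j\<in>neg_states v. ?E z $ i $ j) \<le> B" if "z \<in> {0..t}" for z
    using that by blast
  have B0: "0 \<le> B" using B[of 0] t by (auto intro: order_trans[OF abs_ge_zero])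
  have bound: "m z \<le> ennreal B" if "0 \<le> z" "z \<le> t" for z
  proof -
    have "m z \<le> (\<Sum>j\<in>neg_states v. ennreal (?E z $ i $ j))"
      unfolding m_def d_def by (intro sum_mono diff_le_self_ennreal)
    also have "\<dots> = ennreal (\<Sum>j\<in>neg_states v. ?E z $ i $ j)"
      using that by (intro sum_ennreal mat_exp_neg_nonneg lower_le_occ_mat)
    also have "\<dots> \<le> ennreal B" using B[of z] that by (intro ennreal_leI) auto
    finally show ?thesis .
  qed
  have "m t = 0" using gronwall_ennreal[OF bound step B0 b'(2) t] by simp
  then have "ennreal (?E t $ i $ j) - occ i j t = 0"
    using dm[OF j, of t] by (simp only: d_def le_zero_eq)
  moreover have "ennreal (?E t $ i $ j) \<le> occ i j t + (ennreal (?E t $ i $ j) - occ i j t)"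
    by (rule le_add_diff_self_ennreal)
  ultimately show ?thesis by (simp only: add_0_right)
qed

text \<open>In columns of negative slope this is the previous bound. In the others
  \<open>flow\<close> multiplies the semigroup by values of \<open>occ\<close> at depth
  \<open>0\<close>, and supermultiplicativity with second depth \<open>0\<close> applies.\<close>

lemma flow_le_occ:
  assumes H: "solves H" and i: "v i < 0" and y: "0 \<le> y"
  shows "ennreal (flow occ_mat y i j) \<le> occ i j y"
proof (cases "v j < 0")
  case True
  have "flow occ_mat y i j = mat_exp (y *\<^sub>R negblock occ_mat) $ i $ j"
    using True unfolding flow_def matrix_mult_nth
    by (subst sum.cong[OF refl, of _ _ "\<lambda>k. if k = j then mat_exp (y *\<^sub>R negblock occ_mat) $ i $ k else 0"])
      (auto simp: IL_nth)
  then show ?thesis using mat_exp_le_occ[OF H i True y] by simp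
next
  case False
  let ?E = "mat_exp (y *\<^sub>R negblock occ_mat)"
  have e: "flow occ_mat y i j = (\<Sum>k\<in>neg_states v. ?E $ i $ k * occ_mat $ k $ j)"
    unfolding flow_def matrix_mult_nth using False
    by (intro sum.mono_neutral_cong_right) (auto simp: IL_nth neg_states_def)
  have "ennreal (flow occ_mat y i j) = (\<Sum>k\<in>neg_states v. ennreal (?E $ i $ k * occ_mat $ k $ j))"
    unfolding e using False y by (intro sum_ennreal[symmetric] mult_nonneg_nonneg mat_exp_neg_nonneg lower_le_occ_mat)
      (auto simp: occ_mat_def)
  also have "\<dots> \<le> (\<Sum>k\<in>neg_states v. occ i k y * occ k j 0)"
  proof (rule sum_mono)
    fix k assume "k \<in> neg_states v"
    then have k: "v k < 0" by (simp add: neg_states_def)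
    have "occ k j 0 = ennreal (occ_mat $ k $ j)"
      using k False occ_finite[OF H k, of 0 j] by (simp add: occ_mat_def)
    then have "ennreal (?E $ i $ k * occ_mat $ k $ j) = ennreal (?E $ i $ k) * occ k j 0"
      by (simp only: ennreal_mult'[OF mat_exp_neg_nonneg[OF lower_le_occ_mat y]])
    also have "\<dots> \<le> occ i k y * occ k j 0" by (intro mult_right_mono mat_exp_le_occ[OF H i k y]) simp
    finally show "ennreal (?E $ i $ k * occ_mat $ k $ j) \<le> occ i k y * occ k j 0" .
  qed
  also have "\<dots> \<le> occ i j (y + 0)" by (rule occ_supermult[OF y]) simp
  finally show ?thesis by simp
qed

lemma theta_occ_mat_le:
  assumes "solves H" "v i < 0"
  shows "theta occ_mat i j \<le> inflow (occ i) j 0"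
  unfolding theta_def using flow_le_occ[OF assms] by (intro inflow_mono) auto

text \<open>The pre-fixed point inequality in the columns of positive slope. Splitting the sweep
  from below at depth \<open>t\<close> writes \<open>occ i j 0\<close> as
  \<open>exp (- lam j * t)\<close> times \<open>occ i j t\<close> plus the part collected in
  \<open>{0..<t}\<close>. The densities are replaced by the smaller \<open>flow\<close> and
  \<open>occ_rate\<close>, and the result is differentiated at \<open>t = 0\<close>.\<close>

lemma occ_mat_super_pos:
  assumes H: "solves H" and i: "v i < 0" and j: "0 < v j"
  shows "gen occ_mat i j + enn2real (inflow (occ i) j 0) / v j \<le> lam j * occ_mat $ i $ j"
proof -
  let ?f = "\<lambda>t. flow occ_mat t i j"
  have nj: "\<not> v j < 0" and ij: "i \<noteq> j" using i j by auto
  have f0: "?f 0 = occ_mat $ i $ j" using i nj by (simp add: flow_0)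
  have occ0: "occ i j 0 = ennreal (occ_mat $ i $ j)"
    using i nj occ_finite[OF H i, of 0 j] by (simp add: occ_mat_def)
  have occ_sweep: "occ i j t = sweep j (inflow (occ i) j) t" for t
    using ij by (subst occ_eq) simp
  have rate0: "occ_rate 0 i j = enn2real (inflow (occ i) j 0)"
    unfolding occ_rate_def using i
    by (subst sum.cong[OF refl, of _ _ "\<lambda>k. if k = i then enn2real (inflow (occ k) j 0) else 0"])
      (auto simp: mat_def neg_states_def)
  \<comment> \<open>The true inflow is not known to be continuous, so it is replaced by
    \<open>occ_rate\<close> before any limit is taken.\<close>
  have split: "ennreal (exp (- lam j * t)) * occ i j t
      + (\<integral>\<^sup>+z. indicator {0..<t} z * ennreal (exp (- lam j * z) / v j * occ_rate z i j) \<partial>lborel) \<le> occ i j 0"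
    if t: "0 \<le> t" for t
  proof -
    let ?r = "inflow (occ i) j"
    have mr [measurable]: "?r \<in> borel_measurable borel" by (intro measurable_inflow measurable_occ)
    have "ennreal (exp (- lam j * t)) * occ i j t
       = (\<integral>\<^sup>+z. ennreal (exp (- lam j * t)) * (indicator {t..} z * ennreal (exp (- lam j * \<bar>t - z\<bar>) / \<bar>v j\<bar>) * ?r z) \<partial>lborel)"
      unfolding occ_sweep sweep_def using nj by (subst nn_integral_cmult) simp_all
    also have "\<dots> = (\<integral>\<^sup>+z. indicator {t..} z * (ennreal (exp (- lam j * z) / v j) * ?r z) \<partial>lborel)"
    proof (rule nn_integral_cong)
      fix z
      show "ennreal (exp (- lam j * t)) * (indicator {t..} z * ennreal (exp (- lam j * \<bar>t - z\<bar>) / \<bar>v j\<bar>) * ?r z)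
        = indicator {t..} z * (ennreal (exp (- lam j * z) / v j) * ?r z)"
      proof (cases "z \<in> {t..}")
        case True
        then have "exp (- lam j * t) * (exp (- lam j * \<bar>t - z\<bar>) / \<bar>v j\<bar>) = exp (- lam j * z) / v j"
          using j by (simp add: exp_add[symmetric] algebra_simps)
        then have "ennreal (exp (- lam j * t)) * ennreal (exp (- lam j * \<bar>t - z\<bar>) / \<bar>v j\<bar>) = ennreal (exp (- lam j * z) / v j)"
          by (subst ennreal_mult'[symmetric]) simp_all
        then show ?thesis using True by (simp only: mult.assoc[symmetric] indicator_simps mult_1_left mult_1_right)
      qed simp
    qed
    finally have 1: "ennreal (exp (- lam j * t)) * occ i j t = (\<integral>\<^sup>+z. indicator {t..} z * (ennreal (exp (- lam j * z) / v j) * ?r z) \<partial>lborel)" .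
    have 2: "(\<integral>\<^sup>+z. indicator {0..<t} z * ennreal (exp (- lam j * z) / v j * occ_rate z i j) \<partial>lborel)
        \<le> (\<integral>\<^sup>+z. indicator {0..<t} z * (ennreal (exp (- lam j * z) / v j) * ?r z) \<partial>lborel)"
    proof (rule nn_integral_mono)
      fix z
      show "indicator {0..<t} z * ennreal (exp (- lam j * z) / v j * occ_rate z i j)
        \<le> indicator {0..<t} z * (ennreal (exp (- lam j * z) / v j) * ?r z)"
      proof (cases "z \<in> {0..<t}")
        case True
        then have z: "0 \<le> z" by simp
        have "ennreal (occ_rate z i j) \<le> (\<Sum>k\<in>neg_states v. occ i k z * inflow (occ k) j 0)"
          unfolding ennreal_occ_rate[OF H z]
          by (intro sum_mono mult_right_mono mat_exp_le_occ[OF H i _ z]) (auto simp: neg_states_def)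
        also have "\<dots> \<le> ?r z" by (rule inflow_occ_ge[OF z])
        finally have "ennreal (exp (- lam j * z) / v j) * ennreal (occ_rate z i j) \<le> ennreal (exp (- lam j * z) / v j) * ?r z"
          by (rule mult_left_mono) simp
        moreover have "ennreal (exp (- lam j * z) / v j * occ_rate z i j) = ennreal (exp (- lam j * z) / v j) * ennreal (occ_rate z i j)"
          using j by (intro ennreal_mult') simp
        ultimately have "ennreal (exp (- lam j * z) / v j * occ_rate z i j) \<le> ennreal (exp (- lam j * z) / v j) * ?r z"
          by (simp only:)
        then show ?thesis using True by (simp only: indicator_simps mult_1_left)
      qed simp
    qed
    have "ennreal (exp (- lam j * t)) * occ i j t
        + (\<integral>\<^sup>+z. indicator {0..<t} z * ennreal (exp (- lam j * z) / v j * occ_rate z i j) \<partial>lborel)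
      \<le> (\<integral>\<^sup>+z. indicator {t..} z * (ennreal (exp (- lam j * z) / v j) * ?r z) \<partial>lborel)
       + (\<integral>\<^sup>+z. indicator {0..<t} z * (ennreal (exp (- lam j * z) / v j) * ?r z) \<partial>lborel)"
      unfolding 1 by (intro add_left_mono 2)
    also have "(\<integral>\<^sup>+z. indicator {t..} z * (ennreal (exp (- lam j * z) / v j) * ?r z) \<partial>lborel)
       + (\<integral>\<^sup>+z. indicator {0..<t} z * (ennreal (exp (- lam j * z) / v j) * ?r z) \<partial>lborel)
       = (\<integral>\<^sup>+z. indicator {t..} z * (ennreal (exp (- lam j * z) / v j) * ?r z) +
            indicator {0..<t} z * (ennreal (exp (- lam j * z) / v j) * ?r z) \<partial>lborel)"
      by (rule nn_integral_add[symmetric]) measurable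
    also have "\<dots> \<le> occ i j 0"
      unfolding occ_sweep sweep_def using t j nj by (intro nn_integral_mono) (auto simp: indicator_def mult.assoc)
    finally show ?thesis .
  qed
  \<comment> \<open>Rather than differentiating the integral, its continuous integrand is compared
    near \<open>0\<close> with constants \<open>b\<close> below its value there.\<close>
  have "b \<le> lam j * occ_mat $ i $ j - gen occ_mat i j" if b: "b < enn2real (inflow (occ i) j 0) / v j" for b
  proof (rule ccontr)
    assume neg: "\<not> b \<le> lam j * occ_mat $ i $ j - gen occ_mat i j"
    let ?g = "\<lambda>z. exp (- lam j * z) / v j * occ_rate z i j"
    have "continuous (at 0) ?g"
      using continuous_on_occ_rate[of i j] j
      by (intro continuous_intros) (auto simp: continuous_on_eq_continuous_at)
    then have "(?g \<longlongrightarrow> ?g 0) (at 0)" by (simp add: continuous_at)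
    moreover have "b < ?g 0" using b by (simp add: rate0)
    ultimately have "eventually (\<lambda>z. b < ?g z) (at 0)" by (rule order_tendstoD)
    then obtain d where d: "0 < d" "\<And>z. z \<noteq> 0 \<Longrightarrow> dist z 0 < d \<Longrightarrow> b < ?g z"
      unfolding eventually_at by blast
    have gb: "b \<le> ?g z" if "0 \<le> z" "z < d" for z
      using d(2)[of z] \<open>b < ?g 0\<close> that by (cases "z = 0") (auto simp: less_imp_le)
    \<comment> \<open>The split keeps \<open>?psi\<close> above its initial value, whereas a
      violation of the claim makes its derivative at \<open>0\<close> negative.\<close>
    let ?psi = "\<lambda>t. - t * b - exp (- lam j * t) * ?f t"
    have le: "?psi 0 \<le> ?psi t" if t: "0 < t" "t < d" for t
    proof -
      \<comment> \<open>The constant \<open>b\<close> may be negative, and \<open>ennreal\<close>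
        would truncate it; hence \<open>max b 0\<close>.\<close>
      have "ennreal (exp (- lam j * t) * ?f t + t * max b 0) = ennreal (exp (- lam j * t)) * ennreal (?f t) + ennreal (max b 0) * ennreal t"
        using t by (simp add: ennreal_mult ennreal_plus flow_nonneg lower_le_occ_mat mult.commute)
      also have "\<dots> \<le> ennreal (exp (- lam j * t)) * occ i j t + (\<integral>\<^sup>+z. indicator {0..<t} z * ennreal (?g z) \<partial>lborel)"
      proof (intro add_mono mult_left_mono flow_le_occ[OF H i])
        have "ennreal (max b 0) * ennreal t = (\<integral>\<^sup>+z. ennreal (max b 0) * indicator {0..<t} z \<partial>lborel)"
          using t by (subst nn_integral_cmult_indicator) auto
        also have "\<dots> \<le> (\<integral>\<^sup>+z. indicator {0..<t} z * ennreal (?g z) \<partial>lborel)"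
        proof (rule nn_integral_mono)
          fix z
          show "ennreal (max b 0) * indicator {0..<t} z \<le> indicator {0..<t} z * ennreal (?g z)"
          proof (cases "z \<in> {0..<t}")
            case True
            then have "max b 0 \<le> ?g z" using gb[of z] t j occ_rate_nonneg[of z i j] by auto
            then show ?thesis using True by (simp add: ennreal_leI)
          qed simp
        qed
        finally show "ennreal (max b 0) * ennreal t \<le> (\<integral>\<^sup>+z. indicator {0..<t} z * ennreal (?g z) \<partial>lborel)" .
      qed (use t in auto)
      also have "\<dots> \<le> ennreal (occ_mat $ i $ j)" using split[of t] t occ0 by simp
      finally have "exp (- lam j * t) * ?f t + t * max b 0 \<le> occ_mat $ i $ j"
        using i nj by (subst (asm) ennreal_le_iff) (auto simp: occ_mat_def)
      moreover have "t * b \<le> t * max b 0" using t by (intro mult_left_mono) auto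
      ultimately show ?thesis by (simp add: f0)
    qed
    have "(?psi has_real_derivative - b + lam j * ?f 0 - gen occ_mat i j) (at 0)"
      using flow_has_derivative[of occ_mat i j 0]
      by (auto intro!: derivative_eq_intros simp: mat_def if_distrib[of "\<lambda>x. x * _"] cong: if_cong)
    moreover have "- b + lam j * ?f 0 - gen occ_mat i j < 0" using neg unfolding f0 by linarith
    ultimately have "\<exists>d>0. \<forall>h>0. h < d \<longrightarrow> ?psi (0 + h) < ?psi 0"
      by (rule DERIV_neg_dec_right)
    then obtain d' where d': "0 < d'" "\<And>h. 0 < h \<Longrightarrow> h < d' \<Longrightarrow> ?psi (0 + h) < ?psi 0" by blast
    define h where "h = min d d' / 2"
    have h: "0 < h" "h < d" "h < d'" using d d' by (auto simp: h_def min_def)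
    show False using le[OF h(1,2)] d'(2)[OF h(1,3)] by simp
  qed
  then have "enn2real (inflow (occ i) j 0) / v j \<le> lam j * occ_mat $ i $ j - gen occ_mat i j"
    by (rule dense_le)
  then show ?thesis by simp
qed

section \<open>Solutions as fixed points of a monotone map\<close>

definition total_rate :: real where
  "total_rate = (\<Sum>j\<in>UNIV. lam j)"

text \<open>The equation for \<open>L\<close> contains the product \<open>KL\<close>, and \<open>K\<close> has negative diagonal entries. Adding
  \<open>total_rate * L\<close> to both sides turns it into a fixed point equation for a monotone map.\<close>

definition Phi :: "real^'s^'s \<Rightarrow> real^'s^'s" where
  "Phi N = (\<chi> i j. if v i < 0
     then if v j < 0 then enn2real (theta N i j) / \<bar>v j\<bar> - (if i = j then lam i else 0)
          else (gen N i j + total_rate * N $ i $ j + enn2real (theta N i j) / v j) / (lam j + total_rate)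
     else 0)"

text \<open>The shift only has to be an upper bound of all \<open>lam\<close>; the sum is a
  convenient one.\<close>

lemma lam_le_total_rate: "lam j \<le> total_rate"
  unfolding total_rate_def using lam_pos by (intro member_le_sum) (auto intro: less_imp_le)

lemma denom_pos: "0 < lam j + total_rate"
  using lam_pos[of j] lam_le_total_rate[of j] by linarith

lemma solves_iff_Phi:
  assumes low: "lower \<le> N" and fin: "\<And>i j. theta N i j < \<infinity>"
  shows "solves N \<longleftrightarrow> Phi N = N"
proof -
  have eq: "gen N i j * v j = exit_rate C D j * flow N 0 i j - enn2real (theta N i j) \<longleftrightarrow> Phi N $ i $ j = N $ i $ j"
    if i: "v i < 0" for i j
  proof (cases "v j < 0")
    case True
    then have "gen N i j = N $ i $ j" using i by (simp add: gen_neg negblock_def)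
    then show ?thesis using i True by (auto simp: flow_0 Phi_def lam_def field_simps)
  next
    case False
    then have j: "0 < v j" by (simp add: pos_iff)
    have c: "exit_rate C D j = lam j * v j" using j by (simp add: lam_def)
    have "gen N i j * v j = exit_rate C D j * flow N 0 i j - enn2real (theta N i j)
      \<longleftrightarrow> gen N i j = lam j * N $ i $ j - enn2real (theta N i j) / v j"
      using i j False by (simp add: c flow_0 field_simps)
    also have "\<dots> \<longleftrightarrow> gen N i j + total_rate * N $ i $ j + enn2real (theta N i j) / v j = N $ i $ j * (lam j + total_rate)"
      by (auto simp: algebra_simps)
    also have "\<dots> \<longleftrightarrow> Phi N $ i $ j = N $ i $ j"
      using i False denom_pos[of j] by (simp add: Phi_def divide_eq_eq)
    finally show ?thesis .
  qed
  have zero: "gen N i j * v j = exit_rate C D j * flow N 0 i j - enn2real (theta N i j)" if "\<not> v i < 0" for i j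
    using that by (simp add: theta_zero_row flow_zero_row gen_def matrix_mult_nth negblock_def)
  have zero': "Phi N $ i $ j = N $ i $ j \<longleftrightarrow> N $ i $ j = 0" if "\<not> v i < 0" for i j
    using that by (auto simp: Phi_def)
  show ?thesis
    unfolding solves_def vec_eq_iff using low fin eq zero zero' by blast
qed

text \<open>After the shift the quadratic term is a sum of products of factors that are nonnegative
  for matrices above \<open>lower\<close>, hence monotone.\<close>

lemma gen_shift:
  assumes "v i < 0" "\<not> v j < 0"
  shows "gen N i j + total_rate * N $ i $ j
    = (\<Sum>k\<in>neg_states v. (N $ i $ k + (if k = i then total_rate else 0)) * N $ k $ j)"
  unfolding distrib_right sum.distrib using assms
  by (auto simp: gen_pos negblock_def neg_states_def if_distrib[of "\<lambda>x. x * _"] cong: if_cong)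

lemma gen_shift_nonneg:
  assumes low: "lower \<le> N" and i: "v i < 0" and j: "\<not> v j < 0" and k: "v k < 0"
  shows "0 \<le> N $ i $ k + (if k = i then total_rate else 0)" "0 \<le> N $ k $ j"
  using lower_leD[OF low, of i k] lower_leD[OF low, of k j] lam_le_total_rate[of i] assms(2-)
  by (auto split: if_splits)

lemma Phi_mono:
  assumes low: "lower \<le> N" and le: "N \<le> N'" and fin: "\<And>i j. theta N' i j < \<infinity>"
  shows "Phi N \<le> Phi N'"
  unfolding vec_le_iff
proof (intro allI)
  fix i j
  have th: "enn2real (theta N i j) \<le> enn2real (theta N' i j)"
    using theta_mono[OF low le, of i j] fin[of i j] by (intro enn2real_mono) auto
  show "Phi N $ i $ j \<le> Phi N' $ i $ j"
  proof (cases "v i < 0 \<and> \<not> v j < 0")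
    case True
    then have j: "0 < v j" by (simp add: pos_iff)
    have "gen N i j + total_rate * N $ i $ j \<le> gen N' i j + total_rate * N' $ i $ j"
      unfolding gen_shift[OF True[THEN conjunct1] True[THEN conjunct2]]
    proof (intro sum_mono mult_mono)
      fix k assume "k \<in> neg_states v"
      then have k: "v k < 0" by (simp add: neg_states_def)
      show "0 \<le> N $ k $ j" "0 \<le> N' $ i $ k + (if k = i then total_rate else 0)"
        using gen_shift_nonneg[OF low _ _ k, of i j] gen_shift_nonneg[OF order_trans[OF low le] _ _ k, of i j] True by auto
    qed (use le in \<open>auto simp: vec_le_iff\<close>)
    then have "gen N i j + total_rate * N $ i $ j + enn2real (theta N i j) / v j
        \<le> gen N' i j + total_rate * N' $ i $ j + enn2real (theta N' i j) / v j"
      using add_mono[OF _ divide_right_mono[OF th, of "v j"]] j by simp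
    then show ?thesis using True denom_pos[of j] by (simp add: Phi_def divide_right_mono)
  next
    case False
    have "enn2real (theta N i j) / \<bar>v j\<bar> \<le> enn2real (theta N' i j) / \<bar>v j\<bar>"
      using th by (intro divide_right_mono) auto
    with False show ?thesis by (auto simp: Phi_def simp del: abs_divide)
  qed
qed

lemma lower_le_Phi:
  assumes low: "lower \<le> N"
  shows "lower \<le> Phi N"
  unfolding lower_le_iff
proof (intro allI)
  fix i j
  show "(if i = j \<and> v i < 0 then - lam i else 0) \<le> Phi N $ i $ j"
  proof (cases "v i < 0 \<and> \<not> v j < 0")
    case True
    then have j: "0 < v j" by (simp add: pos_iff)
    have "0 \<le> gen N i j + total_rate * N $ i $ j"
      unfolding gen_shift[OF True[THEN conjunct1] True[THEN conjunct2]]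
      using gen_shift_nonneg[OF low, of i j] True
      by (intro sum_nonneg mult_nonneg_nonneg) (auto simp: neg_states_def)
    then have "0 \<le> Phi N $ i $ j" using True j denom_pos[of j] by (simp add: Phi_def)
    then show ?thesis using True by auto
  next
    case False
    have "0 \<le> enn2real (theta N i j) / \<bar>v j\<bar>" by (intro divide_nonneg_nonneg) auto
    with False show ?thesis by (auto simp: Phi_def divide_nonneg_neg)
  qed
qed

lemma ex_solution_le_occ_mat:
  assumes H: "solves H"
  shows "\<exists>Z. solves Z \<and> Z \<le> occ_mat"
proof -
  have low: "lower \<le> H" and fin: "\<And>i j. theta H i j < \<infinity>" using H by (auto simp: solves_def)
  have finN: "theta N i j < \<infinity>" if "lower \<le> N" "N \<le> H" for N i j
    using theta_mono[OF that, of i j] fin[of i j] by (rule le_less_trans)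
  have "Phi occ_mat \<le> occ_mat"
    unfolding vec_le_iff
  proof (intro allI)
    fix i j
    show "Phi occ_mat $ i $ j \<le> occ_mat $ i $ j"
    proof (cases "v i < 0")
      case i: True
      have th: "enn2real (theta occ_mat i j) \<le> enn2real (inflow (occ i) j 0)"
        using theta_occ_mat_le[OF H i] inflow_occ_finite[OF H i, of j] by (intro enn2real_mono) auto
      show ?thesis
      proof (cases "v j < 0")
        case True
        have "enn2real (theta occ_mat i j) / \<bar>v j\<bar> \<le> enn2real (inflow (occ i) j 0) / \<bar>v j\<bar>"
          using th by (intro divide_right_mono) auto
        then show ?thesis using i True by (simp add: Phi_def occ_mat_def[THEN arg_cong[of _ _ "\<lambda>M. M $ i $ j"]])
      next
        case False
        then have j: "0 < v j" by (simp add: pos_iff)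
        have "enn2real (theta occ_mat i j) / v j \<le> enn2real (inflow (occ i) j 0) / v j"
          using th j by (intro divide_right_mono) auto
        with occ_mat_super_pos[OF H i j]
        have "gen occ_mat i j + total_rate * occ_mat $ i $ j + enn2real (theta occ_mat i j) / v j
          \<le> occ_mat $ i $ j * (lam j + total_rate)"
          by (simp add: algebra_simps)
        then show ?thesis using i False denom_pos[of j] by (simp add: Phi_def divide_le_eq)
      qed
    qed (simp add: Phi_def occ_mat_def)
  qed
  \<comment> \<open>The upper end is the solution \<open>H\<close>, because below it every
    \<open>theta\<close> is finite; at an infinite value \<open>enn2real\<close> would drop to
    \<open>0\<close> and spoil monotonicity.\<close>
  then have "\<exists>Z. lower \<le> Z \<and> Z \<le> occ_mat \<and> Phi Z = Z"
    by (intro conditionally_complete_lfp[of lower H] Phi_mono lower_le_Phi finN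
        lower_le_occ_mat occ_mat_le[OF H]) (auto intro: order_trans)
  then obtain Z where Z: "lower \<le> Z" "Z \<le> occ_mat" "Phi Z = Z" by blast
  then have "Z \<le> H" using occ_mat_le[OF H] by auto
  then have "solves Z" using Z solves_iff_Phi[OF Z(1) finN[OF Z(1)]] by simp
  with Z(2) show ?thesis by blast
qed

section \<open>From the given matrix equation to its encoding\<close>

lemma sets_D_meas [measurable_cong]: "sets (D_meas D F k j) = sets borel"
  by (simp add: D_meas_def sets_F)

lemma nn_integral_D_meas:
  "g \<in> borel_measurable borel \<Longrightarrow> (\<integral>\<^sup>+u. g u \<partial>D_meas D F k j) = ennreal (D $ k $ j) * (\<integral>\<^sup>+u. g u \<partial>F k j)"
  by (simp add: D_meas_def nn_integral_scale_measure measurable_cong_sets[OF sets_F refl])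

text \<open>Nonnegativity reduces Bochner integrals to integrals in \<open>ennreal\<close>, where
  integrability is finiteness.\<close>

lemma set_integral_D_meas:
  fixes g :: "real \<Rightarrow> real"
  assumes [measurable]: "g \<in> borel_measurable borel" and g: "\<And>u. w \<le> u \<Longrightarrow> 0 \<le> g u"
  shows "(LINT u:{w..}|D_meas D F k j. g u) =
      enn2real (ennreal (D $ k $ j) * (\<integral>\<^sup>+u. ennreal (g u) * indicator {w..} u \<partial>F k j))"
    and "set_integrable (D_meas D F k j) {w..} g \<longleftrightarrow>
      ennreal (D $ k $ j) * (\<integral>\<^sup>+u. ennreal (g u) * indicator {w..} u \<partial>F k j) < \<infinity>"
proof -
  have nn: "(\<integral>\<^sup>+u. ennreal (indicator {w..} u *\<^sub>R g u) \<partial>D_meas D F k j) =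
      ennreal (D $ k $ j) * (\<integral>\<^sup>+u. ennreal (g u) * indicator {w..} u \<partial>F k j)"
    by (subst nn_integral_D_meas) (auto intro!: arg_cong2[where f="(*)"] nn_integral_cong simp: indicator_def)
  have n: "(\<lambda>u. ennreal (norm (indicator {w..} u *\<^sub>R g u))) = (\<lambda>u. ennreal (indicator {w..} u *\<^sub>R g u))"
    using g by (auto simp: indicator_def)
  show "(LINT u:{w..}|D_meas D F k j. g u) =
      enn2real (ennreal (D $ k $ j) * (\<integral>\<^sup>+u. ennreal (g u) * indicator {w..} u \<partial>F k j))"
    unfolding set_lebesgue_integral_def nn[symmetric] using g
    by (intro integral_eq_nn_integral) (auto simp: indicator_def intro!: AE_I2)
  show "set_integrable (D_meas D F k j) {w..} g \<longleftrightarrow>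
      ennreal (D $ k $ j) * (\<integral>\<^sup>+u. ennreal (g u) * indicator {w..} u \<partial>F k j) < \<infinity>"
    unfolding set_integrable_def nn[symmetric] integrable_iff_bounded n by measurable
qed

lemma nn_integral_F_atLeast_0: "(\<integral>\<^sup>+u. g u * indicator {0..} u \<partial>F k j) = (\<integral>\<^sup>+u. g u \<partial>F k j)"
  using AE_F_pos[of k j] by (intro nn_integral_cong_AE) (auto elim!: eventually_mono)

text \<open>\<open>theta\<close> is a finite sum of nonnegative terms, and those from
  \<open>D\<close> are the integrals of the single entries. It is finite exactly if all of these
  are.\<close>

lemma flow_integrals:
  assumes low: "lower \<le> N"
  shows "mat_integrable {0..} (\<lambda>u. mat_exp (u *\<^sub>R negblock N) ** IL v (posblock N)) (D_meas D F)
      \<longleftrightarrow> (\<forall>i j. theta N i j < \<infinity>)" (is "?I \<longleftrightarrow> ?T")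
    and "\<forall>i j. theta N i j < \<infinity> \<Longrightarrow> enn2real (theta N i j) = (\<Sum>k\<in>-{j}. C $ k $ j * flow N 0 i k) +
      mat_integral {0..} (\<lambda>u. mat_exp (u *\<^sub>R negblock N) ** IL v (posblock N)) (D_meas D F) $ i $ j"
proof -
  have f: "(\<lambda>u. (mat_exp (u *\<^sub>R negblock N) ** IL v (posblock N)) $ i $ k) = (\<lambda>u. flow N u i k)" for i k
    by (simp add: flow_def)
  define t where "t i k j = ennreal (D $ k $ j) * (\<integral>\<^sup>+u. ennreal (flow N u i k) \<partial>F k j)" for i k j
  have nn: "ennreal (D $ k $ j) * (\<integral>\<^sup>+u. ennreal (flow N u i k) * indicator {0..} u \<partial>F k j) = t i k j" for i k j
    unfolding t_def by (simp only: nn_integral_F_atLeast_0)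
  have int: "(LINT u:{0..}|D_meas D F k j. flow N u i k) = enn2real (t i k j)"
    "set_integrable (D_meas D F k j) {0..} (\<lambda>u. flow N u i k) \<longleftrightarrow> t i k j < \<infinity>" for i k j
    using set_integral_D_meas[where g = "\<lambda>u. flow N u i k" and w = 0 and k = k and j = j,
        OF measurable_flow flow_nonneg[OF low]] unfolding nn by auto
  have theta: "theta N i j = (\<Sum>k\<in>-{j}. ennreal (C $ k $ j) * ennreal (flow N 0 i k)) + (\<Sum>k\<in>UNIV. t i k j)" for i j
    unfolding theta_def inflow_def t_def by simp
  have fin: "theta N i j < \<infinity> \<longleftrightarrow> (\<forall>k. t i k j < \<infinity>)" for i j
    unfolding theta by (auto simp: ennreal_mult_less_top)
  show "?I \<longleftrightarrow> ?T" unfolding mat_integrable_def f int fin by blast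
  assume T: ?T
  have tf: "t i k j < \<infinity>" for k using T fin by blast
  have "enn2real (theta N i j) = enn2real (ennreal ((\<Sum>k\<in>-{j}. C $ k $ j * flow N 0 i k) + (\<Sum>k\<in>UNIV. enn2real (t i k j))))"
  proof (rule arg_cong[where f=enn2real])
    have 1: "(\<Sum>k\<in>-{j}. ennreal (C $ k $ j) * ennreal (flow N 0 i k)) = ennreal (\<Sum>k\<in>-{j}. C $ k $ j * flow N 0 i k)"
      using C_nonneg flow_nonneg[OF low] by (subst sum_ennreal[symmetric]) (auto simp: ennreal_mult)
    have 2: "(\<Sum>k\<in>UNIV. t i k j) = ennreal (\<Sum>k\<in>UNIV. enn2real (t i k j))"
      using tf by (subst sum_ennreal[symmetric]) (auto)
    show "theta N i j = ennreal ((\<Sum>k\<in>-{j}. C $ k $ j * flow N 0 i k) + (\<Sum>k\<in>UNIV. enn2real (t i k j)))"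
      unfolding theta 1 2 using C_nonneg flow_nonneg[OF low]
      by (intro ennreal_plus[symmetric] sum_nonneg mult_nonneg_nonneg) auto
  qed
  also have "\<dots> = (\<Sum>k\<in>-{j}. C $ k $ j * flow N 0 i k) + (\<Sum>k\<in>UNIV. enn2real (t i k j))"
    using C_nonneg flow_nonneg[OF low]
    by (intro enn2real_ennreal add_nonneg_nonneg sum_nonneg mult_nonneg_nonneg) auto
  finally show "enn2real (theta N i j) = (\<Sum>k\<in>-{j}. C $ k $ j * flow N 0 i k) +
      mat_integral {0..} (\<lambda>u. mat_exp (u *\<^sub>R negblock N) ** IL v (posblock N)) (D_meas D F) $ i $ j"
    by (simp add: mat_integral_def f int)
qed

text \<open>The inverse diagonal matrix divides column \<open>j\<close> by \<open>v j\<close>. The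
  diagonal of \<open>C\<close> supplies the term with \<open>exit_rate\<close>, everything else on
  the right is \<open>theta\<close>.\<close>

lemma KL_equation_iff:
  assumes low: "lower \<le> N" and fin: "\<And>i j. theta N i j < \<infinity>"
  shows "- (negblock N ** IL v (posblock N)) =
       (mat_exp (0 *\<^sub>R negblock N) ** IL v (posblock N) ** C +
        mat_integral {0..} (\<lambda>u. mat_exp (u *\<^sub>R negblock N) ** IL v (posblock N)) (D_meas D F)) **
       matrix_inv (diag_mat v) \<longleftrightarrow>
     (\<forall>i j. gen N i j * v j = exit_rate C D j * flow N 0 i j - enn2real (theta N i j))"
proof -
  let ?A = "mat_exp (0 *\<^sub>R negblock N) ** IL v (posblock N) ** C +
        mat_integral {0..} (\<lambda>u. mat_exp (u *\<^sub>R negblock N) ** IL v (posblock N)) (D_meas D F)"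
  have A: "?A $ i $ j = enn2real (theta N i j) - exit_rate C D j * flow N 0 i j" for i j
  proof -
    have "(mat_exp (0 *\<^sub>R negblock N) ** IL v (posblock N) ** C) $ i $ j = (\<Sum>k\<in>UNIV. C $ k $ j * flow N 0 i k)"
      unfolding flow_def matrix_mult_nth[of "_ ** _" C] by (simp add: mult.commute)
    also have "\<dots> = C $ j $ j * flow N 0 i j + (\<Sum>k\<in>-{j}. C $ k $ j * flow N 0 i k)"
      by (simp add: sum.remove[of UNIV j] Compl_eq_Diff_UNIV)
    finally show ?thesis
      using flow_integrals(2)[OF low, of i j] fin by (simp add: C_diag)
  qed
  have "(- (negblock N ** IL v (posblock N)) = ?A ** matrix_inv (diag_mat v)) \<longleftrightarrow>
      (\<forall>i j. - gen N i j = ?A $ i $ j / v j)"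
    unfolding matrix_inv_diag_mat[OF v_nonzero] vec_eq_iff mult_diag_mat_nth by (simp add: gen_def)
  also have "\<dots> \<longleftrightarrow> (\<forall>i j. gen N i j * v j = exit_rate C D j * flow N 0 i j - enn2real (theta N i j))"
  proof -
    have "- g = a / v j \<longleftrightarrow> g * v j = - a" for g a j
      using v_nonzero[of j] by (auto simp: field_simps)
    then show ?thesis unfolding A by simp
  qed
  finally show ?thesis .
qed

lemma KL_solution_blocks:
  assumes N: "solves N"
  shows "KL_solution C D F v (negblock N) (posblock N)"
proof -
  have low: "lower \<le> N" and fin: "\<And>i j. theta N i j < \<infinity>" using N by (auto simp: solves_def)
  have "0 \<le> posblock N $ i $ j" for i j
    using lower_leD[OF low, of i j] by (auto simp: posblock_def split: if_splits)
  then show ?thesis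
    unfolding KL_solution_def KL_equation_iff[OF low fin] flow_integrals(1)[OF low]
    using fin solves_eq[OF N] negblock_offdiag[OF low]
    by (simp add: negblock_def posblock_def neg_states_def pos_states_def)
qed

lemma solves_KL:
  assumes KL: "KL_solution C D F v K L"
  shows "negblock (K + L) = K" "posblock (K + L) = L" "solves (K + L)"
proof -
  note sol = KL[unfolded KL_solution_def neg_states_def pos_states_def mem_Collect_eq]
  have z: "\<And>i j. \<not> (v i < 0 \<and> v j < 0) \<Longrightarrow> K $ i $ j = 0" "\<And>i j. \<not> (v i < 0 \<and> 0 < v j) \<Longrightarrow> L $ i $ j = 0"
    using sol[THEN conjunct1] sol[THEN conjunct2, THEN conjunct1] by blast+
  have nonneg: "\<And>i j. i \<noteq> j \<Longrightarrow> 0 \<le> K $ i $ j" "\<And>i j. 0 \<le> L $ i $ j"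
    using sol[THEN conjunct2, THEN conjunct2, THEN conjunct1]
      sol[THEN conjunct2, THEN conjunct2, THEN conjunct2, THEN conjunct1] by blast+
  have int: "mat_integrable {0..} (\<lambda>u. mat_exp (u *\<^sub>R K) ** IL v L) (D_meas D F)"
    and eq: "- (K ** IL v L) = (mat_exp (0 *\<^sub>R K) ** IL v L ** C +
        mat_integral {0..} (\<lambda>u. mat_exp (u *\<^sub>R K) ** IL v L) (D_meas D F)) ** matrix_inv (diag_mat v)"
    using sol by - (elim conjE, assumption)+
  show neg: "negblock (K + L) = K" using z by (simp add: vec_eq_iff negblock_def)
  show pos: "posblock (K + L) = L" using z by (auto simp: vec_eq_iff posblock_def)
  have flow_nn: "0 \<le> flow (K + L) u i j" if "0 \<le> u" for u i j
    unfolding flow_def neg pos matrix_mult_nth using that nonneg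
    by (intro sum_nonneg mult_nonneg_nonneg mat_exp_nonneg) (auto simp: IL_def)
  \<comment> \<open>\<open>KL_solution\<close> states no lower bound for the diagonal of
    \<open>K\<close>. It follows from the equation at \<open>(i, i)\<close>: every term on the right
    except \<open>C $ i $ i\<close> is nonnegative, and the slope by which they are divided is
    negative.\<close>
  have low: "lower \<le> K + L"
    unfolding lower_le_iff
  proof (intro allI)
    fix i j
    show "(if i = j \<and> v i < 0 then - lam i else 0) \<le> (K + L) $ i $ j"
    proof (cases "i = j \<and> v i < 0")
      case True
      then have i: "v i < 0" and ij: "j = i" by auto
      let ?M = "mat_integral {0..} (\<lambda>u. mat_exp (u *\<^sub>R K) ** IL v L) (D_meas D F)"
      have "gen (K + L) i i = K $ i $ i" using gen_neg[OF i, of "K + L" i] by (simp add: neg)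
      then have "(- (K ** IL v L)) $ i $ i = - K $ i $ i" by (simp add: gen_def neg pos)
      then have "- K $ i $ i = ((IL v L ** C) $ i $ i + ?M $ i $ i) / v i"
        unfolding eq matrix_inv_diag_mat[OF v_nonzero] mult_diag_mat_nth by simp
      moreover have "0 \<le> ?M $ i $ i"
        unfolding mat_integral_def set_lebesgue_integral_def vec_lambda_beta
        using flow_nn[unfolded flow_def neg pos]
        by (intro sum_nonneg integral_nonneg_AE AE_I2) (simp add: indicator_def)
      moreover have "C $ i $ i \<le> (IL v L ** C) $ i $ i"
      proof -
        have "(IL v L ** C) $ i $ i = IL v L $ i $ i * C $ i $ i + (\<Sum>k\<in>-{i}. IL v L $ i $ k * C $ k $ i)"
          unfolding matrix_mult_nth by (simp add: sum.remove[of UNIV i] Compl_eq_Diff_UNIV)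
        moreover have "0 \<le> (\<Sum>k\<in>-{i}. IL v L $ i $ k * C $ k $ i)"
          using C_nonneg nonneg by (intro sum_nonneg mult_nonneg_nonneg) (auto simp: IL_def)
        ultimately show ?thesis using i by (simp add: IL_def neg_states_def)
      qed
      ultimately have "- K $ i $ i \<le> C $ i $ i / v i"
        using i by (simp add: divide_right_mono_neg)
      then have "- lam i \<le> K $ i $ i" using i by (simp add: C_diag lam_def)
      moreover have "L $ i $ i = 0" using z i by simp
      ultimately show ?thesis using i unfolding ij by simp
    next
      case False
      then have "0 \<le> K $ i $ j" using z nonneg by (cases "i = j") auto
      then show ?thesis using False nonneg(2)[of i j] by auto
    qed
  qed
  have fin: "theta (K + L) i j < \<infinity>" for i j
    using int flow_integrals(1)[OF low] by (simp add: neg pos)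
  have "gen (K + L) i j * v j = exit_rate C D j * flow (K + L) 0 i j - enn2real (theta (K + L) i j)" for i j
    using KL_equation_iff[OF low fin] eq unfolding neg pos by blast
  then show "solves (K + L)" unfolding solves_def using low fin z by simp
qed

theorem occ_eq_mat_exp:
  assumes min: "KL_minimal_solution C D F v K L" and i: "v i < 0" and y: "0 \<le> y"
  shows "occ i j y = ennreal ((mat_exp (y *\<^sub>R K) ** IL v L) $ i $ j)"
    and "0 \<le> (mat_exp (y *\<^sub>R K) ** IL v L) $ i $ j"
proof -
  have KL: "KL_solution C D F v K L" using min by (simp add: KL_minimal_solution_def)
  note H = solves_KL[OF KL]
  have low: "lower \<le> K + L" using H(3) by (simp add: solves_def)
  obtain Z where Z: "solves Z" "Z \<le> occ_mat" using ex_solution_le_occ_mat[OF H(3)] by blast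
  have "K + L \<le> Z"
    unfolding vec_le_iff
  proof (intro allI)
    fix k l
    have "K $ k $ l \<le> negblock Z $ k $ l" "L $ k $ l \<le> posblock Z $ k $ l"
      using min KL_solution_blocks[OF Z(1)] by (auto simp: KL_minimal_solution_def)
    moreover have "negblock Z $ k $ l + posblock Z $ k $ l \<le> Z $ k $ l"
    proof -
      have "\<not> v k < 0 \<Longrightarrow> Z $ k $ l = 0" using Z(1) by (simp add: solves_def)
      then show ?thesis by (auto simp: negblock_def posblock_def pos_iff)
    qed
    ultimately show "(K + L) $ k $ l \<le> Z $ k $ l" by simp
  qed
  \<comment> \<open>The chain \<open>K + L \<le> Z \<le> occ_mat \<le> K + L\<close> closes, so the
    upper and the lower bound on \<open>occ\<close> concern the same matrix.\<close>
  with Z(2) occ_mat_le[OF H(3)] have "occ_mat = K + L" by auto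
  then have "occ i j y = ennreal (flow (K + L) y i j)"
    using occ_le_flow[OF H(3) i y, of j] flow_le_occ[OF H(3) i y, of j] by auto
  then show "occ i j y = ennreal ((mat_exp (y *\<^sub>R K) ** IL v L) $ i $ j)"
    by (simp add: flow_def H)
  show "0 \<le> (mat_exp (y *\<^sub>R K) ** IL v L) $ i $ j"
    using flow_nonneg[OF low y, of i j] by (simp add: flow_def H)
qed

end

section \<open>The Markov property\<close>

definition exp_law :: "real \<Rightarrow> real measure" where
  "exp_law c = density lborel (\<lambda>t. ennreal (c * exp (- c * t)) * indicator {0..} t)"

lemma sets_exp_law [measurable_cong]: "sets (exp_law c) = sets borel"
  by (simp add: exp_law_def)

lemma nn_integral_exp_law:
  "f \<in> borel_measurable borel \<Longrightarrow>
    (\<integral>\<^sup>+t. f t \<partial>exp_law c) = (\<integral>\<^sup>+t. ennreal (c * exp (- c * t)) * indicator {0..} t * f t \<partial>lborel)"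
  unfolding exp_law_def by (subst nn_integral_density) auto

lemma emeasure_exp_law_greaterThan:
  assumes c: "0 < c"
  shows "emeasure (exp_law c) {s<..} = ennreal (exp (- c * max s 0))"
proof -
  have "emeasure (exp_law c) {s<..} = (\<integral>\<^sup>+t. ennreal (c * exp (- c * t)) * indicator {0..} t * indicator {s<..} t \<partial>lborel)"
    unfolding exp_law_def by (subst emeasure_density) auto
  also have "\<dots> = (\<integral>\<^sup>+t. ennreal (c * exp (- c * t)) * indicator {max s 0..} t \<partial>lborel)"
    using AE_lborel_singleton[of s]
    by (intro nn_integral_cong_AE) (auto elim!: eventually_mono simp: indicator_def max_def)
  also have "\<dots> = ennreal (0 - - exp (- c * max s 0))"
  proof (rule nn_integral_FTC_atLeast)
    show "((\<lambda>t. - exp (- c * t)) \<longlongrightarrow> 0) at_top"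
      using c by real_asymp
  qed (use c in \<open>auto intro!: derivative_eq_intros\<close>)
  finally show ?thesis by simp
qed

lemma prob_space_exp_law:
  assumes c: "0 < c"
  shows "prob_space (exp_law c)"
proof
  have "emeasure (exp_law c) UNIV = (\<integral>\<^sup>+t. ennreal (c * exp (- c * t)) * indicator {0..} t \<partial>lborel)"
    unfolding exp_law_def by (subst emeasure_density) auto
  also have "\<dots> = (\<integral>\<^sup>+t. ennreal (c * exp (- c * t)) * indicator {0..} t * indicator {-1<..} t \<partial>lborel)"
    by (intro nn_integral_cong) (auto simp: indicator_def)
  also have "\<dots> = emeasure (exp_law c) {-1<..}"
    unfolding exp_law_def by (subst emeasure_density) auto
  finally show "emeasure (exp_law c) (space (exp_law c)) = 1"
    using emeasure_exp_law_greaterThan[OF c, of "-1"] by (simp add: exp_law_def)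
qed

context MAP_process
begin

lemma UNIV_trans_type: "(UNIV :: trans_type set) = {TypeC, TypeD}"
proof -
  have "k \<in> {TypeC, TypeD}" for k by (cases k) auto
  then show ?thesis by auto
qed

lemma finite_trans_type: "finite (UNIV :: trans_type set)"
  by (simp add: UNIV_trans_type)

lemma jump_dist_prob: "prob_space (jump_dist F k i j)"
  by (cases k) (auto simp: prob_space_F intro: prob_space_return)

lemma sets_jump_dist [measurable_cong]: "sets (jump_dist F k i j) = sets borel"
  by (cases k) (auto simp: sets_F)

text \<open>The events whose probability the assumption \<open>law\<close> prescribes.\<close>

definition cyl :: "nat \<Rightarrow> (nat \<Rightarrow> 's) \<Rightarrow> (nat \<Rightarrow> trans_type) \<Rightarrow> (nat \<Rightarrow> real) \<Rightarrow> (nat \<Rightarrow> real set) \<Rightarrow> 'w set" where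
  "cyl n x k s B = {w \<in> space P. X 0 w = x 0 \<and>
     (\<forall>m<n. s m < T m w \<and> ty m w = k m \<and> X (Suc m) w = x (Suc m) \<and> J m w \<in> B m)}"

text \<open>The empty set makes the system stable under intersection, since cylinders with different
  discrete parts are disjoint.\<close>

definition cyls :: "nat \<Rightarrow> 'w set set" where
  "cyls n = insert {} {cyl n x k s B | x k s B. (\<forall>m. 0 \<le> s m) \<and> (\<forall>m. B m \<in> sets borel)}"

text \<open>The past before the \<open>n\<close>-th sojourn: states up to index \<open>n\<close>;
  sojourn times, types and jumps below \<open>n\<close>.\<close>

definition hist :: "nat \<Rightarrow> 'w measure" where
  "hist n = sigma (space P) (cyls n)"

text \<open>Extensional functions, so that there are only finitely many discrete paths.\<close>

definition paths :: "nat \<Rightarrow> ((nat \<Rightarrow> 's) \<times> (nat \<Rightarrow> trans_type)) set" where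
  "paths n = (PiE {..n} (\<lambda>_. UNIV)) \<times> (PiE {..<n} (\<lambda>_. UNIV))"

definition stp :: "nat \<Rightarrow> real \<Rightarrow> trans_type \<Rightarrow> 's \<Rightarrow> real set \<Rightarrow> 'w set" where
  "stp n t \<kappa> y E = {w \<in> space P. t < T n w \<and> ty n w = \<kappa> \<and> X (Suc n) w = y \<and> J n w \<in> E}"

lemma cyl_state:
  assumes "w \<in> cyl n x k s B" "m \<le> n"
  shows "X m w = x m"
  using assms by (cases m) (auto simp: cyl_def)

lemma sets_cyl:
  assumes "\<And>m. B m \<in> sets borel"
  shows "cyl n x k s B \<in> sets P"
proof -
  note [measurable] = X_meas T_meas ty_meas J_meas assms
  show ?thesis unfolding cyl_def by measurable
qed

lemma sets_stp:
  assumes [measurable]: "E \<in> sets borel"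
  shows "stp n t \<kappa> y E \<in> sets P"
proof -
  note [measurable] = X_meas T_meas ty_meas J_meas
  show ?thesis unfolding stp_def by measurable
qed

lemma cyls_subset: "cyls n \<subseteq> sets P"
  by (auto simp: cyls_def sets_cyl)

lemma sets_hist: "sets (hist n) = sigma_sets (space P) (cyls n)"
  unfolding hist_def using order_trans[OF cyls_subset sets.space_closed] by (rule sets_measure_of)

lemma space_hist [simp]: "space (hist n) = space P"
  by (simp add: hist_def space_measure_of_conv)

lemma sets_hist_subset: "sets (hist n) \<subseteq> sets P"
  unfolding sets_hist by (rule sets.sigma_sets_subset[OF cyls_subset])

lemma Int_stable_cyls: "Int_stable (cyls n)"
proof (rule Int_stableI)
  fix a b assume a: "a \<in> cyls n" and b: "b \<in> cyls n"
  show "a \<inter> b \<in> cyls n"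
  proof (cases "a = {} \<or> b = {} \<or> a \<inter> b = {}")
    case True
    then show ?thesis by (auto simp: cyls_def)
  next
    case False
    obtain x k s B where A: "a = cyl n x k s B" "\<forall>m. 0 \<le> s m" "\<forall>m. B m \<in> sets borel"
      using a False by (auto simp: cyls_def)
    obtain x' k' s' B' where A': "b = cyl n x' k' s' B'" "\<forall>m. 0 \<le> s' m" "\<forall>m. B' m \<in> sets borel"
      using b False by (auto simp: cyls_def)
    obtain w where "w \<in> a \<inter> b" using False by blast
    then have eq: "x 0 = x' 0" "\<forall>m<n. k m = k' m \<and> x (Suc m) = x' (Suc m)"
      by (auto simp: A A' cyl_def)
    then have "a \<inter> b = cyl n x k (\<lambda>m. max (s m) (s' m)) (\<lambda>m. B m \<inter> B' m)"
      unfolding A A' cyl_def by auto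
    moreover have "\<forall>m. 0 \<le> max (s m) (s' m)" "\<forall>m. B m \<inter> B' m \<in> sets borel"
      using A A' by (auto simp: le_max_iff_disj)
    ultimately show ?thesis unfolding cyls_def by blast
  qed
qed

lemma finite_paths: "finite (paths n)"
  unfolding paths_def by (intro finite_SigmaI finite_PiE finite_trans_type finite_atMost finite_lessThan finite)

lemma ex_path:
  assumes "w \<in> space P"
  shows "\<exists>q\<in>paths n. X 0 w = fst q 0 \<and> (\<forall>m<n. ty m w = snd q m \<and> X (Suc m) w = fst q (Suc m))"
proof (rule bexI)
  show "(restrict (\<lambda>m. X m w) {..n}, restrict (\<lambda>m. ty m w) {..<n}) \<in> paths n"
    by (simp add: paths_def)
qed simp

lemma cyl_hist:
  assumes "\<And>m. 0 \<le> s m" "\<And>m. B m \<in> sets borel"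
  shows "cyl n x k s B \<in> sets (hist n)"
proof -
  have "cyl n x k s B \<in> cyls n" unfolding cyls_def using assms by blast
  then show ?thesis unfolding sets_hist by (rule sigma_sets.Basic)
qed

lemma path_sets_hist:
  assumes "\<And>m. 0 \<le> s m" "\<And>m. B m \<in> sets borel"
  shows "{w \<in> space P. \<forall>m<n. s m < T m w \<and> J m w \<in> B m} \<in> sets (hist n)"
proof -
  have "{w \<in> space P. \<forall>m<n. s m < T m w \<and> J m w \<in> B m} = (\<Union>q\<in>paths n. cyl n (fst q) (snd q) s B)"
    using ex_path[of _ n] unfolding cyl_def by auto
  also have "\<dots> \<in> sets (hist n)"
    by (intro sets.finite_UN finite_paths cyl_hist assms)
  finally show ?thesis .
qed

lemma T_hist: "m < n \<Longrightarrow> T m \<in> borel_measurable (hist n)"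
proof (rule borel_measurableI_greater)
  fix t assume m: "m < n"
  \<comment> \<open>Positive sojourn times make the threshold \<open>0\<close> void and allow
    \<open>max t 0\<close> in place of \<open>t\<close>.\<close>
  have "{w \<in> space P. t < T m w} =
      {w \<in> space P. \<forall>l<n. (if l = m then max t 0 else 0) < T l w \<and> J l w \<in> UNIV}"
    using m T_pos by auto
  also have "\<dots> \<in> sets (hist n)" by (rule path_sets_hist) auto
  finally show "{w \<in> space (hist n). t < T m w} \<in> sets (hist n)" by simp
qed

lemma J_hist: "m < n \<Longrightarrow> J m \<in> borel_measurable (hist n)"
proof (rule measurableI)
  fix E :: "real set" assume m: "m < n" and E: "E \<in> sets borel"
  have "J m -` E \<inter> space (hist n) = {w \<in> space P. \<forall>l<n. 0 < T l w \<and> J l w \<in> (if l = m then E else UNIV)}"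
    using m T_pos by auto
  also have "\<dots> \<in> sets (hist n)" using E by (intro path_sets_hist) auto
  finally show "J m -` E \<inter> space (hist n) \<in> sets (hist n)" .
qed simp

lemma X_hist: "m \<le> n \<Longrightarrow> X m \<in> measurable (hist n) (count_space UNIV)"
proof (rule measurableI)
  fix A :: "'s set" assume m: "m \<le> n"
  have "X m -` A \<inter> space (hist n) = (\<Union>q\<in>{q\<in>paths n. fst q m \<in> A}. cyl n (fst q) (snd q) (\<lambda>_. 0) (\<lambda>_. UNIV))"
  proof (intro set_eqI iffI)
    fix w assume w: "w \<in> X m -` A \<inter> space (hist n)"
    then obtain q where q: "q \<in> paths n" "X 0 w = fst q 0 \<and> (\<forall>m<n. ty m w = snd q m \<and> X (Suc m) w = fst q (Suc m))"
      using ex_path[of w n] by auto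
    then have c: "w \<in> cyl n (fst q) (snd q) (\<lambda>_. 0) (\<lambda>_. UNIV)" using w T_pos by (auto simp: cyl_def)
    then show "w \<in> (\<Union>q\<in>{q\<in>paths n. fst q m \<in> A}. cyl n (fst q) (snd q) (\<lambda>_. 0) (\<lambda>_. UNIV))"
      by (intro UN_I[of q]) (use w q(1) cyl_state[OF c m] in auto)
  next
    fix w assume "w \<in> (\<Union>q\<in>{q\<in>paths n. fst q m \<in> A}. cyl n (fst q) (snd q) (\<lambda>_. 0) (\<lambda>_. UNIV))"
    then obtain q where q: "fst q m \<in> A" "w \<in> cyl n (fst q) (snd q) (\<lambda>_. 0) (\<lambda>_. UNIV)" by blast
    then have "w \<in> space P" by (simp add: cyl_def)
    then show "w \<in> X m -` A \<inter> space (hist n)"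
      using cyl_state[OF q(2) m] q(1) by simp
  qed
  also have "\<dots> \<in> sets (hist n)"
    by (intro sets.finite_UN finite_subset[OF _ finite_paths] cyl_hist) auto
  finally show "X m -` A \<inter> space (hist n) \<in> sets (hist n)" .
qed simp

lemma prob_cyl:
  assumes "\<And>m. 0 \<le> s m" "\<And>m. B m \<in> sets borel"
  shows "prob (cyl n x k s B) = prob {w \<in> space P. X 0 w = x 0} *
    (\<Prod>m<n. exp (- exit_rate C D (x m) * s m) * (trans_rate C D (k m) (x m) (x (Suc m)) / exit_rate C D (x m)) *
      measure (jump_dist F (k m) (x m) (x (Suc m))) (B m))"
  unfolding cyl_def by (rule law[where s = s and B = B and x = x and k = k and n = n]) (fact assms)+

definition step_prob :: "'s \<Rightarrow> real \<Rightarrow> trans_type \<Rightarrow> 's \<Rightarrow> real set \<Rightarrow> real" where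
  "step_prob a t \<kappa> y E = exp (- exit_rate C D a * t) * (trans_rate C D \<kappa> a y / exit_rate C D a) *
     measure (jump_dist F \<kappa> a y) E"

text \<open>Overwriting the data at index \<open>n\<close> turns the intersection into a cylinder of
  length \<open>Suc n\<close>. The product in \<open>law\<close> gains one factor, which depends on
  the past only through \<open>x n\<close>.\<close>

lemma prob_cyl_stp:
  assumes s: "\<And>m. 0 \<le> s m" "\<And>m. B m \<in> sets borel" and t: "0 \<le> t" "E \<in> sets borel"
  shows "prob (cyl n x k s B \<inter> stp n t \<kappa> y E) = prob (cyl n x k s B) * step_prob (x n) t \<kappa> y E"
proof -
  let ?x = "x(Suc n := y)" and ?k = "k(n := \<kappa>)" and ?s = "s(n := t)" and ?B = "B(n := E)"
  have e: "cyl n x k s B \<inter> stp n t \<kappa> y E = cyl (Suc n) ?x ?k ?s ?B"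
    by (auto simp: cyl_def stp_def less_Suc_eq)
  have s': "0 \<le> ?s m" "?B m \<in> sets borel" for m using s t by simp_all
  have p: "(\<Prod>m<n. exp (- exit_rate C D (?x m) * ?s m) * (trans_rate C D (?k m) (?x m) (?x (Suc m)) / exit_rate C D (?x m)) *
      measure (jump_dist F (?k m) (?x m) (?x (Suc m))) (?B m))
    = (\<Prod>m<n. exp (- exit_rate C D (x m) * s m) * (trans_rate C D (k m) (x m) (x (Suc m)) / exit_rate C D (x m)) *
      measure (jump_dist F (k m) (x m) (x (Suc m))) (B m))"
    by (intro prod.cong refl) simp
  show ?thesis
    unfolding e prob_cyl[of ?s ?B "Suc n" ?x ?k, OF s'] prob_cyl[of s B n x k, OF s] prod.lessThan_Suc p
    by (simp add: step_prob_def mult.assoc)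
qed

text \<open>With the discrete path fixed, the factor \<open>step_prob\<close> is a constant and both
  sides are finite measures in \<open>A\<close>. They agree on cylinders, which are stable under
  intersection and generate \<open>hist n\<close>.\<close>

lemma markov_path:
  assumes A: "A \<in> sets (hist n)" and t: "0 \<le> t" "E \<in> sets borel"
  shows "prob (A \<inter> cyl n x k (\<lambda>_. 0) (\<lambda>_. UNIV) \<inter> stp n t \<kappa> y E)
    = prob (A \<inter> cyl n x k (\<lambda>_. 0) (\<lambda>_. UNIV)) * step_prob (x n) t \<kappa> y E"
proof -
  let ?H = "cyl n x k (\<lambda>_. 0) (\<lambda>_. UNIV)" and ?S = "stp n t \<kappa> y E" and ?q = "step_prob (x n) t \<kappa> y E"
  have H [measurable]: "?H \<in> sets P" by (rule sets_cyl) simp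
  have S [measurable]: "?S \<in> sets P" by (rule sets_stp[OF t(2)])
  have HS: "prob (?H \<inter> ?S) = prob ?H * ?q" by (rule prob_cyl_stp) (use t in auto)
  have sub: "sigma_sets (space P) (cyls n) \<subseteq> sets P" using sets_hist_subset[of n] by (simp add: sets_hist)
  have "cyls n \<subseteq> Pow (space P)" using cyls_subset[of n] sets.space_closed[of P] by blast
  with Int_stable_cyls show ?thesis using A unfolding sets_hist
  proof (induction A rule: sigma_sets_induct_disjoint)
    case (basic A)
    show ?case
    proof (cases "A \<inter> ?H = {}")
      case True
      then show ?thesis by simp
    next
      case False
      then obtain x' k' s' B' where A: "A = cyl n x' k' s' B'" "\<forall>m. 0 \<le> s' m" "\<forall>m. B' m \<in> sets borel"
        using basic by (auto simp: cyls_def)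
      obtain w where "w \<in> A \<inter> ?H" using False by blast
      then have eq: "x 0 = x' 0" "\<forall>m<n. k m = k' m \<and> x (Suc m) = x' (Suc m)"
        by (auto simp: A cyl_def)
      \<comment> \<open>Zero thresholds and unrestricted jumps add nothing to \<open>A\<close>, so
        the intersection is again a cylinder.\<close>
      then have "A \<inter> ?H = cyl n x k s' B'"
        unfolding A cyl_def using A(2) T_pos by auto
      then show ?thesis using prob_cyl_stp[of s' B' t E n x k \<kappa> y] A t by simp
    qed
  next
    case (compl A)
    then have [measurable]: "A \<in> sets P" using sub by blast
    have 1: "prob ((space P - A) \<inter> ?H \<inter> ?S) = prob (?H \<inter> ?S) - prob (A \<inter> ?H \<inter> ?S)"
    proof -
      have "(space P - A) \<inter> ?H \<inter> ?S = (?H \<inter> ?S) - (A \<inter> ?H \<inter> ?S)"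
        using sets.sets_into_space[OF H] by blast
      then show ?thesis by (simp only:) (rule finite_measure_Diff; auto)
    qed
    have 2: "prob ((space P - A) \<inter> ?H) = prob ?H - prob (A \<inter> ?H)"
    proof -
      have "(space P - A) \<inter> ?H = ?H - (A \<inter> ?H)"
        using sets.sets_into_space[OF H] by blast
      then show ?thesis by (simp only:) (rule finite_measure_Diff; auto)
    qed
    show ?case unfolding 1 2 HS compl.IH by (simp add: left_diff_distrib)
  next
    case (union A)
    have m [measurable]: "A i \<in> sets P" for i using union(2) sub by blast
    have dis: "disjoint_family (\<lambda>i. A i \<inter> ?H \<inter> ?S)" "disjoint_family (\<lambda>i. A i \<inter> ?H)"
      using union(1) by (auto simp: disjoint_family_on_def)
    have "(\<lambda>i. prob (A i \<inter> ?H \<inter> ?S)) sums prob (\<Union>i. A i \<inter> ?H \<inter> ?S)"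
      by (rule finite_measure_UNION[OF _ dis(1)]) auto
    moreover have "(\<lambda>i. prob (A i \<inter> ?H) * ?q) sums (prob (\<Union>i. A i \<inter> ?H) * ?q)"
      by (intro sums_mult2 finite_measure_UNION dis(2)) auto
    ultimately have "prob (\<Union>i. A i \<inter> ?H \<inter> ?S) = prob (\<Union>i. A i \<inter> ?H) * ?q"
      unfolding union(3) by (rule sums_unique2)
    then show ?case by (simp only: Int_UN_distrib2 UN_simps)
  qed simp
qed

text \<open>Sum over the finitely many discrete paths that end in \<open>a\<close>; the factor is
  the same for all of them.\<close>

lemma markov:
  assumes A: "A \<in> sets (hist n)" and t: "0 \<le> t" "E \<in> sets borel"
  shows "prob (A \<inter> {w \<in> space P. X n w = a} \<inter> stp n t \<kappa> y E)
    = prob (A \<inter> {w \<in> space P. X n w = a}) * step_prob a t \<kappa> y E"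
proof -
  define I where "I = {q \<in> paths n. fst q n = a}"
  define H where "H q = cyl n (fst q) (snd q) (\<lambda>_. 0) (\<lambda>_. UNIV)" for q
  have I: "finite I" unfolding I_def using finite_paths by auto
  have [measurable]: "A \<in> sets P" using A sets_hist_subset by blast
  have H [measurable]: "H q \<in> sets P" for q unfolding H_def by (rule sets_cyl) simp
  have S [measurable]: "stp n t \<kappa> y E \<in> sets P" by (rule sets_stp[OF t(2)])
  have dis: "disjoint_family_on H I"
    unfolding disjoint_family_on_def
  proof (intro ballI impI)
    fix q r assume qr: "q \<in> I" "r \<in> I" "q \<noteq> r"
    show "H q \<inter> H r = {}"
    proof (rule ccontr)
      assume "H q \<inter> H r \<noteq> {}"
      then obtain w where w: "w \<in> H q" "w \<in> H r" by blast
      have 1: "fst q m = fst r m" if "m \<in> {..n}" for m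
        using cyl_state[OF w(1)[unfolded H_def]] cyl_state[OF w(2)[unfolded H_def]] that by simp
      have 2: "snd q m = snd r m" if "m \<in> {..<n}" for m
        using w that by (simp add: H_def cyl_def)
      have "q \<in> paths n" "r \<in> paths n" using qr(1,2) by (simp_all add: I_def)
      then have p: "fst q \<in> PiE {..n} (\<lambda>_. UNIV)" "fst r \<in> PiE {..n} (\<lambda>_. UNIV)"
        "snd q \<in> PiE {..<n} (\<lambda>_. UNIV)" "snd r \<in> PiE {..<n} (\<lambda>_. UNIV)"
        by (simp_all only: paths_def mem_Times_iff)
      have "fst q = fst r" "snd q = snd r"
        by (rule PiE_ext[OF p(1,2) 1], assumption) (rule PiE_ext[OF p(3,4) 2])
      then show False using qr(3) by (simp add: prod_eq_iff)
    qed
  qed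
  have un: "{w \<in> space P. X n w = a} = (\<Union>q\<in>I. H q)"
  proof (intro set_eqI iffI)
    fix w assume w: "w \<in> {w \<in> space P. X n w = a}"
    then obtain q where q: "q \<in> paths n" "X 0 w = fst q 0 \<and> (\<forall>m<n. ty m w = snd q m \<and> X (Suc m) w = fst q (Suc m))"
      using ex_path[of w n] by auto
    then have c: "w \<in> H q" using w T_pos by (auto simp: cyl_def H_def)
    then show "w \<in> (\<Union>q\<in>I. H q)"
      by (intro UN_I[of q]) (use w q(1) cyl_state[OF c[unfolded H_def], of n] in \<open>auto simp: I_def\<close>)
  next
    fix w assume "w \<in> (\<Union>q\<in>I. H q)"
    then obtain q where q: "q \<in> I" "w \<in> H q" by blast
    then show "w \<in> {w \<in> space P. X n w = a}"
      using cyl_state[OF q(2)[unfolded H_def], of n] sets.sets_into_space[OF H[of q]] by (auto simp: I_def)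
  qed
  have "prob (A \<inter> {w \<in> space P. X n w = a} \<inter> stp n t \<kappa> y E) = prob (\<Union>q\<in>I. A \<inter> H q \<inter> stp n t \<kappa> y E)"
    unfolding un by (rule arg_cong[where f=prob]) auto
  also have "\<dots> = (\<Sum>q\<in>I. prob (A \<inter> H q \<inter> stp n t \<kappa> y E))"
    by (intro finite_measure_finite_Union I disjoint_family_on_bisimulation[OF dis]) auto
  also have "\<dots> = (\<Sum>q\<in>I. prob (A \<inter> H q) * step_prob a t \<kappa> y E)"
    unfolding H_def by (intro sum.cong refl) (auto simp: markov_path[OF A t] I_def)
  also have "\<dots> = prob (\<Union>q\<in>I. A \<inter> H q) * step_prob a t \<kappa> y E"
    unfolding sum_distrib_right[symmetric]
    by (subst finite_measure_finite_Union[OF I]) (auto intro!: disjoint_family_on_bisimulation[OF dis])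
  also have "(\<Union>q\<in>I. A \<inter> H q) = A \<inter> {w \<in> space P. X n w = a}" unfolding un by auto
  finally show ?thesis .
qed

end

section \<open>Integrating out the next sojourn time and jump\<close>

lemma emeasure_distr_restricted:
  assumes "W \<in> sets M" "g \<in> measurable M N" "R \<in> sets N"
  shows "emeasure (distr (density M (indicator W)) N g) R = emeasure M (W \<inter> (g -` R \<inter> space M))"
  using assms emeasure_restricted[OF assms(1) measurable_sets[OF assms(2,3)]]
  by (simp add: emeasure_distr)

context MAP_process
begin

text \<open>The value of \<open>Y\<close> at the \<open>n\<close>-th transition epoch.\<close>

definition S :: "nat \<Rightarrow> 'w \<Rightarrow> real" where
  "S n w = (\<Sum>m<n. v (X m w) * T m w + J m w)"

definition Z :: "nat \<Rightarrow> 'w \<Rightarrow> real" where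
  "Z n w = S n w + v (X n w) * T n w"

text \<open>The weak inequality for \<open>Z m\<close>, the level just before the next transition, makes the decomposition of
  the first passage event exact rather than valid up to a null set.\<close>

definition alive :: "nat \<Rightarrow> 'w \<Rightarrow> bool" where
  "alive n w \<longleftrightarrow> (\<forall>m<n. Z m w \<le> 0 \<and> S (Suc m) w < 0)"

lemma S_Suc: "S (Suc n) w = Z n w + J n w"
  by (simp add: S_def Z_def)

lemma v_X_hist: "m \<le> n \<Longrightarrow> (\<lambda>w. v (X m w)) \<in> borel_measurable (hist n)"
  by (rule measurable_compose[OF X_hist, where g = v]) auto

lemma S_hist: "m \<le> n \<Longrightarrow> S m \<in> borel_measurable (hist n)"
  unfolding S_def[abs_def]
  by (intro borel_measurable_sum borel_measurable_add borel_measurable_times v_X_hist T_hist J_hist) auto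

lemma Z_hist: "m < n \<Longrightarrow> Z m \<in> borel_measurable (hist n)"
  unfolding Z_def[abs_def]
  by (intro borel_measurable_add borel_measurable_times v_X_hist T_hist S_hist) auto

lemma measurable_hist: "f \<in> measurable (hist n) N \<Longrightarrow> f \<in> measurable P N"
proof (rule measurableI)
  assume f: "f \<in> measurable (hist n) N"
  show "w \<in> space P \<Longrightarrow> f w \<in> space N" for w
    using measurable_space[OF f, of w] by simp
  show "f -` A \<inter> space P \<in> sets P" if "A \<in> sets N" for A
    using measurable_sets[OF f that] sets_hist_subset[of n] by auto
qed

lemma measurable_T [measurable]: "T n \<in> borel_measurable P" by (rule T_meas)
lemma measurable_J [measurable]: "J n \<in> borel_measurable P" by (rule J_meas)
lemma measurable_X [measurable]: "X n \<in> measurable P (count_space UNIV)" by (rule X_meas)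
lemma measurable_ty [measurable]: "ty n \<in> measurable P (count_space UNIV)" by (rule ty_meas)
lemma measurable_S [measurable]: "S n \<in> borel_measurable P" by (rule measurable_hist[OF S_hist[OF order_refl]])
lemma measurable_Z [measurable]: "Z n \<in> borel_measurable P" by (rule measurable_hist[OF Z_hist[OF lessI]])

lemma alive_hist: "{w \<in> space P. X 0 w = i \<and> alive n w} \<in> sets (hist n)"
proof -
  have [measurable]: "Z m \<in> borel_measurable (hist n)" "S (Suc m) \<in> borel_measurable (hist n)" if "m < n" for m
    using that by (auto intro: Z_hist S_hist)
  have [measurable]: "X 0 \<in> measurable (hist n) (count_space UNIV)" by (rule X_hist) simp
  have "{w \<in> space (hist n). X 0 w = i \<and> (\<forall>m\<in>{..<n}. Z m w \<le> 0 \<and> S (Suc m) w < 0)} \<in> sets (hist n)"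
    by measurable
  then show ?thesis by (simp only: alive_def space_hist Ball_def lessThan_iff)
qed

lemma trans_rate_nonneg: "0 \<le> trans_rate C D \<kappa> a y"
  using C_nonneg[of a y] D_nonneg[of a y] by (cases \<kappa>) auto

text \<open>\<open>law\<close> describes sojourn times only through the rays \<open>{s<..}\<close>.
  These determine the distribution of \<open>T n\<close> on the event that fixes the other data, and
  identify it as a multiple of the exponential law.\<close>

lemma markov_time:
  assumes H: "A \<in> sets (hist n)" and B: "B \<in> sets borel" and E: "E \<in> sets borel"
  shows "emeasure P {w \<in> A. X n w = a \<and> ty n w = \<kappa> \<and> X (Suc n) w = y \<and> T n w \<in> E \<and> J n w \<in> B}
    = emeasure P {w \<in> A. X n w = a} * ennreal (trans_rate C D \<kappa> a y / exit_rate C D a) *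
      emeasure (exp_law (exit_rate C D a)) E * emeasure (jump_dist F \<kappa> a y) B"
proof -
  have A [measurable]: "A \<in> sets P" using H sets_hist_subset by blast
  have sub: "A \<subseteq> space P" using sets.sets_into_space[OF A] .
  note [measurable] = B
  let ?c = "exit_rate C D a" and ?V = "{w \<in> A. X n w = a \<and> ty n w = \<kappa> \<and> X (Suc n) w = y \<and> J n w \<in> B}"
  have V': "?V = {w \<in> space P. w \<in> A \<and> X n w = a \<and> ty n w = \<kappa> \<and> X (Suc n) w = y \<and> J n w \<in> B}"
    using sub by auto
  have V [measurable]: "?V \<in> sets P" unfolding V' by measurable
  let ?q = "prob {w \<in> A. X n w = a} * (trans_rate C D \<kappa> a y / ?c) * measure (jump_dist F \<kappa> a y) B"
  have q0: "0 \<le> ?q" using trans_rate_nonneg exit_rate_pos[of a] by (simp add: less_imp_le)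
  have "distr (density P (indicator ?V)) borel (T n) = scale_measure (ennreal ?q) (exp_law ?c)"
  proof (rule measure_eqI_lessThan)
    have *: "emeasure (distr (density P (indicator ?V)) borel (T n)) {s<..} = ennreal ?q * ennreal (exp (- ?c * max s 0))" for s
    proof -
      have "emeasure (distr (density P (indicator ?V)) borel (T n)) {s<..} = emeasure P (?V \<inter> (T n -` {s<..} \<inter> space P))"
        by (rule emeasure_distr_restricted[OF V]) auto
      also have "?V \<inter> (T n -` {s<..} \<inter> space P) = A \<inter> {w \<in> space P. X n w = a} \<inter> stp n (max s 0) \<kappa> y B"
        using sub T_pos by (auto simp: stp_def)
      also have "emeasure P (A \<inter> {w \<in> space P. X n w = a} \<inter> stp n (max s 0) \<kappa> y B) =
          ennreal (prob (A \<inter> {w \<in> space P. X n w = a}) * step_prob a (max s 0) \<kappa> y B)"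
        unfolding emeasure_eq_measure using markov[OF H, of "max s 0" B a \<kappa> y] B by simp
      also have "A \<inter> {w \<in> space P. X n w = a} = {w \<in> A. X n w = a}" using sub by auto
      also have "prob {w \<in> A. X n w = a} * step_prob a (max s 0) \<kappa> y B = ?q * exp (- ?c * max s 0)"
        by (simp add: step_prob_def)
      finally show ?thesis using q0 by (simp only: ennreal_mult'[OF q0])
    qed
    show "emeasure (distr (density P (indicator ?V)) borel (T n)) {s<..} < \<infinity>" for s
      unfolding * by (simp add: ennreal_mult_less_top)
    show "emeasure (distr (density P (indicator ?V)) borel (T n)) {s<..} = emeasure (scale_measure (ennreal ?q) (exp_law ?c)) {s<..}" for s
      unfolding * by (simp add: emeasure_exp_law_greaterThan exit_rate_pos)
  qed (simp_all add: sets_exp_law)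
  then have "emeasure (distr (density P (indicator ?V)) borel (T n)) E = ennreal ?q * emeasure (exp_law ?c) E" by simp
  moreover have "emeasure (distr (density P (indicator ?V)) borel (T n)) E = emeasure P (?V \<inter> (T n -` E \<inter> space P))"
    using E by (intro emeasure_distr_restricted[OF V]) auto
  moreover have "?V \<inter> (T n -` E \<inter> space P) = {w \<in> A. X n w = a \<and> ty n w = \<kappa> \<and> X (Suc n) w = y \<and> T n w \<in> E \<and> J n w \<in> B}"
    using sub by auto
  moreover have "ennreal ?q = emeasure P {w \<in> A. X n w = a} * ennreal (trans_rate C D \<kappa> a y / ?c) * emeasure (jump_dist F \<kappa> a y) B"
  proof -
    interpret jd: prob_space "jump_dist F \<kappa> a y" by (rule jump_dist_prob)
    show ?thesis unfolding emeasure_eq_measure jd.emeasure_eq_measure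
      using trans_rate_nonneg[of \<kappa> a y] exit_rate_pos[of a] by (simp only: ennreal_mult' measure_nonneg mult_nonneg_nonneg divide_nonneg_nonneg less_imp_le)
  qed
  ultimately show ?thesis by (simp only: mult_ac)
qed

text \<open>\<open>S n\<close> belongs to the past, and \<open>T n\<close> and \<open>J n\<close>
  are independent of it once the state and the kind of transition are fixed. The joint law of the
  three is identified in two rounds, each comparing a measure with a product measure on
  rectangles.\<close>

lemma markov_nn_integral:
  assumes H: "A \<in> sets (hist n)"
    and f [measurable]: "(\<lambda>(s, t, u). f s t u) \<in> borel_measurable (borel \<Otimes>\<^sub>M (borel \<Otimes>\<^sub>M borel))"
  shows "(\<integral>\<^sup>+w. indicator {w \<in> A. X n w = a \<and> ty n w = \<kappa> \<and> X (Suc n) w = y} w * f (S n w) (T n w) (J n w) \<partial>P)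
    = (\<integral>\<^sup>+w. indicator {w \<in> A. X n w = a} w * (ennreal (trans_rate C D \<kappa> a y / exit_rate C D a) *
        (\<integral>\<^sup>+t. \<integral>\<^sup>+u. f (S n w) t u \<partial>jump_dist F \<kappa> a y \<partial>exp_law (exit_rate C D a))) \<partial>P)"
proof -
  have A [measurable]: "A \<in> sets P" using H sets_hist_subset by blast
  have sub: "A \<subseteq> space P" using sets.sets_into_space[OF A] .
  let ?c = "exit_rate C D a"
  let ?E = "exp_law ?c" and ?Jd = "jump_dist F \<kappa> a y" and ?r = "ennreal (trans_rate C D \<kappa> a y / ?c)"
  let ?H = "{w \<in> A. X n w = a}" and ?V = "{w \<in> A. X n w = a \<and> ty n w = \<kappa> \<and> X (Suc n) w = y}"
  have "?V = {w \<in> space P. w \<in> A \<and> X n w = a \<and> ty n w = \<kappa> \<and> X (Suc n) w = y}" using sub by auto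
  then have V [measurable]: "?V \<in> sets P" by simp
  have "?H = {w \<in> space P. w \<in> A \<and> X n w = a}" using sub by auto
  then have Hm [measurable]: "?H \<in> sets P" by simp
  interpret E: prob_space ?E by (rule prob_space_exp_law[OF exit_rate_pos])
  interpret Jd: prob_space ?Jd by (rule jump_dist_prob)
  have scaled: "finite_measure (scale_measure (ennreal r) M)" if "finite_measure M" for r and M :: "real measure"
    using that by (intro finite_measureI) (auto simp: ennreal_mult_eq_top_iff space_scale_measure finite_measure.emeasure_eq_measure)
  let ?EJ = "scale_measure ?r ?E \<Otimes>\<^sub>M ?Jd"
  interpret rE: finite_measure "scale_measure ?r ?E" by (rule scaled) (rule E.finite_measure_axioms)
  have dfin: "finite_measure (density P (indicator U))" if "U \<in> sets P" for U
    using that by (intro finite_measureI) (simp add: emeasure_restricted)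
  \<comment> \<open>First round, for \<open>T n\<close> and \<open>J n\<close>. The past event
    \<open>U\<close> is arbitrary, so that a condition on \<open>S n\<close> can be included
    afterwards.\<close>
  have EJ: "emeasure P {w \<in> U. X n w = a \<and> ty n w = \<kappa> \<and> X (Suc n) w = y \<and> (T n w, J n w) \<in> R}
      = emeasure P {w \<in> U. X n w = a} * emeasure ?EJ R"
    if U: "U \<in> sets (hist n)" and R: "R \<in> sets (borel \<Otimes>\<^sub>M borel)" for U R
  proof -
    have Um [measurable]: "U \<in> sets P" using U sets_hist_subset by blast
    have subU: "U \<subseteq> space P" using sets.sets_into_space[OF Um] .
    let ?W = "{w \<in> U. X n w = a \<and> ty n w = \<kappa> \<and> X (Suc n) w = y}"
    have "?W = {w \<in> space P. w \<in> U \<and> X n w = a \<and> ty n w = \<kappa> \<and> X (Suc n) w = y}" using subU by auto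
    then have W [measurable]: "?W \<in> sets P" by simp
    let ?p = "emeasure P {w \<in> U. X n w = a}"
    have p: "?p = ennreal (prob {w \<in> U. X n w = a})" by (rule emeasure_eq_measure)
    interpret pE: finite_measure "scale_measure ?p (scale_measure ?r ?E)"
      unfolding p by (rule scaled) (rule rE.finite_measure_axioms)
    have eq: "scale_measure ?p (scale_measure ?r ?E) \<Otimes>\<^sub>M ?Jd = distr (density P (indicator ?W)) (borel \<Otimes>\<^sub>M borel) (\<lambda>w. (T n w, J n w))"
    proof (rule pair_measure_eqI)
      show "sets (scale_measure ?p (scale_measure ?r ?E) \<Otimes>\<^sub>M ?Jd) = sets (distr (density P (indicator ?W)) (borel \<Otimes>\<^sub>M borel) (\<lambda>w. (T n w, J n w)))"
        by (simp add: sets_exp_law sets_jump_dist cong: sets_pair_measure_cong)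
      fix E B assume "E \<in> sets (scale_measure ?p (scale_measure ?r ?E))" "B \<in> sets ?Jd"
      then have E: "E \<in> sets borel" and B: "B \<in> sets borel" by (auto simp: sets_exp_law sets_jump_dist)
      have "emeasure (distr (density P (indicator ?W)) (borel \<Otimes>\<^sub>M borel) (\<lambda>w. (T n w, J n w))) (E \<times> B)
        = emeasure P (?W \<inter> ((\<lambda>w. (T n w, J n w)) -` (E \<times> B) \<inter> space P))"
        using E B by (intro emeasure_distr_restricted[OF W]) auto
      also have "?W \<inter> ((\<lambda>w. (T n w, J n w)) -` (E \<times> B) \<inter> space P)
        = {w \<in> U. X n w = a \<and> ty n w = \<kappa> \<and> X (Suc n) w = y \<and> T n w \<in> E \<and> J n w \<in> B}"
        using subU by auto
      finally show "emeasure (scale_measure ?p (scale_measure ?r ?E)) E * emeasure ?Jd B =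
        emeasure (distr (density P (indicator ?W)) (borel \<Otimes>\<^sub>M borel) (\<lambda>w. (T n w, J n w))) (E \<times> B)"
        unfolding markov_time[OF U B E] by (simp add: mult.assoc)
    qed (rule pE.sigma_finite_measure_axioms Jd.sigma_finite_measure_axioms)+
    have R' [measurable]: "R \<in> sets (M1 \<Otimes>\<^sub>M M2)" if "sets M1 = sets borel" "sets M2 = sets borel" for M1 M2 :: "real measure"
      using R sets_pair_measure_cong[OF that] by simp
    have "emeasure P {w \<in> U. X n w = a \<and> ty n w = \<kappa> \<and> X (Suc n) w = y \<and> (T n w, J n w) \<in> R}
      = emeasure P (?W \<inter> ((\<lambda>w. (T n w, J n w)) -` R \<inter> space P))"
      using subU by (intro arg_cong[where f="emeasure P"]) auto
    also have "\<dots> = emeasure (distr (density P (indicator ?W)) (borel \<Otimes>\<^sub>M borel) (\<lambda>w. (T n w, J n w))) R"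
      using R by (intro emeasure_distr_restricted[OF W, symmetric]) auto
    also have "\<dots> = emeasure (scale_measure ?p (scale_measure ?r ?E) \<Otimes>\<^sub>M ?Jd) R" unfolding eq ..
    also have "\<dots> = (\<integral>\<^sup>+t. emeasure ?Jd (Pair t -` R) \<partial>scale_measure ?p (scale_measure ?r ?E))"
      by (rule Jd.emeasure_pair_measure_alt) (rule R'; simp add: sets_exp_law sets_jump_dist)
    also have "\<dots> = ?p * (\<integral>\<^sup>+t. emeasure ?Jd (Pair t -` R) \<partial>scale_measure ?r ?E)"
      by (rule nn_integral_scale_measure, rule Jd.measurable_emeasure_Pair) (rule R'; simp add: sets_exp_law sets_jump_dist)
    also have "(\<integral>\<^sup>+t. emeasure ?Jd (Pair t -` R) \<partial>scale_measure ?r ?E) = emeasure ?EJ R"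
      by (rule Jd.emeasure_pair_measure_alt[symmetric]) (rule R'; simp add: sets_exp_law sets_jump_dist)
    finally show ?thesis .
  qed
  let ?M1 = "distr (density P (indicator ?H)) borel (S n)"
  interpret M1: finite_measure ?M1
    using finite_measure.finite_measure_distr[OF dfin[OF Hm], of "S n" borel] by simp
  interpret EJ: pair_sigma_finite "scale_measure ?r ?E" ?Jd ..
  have sEJ: "sets ?EJ = sets (borel \<Otimes>\<^sub>M borel)"
    by (simp add: sets_exp_law sets_jump_dist cong: sets_pair_measure_cong)
  \<comment> \<open>Second round, for \<open>S n\<close> against the pair of \<open>T n\<close> and
    \<open>J n\<close>.\<close>
  have eq: "?M1 \<Otimes>\<^sub>M ?EJ = distr (density P (indicator ?V)) (borel \<Otimes>\<^sub>M (borel \<Otimes>\<^sub>M borel)) (\<lambda>w. (S n w, T n w, J n w))"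
  proof (rule pair_measure_eqI)
    show "sets (?M1 \<Otimes>\<^sub>M ?EJ) = sets (distr (density P (indicator ?V)) (borel \<Otimes>\<^sub>M (borel \<Otimes>\<^sub>M borel)) (\<lambda>w. (S n w, T n w, J n w)))"
      using sEJ by (simp cong: sets_pair_measure_cong)
    fix B R assume "B \<in> sets ?M1" "R \<in> sets ?EJ"
    then have B: "B \<in> sets borel" and R: "R \<in> sets (borel \<Otimes>\<^sub>M borel)" using sEJ by auto
    have SB: "A \<inter> (S n -` B \<inter> space P) \<in> sets (hist n)"
      using H measurable_sets[OF S_hist[OF order_refl] B] by auto
    have "emeasure ?M1 B = emeasure P (?H \<inter> (S n -` B \<inter> space P))"
      using B by (intro emeasure_distr_restricted[OF Hm]) auto
    moreover have "?H \<inter> (S n -` B \<inter> space P) = {w \<in> A \<inter> (S n -` B \<inter> space P). X n w = a}" by auto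
    moreover have "emeasure (distr (density P (indicator ?V)) (borel \<Otimes>\<^sub>M (borel \<Otimes>\<^sub>M borel)) (\<lambda>w. (S n w, T n w, J n w))) (B \<times> R)
      = emeasure P (?V \<inter> ((\<lambda>w. (S n w, T n w, J n w)) -` (B \<times> R) \<inter> space P))"
      using B R by (intro emeasure_distr_restricted[OF V]) auto
    moreover have "?V \<inter> ((\<lambda>w. (S n w, T n w, J n w)) -` (B \<times> R) \<inter> space P)
      = {w \<in> A \<inter> (S n -` B \<inter> space P). X n w = a \<and> ty n w = \<kappa> \<and> X (Suc n) w = y \<and> (T n w, J n w) \<in> R}" by auto
    ultimately show "emeasure ?M1 B * emeasure ?EJ R =
      emeasure (distr (density P (indicator ?V)) (borel \<Otimes>\<^sub>M (borel \<Otimes>\<^sub>M borel)) (\<lambda>w. (S n w, T n w, J n w))) (B \<times> R)"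
      using EJ[OF SB R] by (simp only:)
  qed (rule M1.sigma_finite_measure_axioms EJ.sigma_finite_measure_axioms)+
  let ?f = "\<lambda>(s, t, u). f s t u"
  have f1: "?f \<in> borel_measurable (?M1 \<Otimes>\<^sub>M ?EJ)"
    using f sEJ by (simp cong: measurable_cong_sets sets_pair_measure_cong)
  have STJ: "(\<lambda>w. (S n w, T n w, J n w)) \<in> measurable P (borel \<Otimes>\<^sub>M (borel \<Otimes>\<^sub>M borel))" by measurable
  have fm: "(\<lambda>w. ?f (S n w, T n w, J n w)) \<in> borel_measurable P"
    by (rule measurable_compose[OF STJ f])
  have "(\<lambda>((s, t), u). (s, t, u)) \<in> measurable ((borel \<Otimes>\<^sub>M ?E) \<Otimes>\<^sub>M ?Jd) (borel \<Otimes>\<^sub>M (borel \<Otimes>\<^sub>M borel))"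
    unfolding split_beta' by measurable
  from measurable_compose[OF this f]
  have f3: "(\<lambda>(p, u). f (fst p) (snd p) u) \<in> borel_measurable ((borel \<Otimes>\<^sub>M ?E) \<Otimes>\<^sub>M ?Jd)"
    by (simp add: split_beta')
  have f2: "(\<lambda>p. \<integral>\<^sup>+u. f (fst p) (snd p) u \<partial>?Jd) \<in> borel_measurable (borel \<Otimes>\<^sub>M ?E)"
    using f3 by (rule Jd.borel_measurable_nn_integral)
  have gm [measurable]: "(\<lambda>s. \<integral>\<^sup>+t. \<integral>\<^sup>+u. f s t u \<partial>?Jd \<partial>?E) \<in> borel_measurable borel"
    by (rule E.borel_measurable_nn_integral) (use f2 in \<open>simp add: split_beta'\<close>)
  have "(\<integral>\<^sup>+w. indicator ?V w * f (S n w) (T n w) (J n w) \<partial>P) = (\<integral>\<^sup>+w. ?f (S n w, T n w, J n w) \<partial>density P (indicator ?V))"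
    using fm by (subst nn_integral_density) auto
  also have "\<dots> = (\<integral>\<^sup>+x. ?f x \<partial>distr (density P (indicator ?V)) (borel \<Otimes>\<^sub>M (borel \<Otimes>\<^sub>M borel)) (\<lambda>w. (S n w, T n w, J n w)))"
    using STJ by (intro nn_integral_distr[symmetric]) simp_all
  also have "\<dots> = (\<integral>\<^sup>+x. ?f x \<partial>(?M1 \<Otimes>\<^sub>M ?EJ))" unfolding eq ..
  also have "\<dots> = (\<integral>\<^sup>+s. \<integral>\<^sup>+p. ?f (s, p) \<partial>?EJ \<partial>?M1)"
    by (rule sigma_finite_measure.nn_integral_fst[OF EJ.sigma_finite_measure_axioms f1, symmetric])
  also have "\<dots> = (\<integral>\<^sup>+s. ?r * (\<integral>\<^sup>+t. \<integral>\<^sup>+u. f s t u \<partial>?Jd \<partial>?E) \<partial>?M1)"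
  proof (rule nn_integral_cong)
    fix s :: real
    have "(\<lambda>p. (s, p)) \<in> measurable ?EJ (borel \<Otimes>\<^sub>M (borel \<Otimes>\<^sub>M borel))"
      unfolding measurable_cong_sets[OF sEJ refl] by measurable
    from measurable_compose[OF this f]
    have fs1: "(\<lambda>p. ?f (s, p)) \<in> borel_measurable ?EJ" .
    have "(\<lambda>t. (s, t)) \<in> measurable ?E (borel \<Otimes>\<^sub>M ?E)" by measurable
    from measurable_compose[OF this f2]
    have fs2: "(\<lambda>t. \<integral>\<^sup>+u. f s t u \<partial>?Jd) \<in> borel_measurable ?E" by simp
    show "(\<integral>\<^sup>+p. ?f (s, p) \<partial>?EJ) = ?r * (\<integral>\<^sup>+t. \<integral>\<^sup>+u. f s t u \<partial>?Jd \<partial>?E)"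
      using Jd.nn_integral_fst[OF fs1] nn_integral_scale_measure[OF fs2, of ?r] by simp
  qed
  also have "\<dots> = (\<integral>\<^sup>+w. ?r * (\<integral>\<^sup>+t. \<integral>\<^sup>+u. f (S n w) t u \<partial>?Jd \<partial>?E) \<partial>density P (indicator ?H))"
    by (intro nn_integral_distr) measurable
  also have "\<dots> = (\<integral>\<^sup>+w. indicator ?H w * (?r * (\<integral>\<^sup>+t. \<integral>\<^sup>+u. f (S n w) t u \<partial>?Jd \<partial>?E)) \<partial>P)"
    by (intro nn_integral_density) measurable
  finally show ?thesis .
qed

end

section \<open>Occupation densities from transition epochs\<close>

context MAP_process
begin

text \<open>The time \<open>(z - y) / v k\<close> leads from level \<open>-z\<close> to level \<open>-y\<close>.\<close>

definition kap :: "'s \<Rightarrow> real \<Rightarrow> real \<Rightarrow> ennreal" where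
  "kap k z y = (if 0 \<le> y \<and> 0 \<le> (z - y) / v k then ennreal (exp (- lam k * \<bar>y - z\<bar>) / \<bar>v k\<bar>) else 0)"

lemma measurable_kap [measurable]: "(\<lambda>(z, y). kap k z y) \<in> borel_measurable (borel \<Otimes>\<^sub>M borel)"
  unfolding kap_def by measurable

text \<open>Substituting \<open>t = (z - y) / v k\<close> turns the exponential law of the sojourn
  time into a kernel in the level. The factor \<open>exit_rate\<close> stays in front, because the
  density of the end of the sojourn is \<open>exit_rate\<close> times the probability that it still
  lasts.\<close>

lemma exp_kernel:
  assumes [measurable]: "g \<in> borel_measurable borel"
  shows "(\<integral>\<^sup>+t. indicator {..0} (- z + v k * t) * g (- z + v k * t) \<partial>exp_law (exit_rate C D k))
    = ennreal (exit_rate C D k) * (\<integral>\<^sup>+y. kap k z y * g (- y) \<partial>lborel)"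
proof -
  let ?c = "exit_rate C D k"
  let ?h = "\<lambda>t. ennreal (?c * exp (- ?c * t)) * indicator {0..} t * (indicator {..0} (- z + v k * t) * g (- z + v k * t))"
  have c: "0 < ?c" by (rule exit_rate_pos)
  have "(\<integral>\<^sup>+t. indicator {..0} (- z + v k * t) * g (- z + v k * t) \<partial>exp_law ?c) = (\<integral>\<^sup>+t. ?h t \<partial>lborel)"
    by (rule nn_integral_exp_law) measurable
  also have "\<dots> = ennreal \<bar>- 1 / v k\<bar> * (\<integral>\<^sup>+y. ?h (z / v k + (- 1 / v k) * y) \<partial>lborel)"
  proof (rule nn_integral_real_affine)
    show "?h \<in> borel_measurable borel" by measurable
  qed (use v_nonzero in simp)
  also have "\<dots> = (\<integral>\<^sup>+y. ennreal \<bar>- 1 / v k\<bar> * ?h (z / v k + (- 1 / v k) * y) \<partial>lborel)"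
    by (rule nn_integral_cmult[symmetric]) measurable
  also have "\<dots> = (\<integral>\<^sup>+y. ennreal ?c * (kap k z y * g (- y)) \<partial>lborel)"
  proof (rule nn_integral_cong)
    fix y
    let ?t = "z / v k + (- 1 / v k) * y"
    have t: "?t = (z - y) / v k" by (simp add: diff_divide_distrib)
    have m: "- z + v k * ?t = - y" unfolding t using v_nonzero[of k] by simp
    have ab: "?c * ?t = lam k * \<bar>y - z\<bar>" if "0 \<le> (z - y) / v k"
    proof -
      have "(z - y) / v k = \<bar>y - z\<bar> / \<bar>v k\<bar>" using that by (metis abs_divide abs_minus_commute abs_of_nonneg)
      then show ?thesis unfolding t by (simp add: lam_def)
    qed
    show "ennreal \<bar>- 1 / v k\<bar> * ?h ?t = ennreal ?c * (kap k z y * g (- y))"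
    proof (cases "0 \<le> y \<and> 0 \<le> (z - y) / v k")
      case True
      have "ennreal \<bar>- 1 / v k\<bar> * ennreal (?c * exp (- ?c * ?t)) = ennreal ?c * ennreal (exp (- lam k * \<bar>y - z\<bar>) / \<bar>v k\<bar>)"
        using c True ab by (simp add: ennreal_mult'[symmetric])
      then show ?thesis unfolding m using True t by (simp add: kap_def mult.assoc[symmetric])
    next
      case False
      then show ?thesis unfolding m using t by (auto simp: kap_def)
    qed
  qed
  also have "\<dots> = ennreal ?c * (\<integral>\<^sup>+y. kap k z y * g (- y) \<partial>lborel)"
    by (rule nn_integral_cmult) measurable
  finally show ?thesis .
qed

lemma kap_sweep:
  assumes y: "0 \<le> y"
  shows "(\<integral>\<^sup>+z. indicator {0<..} z * kap k z y * r z \<partial>lborel) = sweep k r y"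
  unfolding sweep_def
proof (rule nn_integral_cong_AE)
  \<comment> \<open>The open range \<open>{0<..}\<close> excludes a single point of the range of
    \<open>sweep\<close>.\<close>
  have "AE z in lborel. z \<noteq> (0::real)" by (rule AE_lborel_singleton)
  then show "AE z in lborel. indicator {0<..} z * kap k z y * r z =
      indicator (if v k < 0 then {0..y} else {y..}) z * ennreal (exp (- lam k * \<bar>y - z\<bar>) / \<bar>v k\<bar>) * r z"
  proof eventually_elim
    case (elim z)
    have "0 \<le> (z - y) / v k \<longleftrightarrow> (if v k < 0 then z \<le> y else y \<le> z)"
      using v_nonzero[of k] by (auto simp: zero_le_divide_iff)
    then show ?case using y elim by (auto simp: kap_def indicator_def)
  qed
qed

definition base :: "'s \<Rightarrow> nat \<Rightarrow> 'w set" where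
  "base i n = {w \<in> space P. X 0 w = i \<and> alive n w}"

lemma base_hist: "base i n \<in> sets (hist n)"
  unfolding base_def by (rule alive_hist)

lemma sets_base [measurable]: "base i n \<in> sets P"
  using base_hist sets_hist_subset by blast

lemma base_Suc: "base i (Suc n) = {w \<in> base i n. Z n w \<le> 0 \<and> S (Suc n) w < 0}"
  by (auto simp: base_def alive_def less_Suc_eq)

lemma base_space: "w \<in> base i n \<Longrightarrow> w \<in> space P"
  by (simp add: base_def)

lemma sets_base_Collect:
  assumes "{w \<in> space P. Q w} \<in> sets P"
  shows "{w \<in> base i n. Q w} \<in> sets P"
proof -
  have "{w \<in> base i n. Q w} = base i n \<inter> {w \<in> space P. Q w}" using base_space by auto
  then show ?thesis using assms by auto
qed

text \<open>Undoes the normalization of \<open>occ_n\<close> and accounts for the initial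
  distribution.\<close>

definition scale :: "'s \<Rightarrow> ennreal" where
  "scale i = ennreal (prob {w \<in> space P. X 0 w = i} / \<bar>v i\<bar>)"

text \<open>In weak form: on survival, the level at the end of the \<open>n\<close>-th sojourn has
  the occupation density times the exit rate as its density. The sojourn time is integrated against
  its law, so that only the past is involved.\<close>

definition level_law :: "'s \<Rightarrow> nat \<Rightarrow> bool" where
  "level_law i n \<longleftrightarrow> (\<forall>k. \<forall>g\<in>borel_measurable borel.
    (\<integral>\<^sup>+w. indicator {w \<in> base i n. X n w = k} w *
       (\<integral>\<^sup>+t. indicator {..0} (S n w + v k * t) * g (S n w + v k * t) \<partial>exp_law (exit_rate C D k)) \<partial>P)
    = scale i * ennreal (exit_rate C D k) * (\<integral>\<^sup>+y. indicator {0..} y * occ_n n i k y * g (- y) \<partial>lborel))"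

lemma level_law_0:
  assumes i: "v i < 0"
  shows "level_law i 0"
  unfolding level_law_def
proof (intro allI ballI)
  fix k and g :: "real \<Rightarrow> ennreal" assume [measurable]: "g \<in> borel_measurable borel"
  let ?K = "\<integral>\<^sup>+t. indicator {..0} (- 0 + v k * t) * g (- 0 + v k * t) \<partial>exp_law (exit_rate C D k)"
  show "(\<integral>\<^sup>+w. indicator {w \<in> base i 0. X 0 w = k} w *
       (\<integral>\<^sup>+t. indicator {..0} (S 0 w + v k * t) * g (S 0 w + v k * t) \<partial>exp_law (exit_rate C D k)) \<partial>P)
    = scale i * ennreal (exit_rate C D k) * (\<integral>\<^sup>+y. indicator {0..} y * occ_n 0 i k y * g (- y) \<partial>lborel)"
  proof (cases "k = i")
    case True
    have "{w \<in> base i 0. X 0 w = k} = {w \<in> space P. X 0 w = i}" using True by (auto simp: base_def alive_def)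
    then have "(\<integral>\<^sup>+w. indicator {w \<in> base i 0. X 0 w = k} w *
       (\<integral>\<^sup>+t. indicator {..0} (S 0 w + v k * t) * g (S 0 w + v k * t) \<partial>exp_law (exit_rate C D k)) \<partial>P)
      = (\<integral>\<^sup>+w. ?K * indicator {w \<in> space P. X 0 w = i} w \<partial>P)" by (simp add: S_def mult.commute)
    also have "\<dots> = ?K * emeasure P {w \<in> space P. X 0 w = i}"
      by (rule nn_integral_cmult_indicator) measurable
    also have "?K = ennreal (exit_rate C D k) * (\<integral>\<^sup>+y. kap k 0 y * g (- y) \<partial>lborel)"
      by (rule exp_kernel) measurable
    also have "(\<integral>\<^sup>+y. kap k 0 y * g (- y) \<partial>lborel) = (\<integral>\<^sup>+y. ennreal (1 / \<bar>v i\<bar>) * (indicator {0..} y * occ_n 0 i k y * g (- y)) \<partial>lborel)"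
    proof (rule nn_integral_cong)
      fix y :: real
      have "0 \<le> (0 - y) / v k \<longleftrightarrow> 0 \<le> y" using i True by (simp add: zero_le_divide_iff divide_le_0_iff)
      moreover have "ennreal (exp (- lam k * y) / \<bar>v k\<bar>) = ennreal (1 / \<bar>v i\<bar>) * ennreal (exp (- lam k * y))"
        using True by (simp add: ennreal_mult'[symmetric])
      ultimately show "kap k 0 y * g (- y) = ennreal (1 / \<bar>v i\<bar>) * (indicator {0..} y * occ_n 0 i k y * g (- y))"
        using True by (auto simp: kap_def indicator_def mult.assoc)
    qed
    also have "\<dots> = ennreal (1 / \<bar>v i\<bar>) * (\<integral>\<^sup>+y. indicator {0..} y * occ_n 0 i k y * g (- y) \<partial>lborel)"
      by (rule nn_integral_cmult) (use measurable_occ_n[of 0 i k] in measurable)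
    finally show ?thesis
      unfolding scale_def emeasure_eq_measure
      by (simp add: ennreal_mult'[symmetric, of "1 / \<bar>v i\<bar>"] divide_inverse ennreal_mult' mult_ac)
  next
    case False
    then have "{w \<in> base i 0. X 0 w = k} = {}" by (auto simp: base_def)
    then show ?thesis using False by simp
  qed
qed

definition Coff :: "'s \<Rightarrow> 's \<Rightarrow> real" where
  "Coff k j = (if k = j then 0 else C $ k $ j)"

text \<open>Each source state \<open>k\<close> contributes its density of the level before the
  transition, and the exit rate in \<open>level_law\<close> cancels the denominator of the
  transition probability.\<close>

lemma step_law:
  assumes law: "level_law i n"
    and h: "(\<lambda>(a, u). h a u) \<in> borel_measurable (borel \<Otimes>\<^sub>M borel)"
  shows "(\<integral>\<^sup>+w. indicator {w \<in> base i n. X (Suc n) w = j \<and> Z n w \<le> 0} w * h (Z n w) (J n w) \<partial>P)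
    = scale i * (\<Sum>k\<in>UNIV. \<integral>\<^sup>+y. indicator {0..} y * occ_n n i k y *
        (ennreal (Coff k j) * h (- y) 0 + ennreal (D $ k $ j) * (\<integral>\<^sup>+u. h (- y) u \<partial>F k j)) \<partial>lborel)"
proof -
  have ha [measurable]: "(\<lambda>w. h (a w) (b w)) \<in> borel_measurable M" if [measurable]: "a \<in> borel_measurable M" "b \<in> borel_measurable M" for a b and M :: "'z measure"
  proof -
    have "(\<lambda>w. (a w, b w)) \<in> measurable M (borel \<Otimes>\<^sub>M borel)" by measurable
    from measurable_compose[OF this h] show ?thesis by simp
  qed
  define G where "G \<kappa> k a = (\<integral>\<^sup>+u. h a u \<partial>jump_dist F \<kappa> k j)" for \<kappa> k a
  have mG [measurable]: "G \<kappa> k \<in> borel_measurable borel" for \<kappa> k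
  proof -
    interpret Jd: prob_space "jump_dist F \<kappa> k j" by (rule jump_dist_prob)
    have "(\<lambda>(a, u). h a u) \<in> borel_measurable (borel \<Otimes>\<^sub>M jump_dist F \<kappa> k j)"
      using h by (simp cong: measurable_cong_sets sets_pair_measure_cong add: sets_jump_dist)
    then show ?thesis unfolding G_def[abs_def] by (rule Jd.borel_measurable_nn_integral)
  qed
  let ?V = "\<lambda>k \<kappa>. {w \<in> base i n. X n w = k \<and> ty n w = \<kappa> \<and> X (Suc n) w = j}"
  let ?f = "\<lambda>k s t u. indicator {..0} (s + v k * t) * h (s + v k * t) u"
  have split: "indicator {w \<in> base i n. X (Suc n) w = j \<and> Z n w \<le> 0} w * h (Z n w) (J n w)
      = (\<Sum>k\<in>UNIV. \<Sum>\<kappa>\<in>UNIV. indicator (?V k \<kappa>) w * ?f k (S n w) (T n w) (J n w))" for w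
  proof -
    have "(\<Sum>k\<in>UNIV. \<Sum>\<kappa>\<in>UNIV. indicator (?V k \<kappa>) w * ?f k (S n w) (T n w) (J n w))
      = (\<Sum>k\<in>UNIV. \<Sum>\<kappa>\<in>UNIV. if \<kappa> = ty n w then if k = X n w then
          indicator {w \<in> base i n. X (Suc n) w = j \<and> Z n w \<le> 0} w * h (Z n w) (J n w) else 0 else 0)"
      by (intro sum.cong refl) (auto simp: indicator_def Z_def)
    also have "\<dots> = indicator {w \<in> base i n. X (Suc n) w = j \<and> Z n w \<le> 0} w * h (Z n w) (J n w)"
      by (simp add: finite_trans_type)
    finally show ?thesis ..
  qed
  have V [measurable]: "?V k \<kappa> \<in> sets P" for k \<kappa> by (rule sets_base_Collect) simp
  have part: "(\<integral>\<^sup>+w. indicator (?V k \<kappa>) w * ?f k (S n w) (T n w) (J n w) \<partial>P)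
      = scale i * (\<integral>\<^sup>+y. indicator {0..} y * occ_n n i k y * (ennreal (trans_rate C D \<kappa> k j) * G \<kappa> k (- y)) \<partial>lborel)" for k \<kappa>
  proof -
    let ?c = "exit_rate C D k" and ?H = "{w \<in> base i n. X n w = k}"
    let ?r = "ennreal (trans_rate C D \<kappa> k j / ?c)"
    have H: "?H \<in> sets P" by (rule sets_base_Collect) simp
    have fm: "(\<lambda>(s, t, u). ?f k s t u) \<in> borel_measurable (borel \<Otimes>\<^sub>M (borel \<Otimes>\<^sub>M borel))"
    proof -
      have "(\<lambda>(s, t, u). (s + v k * t, u)) \<in> measurable (borel \<Otimes>\<^sub>M (borel \<Otimes>\<^sub>M borel)) (borel \<Otimes>\<^sub>M borel)"
        unfolding split_beta' by measurable
      from measurable_compose[OF this h]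
      have "(\<lambda>p. h (fst p + v k * fst (snd p)) (snd (snd p))) \<in> borel_measurable (borel \<Otimes>\<^sub>M (borel \<Otimes>\<^sub>M borel))"
        by (simp add: split_beta')
      then show ?thesis unfolding split_beta' by measurable
    qed
    have inner: "(\<integral>\<^sup>+u. ?f k s t u \<partial>jump_dist F \<kappa> k j) = indicator {..0} (s + v k * t) * G \<kappa> k (s + v k * t)" for s t
      unfolding G_def by (cases "s + v k * t \<in> {..0}") simp_all
    interpret E: prob_space "exp_law ?c" by (rule prob_space_exp_law[OF exit_rate_pos])
    have Km: "(\<lambda>s. \<integral>\<^sup>+t. indicator {..0} (s + v k * t) * G \<kappa> k (s + v k * t) \<partial>exp_law ?c) \<in> borel_measurable borel"
      by (rule E.borel_measurable_nn_integral) measurable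
    have "(\<integral>\<^sup>+w. indicator (?V k \<kappa>) w * ?f k (S n w) (T n w) (J n w) \<partial>P)
      = (\<integral>\<^sup>+w. indicator ?H w * (?r * (\<integral>\<^sup>+t. \<integral>\<^sup>+u. ?f k (S n w) t u \<partial>jump_dist F \<kappa> k j \<partial>exp_law ?c)) \<partial>P)"
      by (rule markov_nn_integral[OF base_hist fm])
    also have "\<dots> = (\<integral>\<^sup>+w. ?r * (indicator ?H w * (\<integral>\<^sup>+t. indicator {..0} (S n w + v k * t) * G \<kappa> k (S n w + v k * t) \<partial>exp_law ?c)) \<partial>P)"
      unfolding inner by (simp only: mult.left_commute)
    also have "\<dots> = ?r * (\<integral>\<^sup>+w. indicator ?H w * (\<integral>\<^sup>+t. indicator {..0} (S n w + v k * t) * G \<kappa> k (S n w + v k * t) \<partial>exp_law ?c) \<partial>P)"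
      using H Km measurable_compose[OF measurable_S Km] by (intro nn_integral_cmult) measurable
    also have "\<dots> = ?r * (scale i * ennreal ?c * (\<integral>\<^sup>+y. indicator {0..} y * occ_n n i k y * G \<kappa> k (- y) \<partial>lborel))"
      using law mG[of \<kappa> k] by (simp only: level_law_def)
    also have "\<dots> = scale i * (ennreal (trans_rate C D \<kappa> k j) * (\<integral>\<^sup>+y. indicator {0..} y * occ_n n i k y * G \<kappa> k (- y) \<partial>lborel))"
    proof -
      have "?r * ennreal ?c = ennreal (trans_rate C D \<kappa> k j)"
        using exit_rate_pos[of k] trans_rate_nonneg[of \<kappa> k j] by (simp add: ennreal_mult'[symmetric])
      moreover have "?r * (scale i * ennreal ?c * I) = scale i * (?r * ennreal ?c * I)" for I by (simp only: mult_ac)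
      ultimately show ?thesis by (simp only:)
    qed
    also have "\<dots> = scale i * (\<integral>\<^sup>+y. ennreal (trans_rate C D \<kappa> k j) * (indicator {0..} y * occ_n n i k y * G \<kappa> k (- y)) \<partial>lborel)"
      by (subst nn_integral_cmult[symmetric]) simp_all
    finally show ?thesis by (simp only: mult.left_commute)
  qed
  have fP: "(\<lambda>w. ?f k (S n w) (T n w) (J n w)) \<in> borel_measurable P" for k by measurable
  have "(\<integral>\<^sup>+w. indicator {w \<in> base i n. X (Suc n) w = j \<and> Z n w \<le> 0} w * h (Z n w) (J n w) \<partial>P)
    = (\<Sum>k\<in>UNIV. \<Sum>\<kappa>\<in>UNIV. \<integral>\<^sup>+w. indicator (?V k \<kappa>) w * ?f k (S n w) (T n w) (J n w) \<partial>P)"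
    unfolding split using fP by (simp add: nn_integral_sum)
  also have "\<dots> = scale i * (\<Sum>k\<in>UNIV. \<integral>\<^sup>+y. (\<Sum>\<kappa>\<in>UNIV. indicator {0..} y * occ_n n i k y *
      (ennreal (trans_rate C D \<kappa> k j) * G \<kappa> k (- y))) \<partial>lborel)"
  proof -
    have s: "(\<integral>\<^sup>+y. (\<Sum>\<kappa>\<in>UNIV. indicator {0..} y * occ_n n i k y * (ennreal (trans_rate C D \<kappa> k j) * G \<kappa> k (- y))) \<partial>lborel)
      = (\<Sum>\<kappa>\<in>UNIV. \<integral>\<^sup>+y. indicator {0..} y * occ_n n i k y * (ennreal (trans_rate C D \<kappa> k j) * G \<kappa> k (- y)) \<partial>lborel)" for k
      by (rule nn_integral_sum) measurable
    show ?thesis unfolding s by (simp only: part sum_distrib_left)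
  qed
  also have "\<dots> = scale i * (\<Sum>k\<in>UNIV. \<integral>\<^sup>+y. indicator {0..} y * occ_n n i k y *
        (ennreal (Coff k j) * h (- y) 0 + ennreal (D $ k $ j) * (\<integral>\<^sup>+u. h (- y) u \<partial>F k j)) \<partial>lborel)"
  proof (intro arg_cong[where f="\<lambda>x. scale i * x"] sum.cong refl nn_integral_cong)
    fix k y
    have "G TypeC k (- y) = h (- y) 0" unfolding G_def by (simp add: nn_integral_return)
    then show "(\<Sum>\<kappa>\<in>UNIV. indicator {0..} y * occ_n n i k y * (ennreal (trans_rate C D \<kappa> k j) * G \<kappa> k (- y)))
      = indicator {0..} y * occ_n n i k y *
        (ennreal (Coff k j) * h (- y) 0 + ennreal (D $ k $ j) * (\<integral>\<^sup>+u. h (- y) u \<partial>F k j))"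
      by (simp add: UNIV_trans_type Coff_def G_def distrib_left)
  qed
  finally show ?thesis .
qed

text \<open>Fubini and the substitution \<open>y = z + u\<close>. As \<open>u\<close> is almost
  surely positive, \<open>0 < z\<close> already implies \<open>0 \<le> z + u\<close>.\<close>

lemma nn_integral_shift_F:
  assumes o [measurable]: "q \<in> borel_measurable borel" and [measurable]: "f \<in> borel_measurable borel"
  shows "(\<integral>\<^sup>+y. indicator {0..} y * q y * (\<integral>\<^sup>+u. indicator {..<0} (- y + u) * f (- y + u) \<partial>F k j) \<partial>lborel)
    = (\<integral>\<^sup>+z. indicator {0<..} z * (\<integral>\<^sup>+u. q (z + u) \<partial>F k j) * f (- z) \<partial>lborel)"
proof -
  interpret Fk: prob_space "F k j" by (rule prob_space_F)
  interpret FL: pair_sigma_finite "F k j" "lborel :: real measure" ..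
  have "(\<integral>\<^sup>+y. indicator {0..} y * q y * (\<integral>\<^sup>+u. indicator {..<0} (- y + u) * f (- y + u) \<partial>F k j) \<partial>lborel)
    = (\<integral>\<^sup>+y. \<integral>\<^sup>+u. indicator {0..} y * q y * (indicator {..<0} (- y + u) * f (- y + u)) \<partial>F k j \<partial>lborel)"
    by (intro nn_integral_cong nn_integral_cmult[symmetric]) measurable
  also have "\<dots> = (\<integral>\<^sup>+u. \<integral>\<^sup>+y. indicator {0..} y * q y * (indicator {..<0} (- y + u) * f (- y + u)) \<partial>lborel \<partial>F k j)"
    by (rule FL.Fubini') measurable
  also have "\<dots> = (\<integral>\<^sup>+u. \<integral>\<^sup>+z. indicator {0<..} z * q (z + u) * f (- z) \<partial>lborel \<partial>F k j)"
  proof (rule nn_integral_cong_AE)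
    show "AE u in F k j. (\<integral>\<^sup>+y. indicator {0..} y * q y * (indicator {..<0} (- y + u) * f (- y + u)) \<partial>lborel)
        = (\<integral>\<^sup>+z. indicator {0<..} z * q (z + u) * f (- z) \<partial>lborel)"
      using AE_F_pos[of k j]
    proof eventually_elim
      case (elim u)
      have "(\<integral>\<^sup>+y. indicator {0..} y * q y * (indicator {..<0} (- y + u) * f (- y + u)) \<partial>lborel)
        = ennreal \<bar>1\<bar> * (\<integral>\<^sup>+z. indicator {0..} (u + 1 * z) * q (u + 1 * z) * (indicator {..<0} (- (u + 1 * z) + u) * f (- (u + 1 * z) + u)) \<partial>lborel)"
        by (rule nn_integral_real_affine) simp_all
      also have "\<dots> = (\<integral>\<^sup>+z. indicator {0..} (u + 1 * z) * q (u + 1 * z) * (indicator {..<0} (- (u + 1 * z) + u) * f (- (u + 1 * z) + u)) \<partial>lborel)"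
        by simp
      also have "\<dots> = (\<integral>\<^sup>+z. indicator {0<..} z * q (z + u) * f (- z) \<partial>lborel)"
        using elim by (intro nn_integral_cong) (auto simp: indicator_def add.commute)
      finally show ?case .
    qed
  qed
  also have "\<dots> = (\<integral>\<^sup>+z. \<integral>\<^sup>+u. indicator {0<..} z * q (z + u) * f (- z) \<partial>F k j \<partial>lborel)"
    by (rule FL.Fubini'[symmetric]) measurable
  also have "\<dots> = (\<integral>\<^sup>+z. indicator {0<..} z * (\<integral>\<^sup>+u. q (z + u) \<partial>F k j) * f (- z) \<partial>lborel)"
    by (intro nn_integral_cong) (simp add: nn_integral_cmult nn_integral_multc)
  finally show ?thesis .
qed

text \<open>A transition that lands at depth \<open>z\<close> started at depth \<open>z\<close>
  (type C) or \<open>z + u\<close> (type D), which is how \<open>inflow\<close> is built.\<close>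

lemma next_law:
  assumes law: "level_law i n" and [measurable]: "f \<in> borel_measurable borel"
  shows "(\<integral>\<^sup>+w. indicator {w \<in> base i (Suc n). X (Suc n) w = j} w * f (S (Suc n) w) \<partial>P)
    = scale i * (\<integral>\<^sup>+z. indicator {0<..} z * inflow (occ_n n i) j z * f (- z) \<partial>lborel)"
proof -
  let ?h = "\<lambda>a u. indicator {..<0} (a + u) * f (a + u)"
  let ?q = "\<lambda>k z. ennreal (Coff k j) * occ_n n i k z"
  let ?Q = "\<lambda>k z. ennreal (D $ k $ j) * (\<integral>\<^sup>+u. occ_n n i k (z + u) \<partial>F k j)"
  have mo [measurable]: "(\<lambda>z. \<integral>\<^sup>+u. occ_n n i k (z + u) \<partial>F k j) \<in> borel_measurable borel" for k
    by (rule sigma_finite_measure.borel_measurable_nn_integral[OF sigma_finite_F]) measurable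
  define I where "I k y = (\<integral>\<^sup>+u. ?h (- y) u \<partial>F k j)" for k y
  have mf [measurable]: "I k \<in> borel_measurable borel" for k
    unfolding I_def[abs_def] by (rule sigma_finite_measure.borel_measurable_nn_integral[OF sigma_finite_F]) measurable
  have "(\<integral>\<^sup>+w. indicator {w \<in> base i (Suc n). X (Suc n) w = j} w * f (S (Suc n) w) \<partial>P)
    = (\<integral>\<^sup>+w. indicator {w \<in> base i n. X (Suc n) w = j \<and> Z n w \<le> 0} w * ?h (Z n w) (J n w) \<partial>P)"
    by (intro nn_integral_cong) (auto simp: base_Suc S_Suc indicator_def)
  also have "\<dots> = scale i * (\<Sum>k\<in>UNIV. \<integral>\<^sup>+y. indicator {0..} y * occ_n n i k y *
        (ennreal (Coff k j) * ?h (- y) 0 + ennreal (D $ k $ j) * I k y) \<partial>lborel)"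
    unfolding I_def by (rule step_law[OF law]) measurable
  also have "\<dots> = scale i * (\<Sum>k\<in>UNIV. \<integral>\<^sup>+z. indicator {0<..} z * (?q k z + ?Q k z) * f (- z) \<partial>lborel)"
  proof (intro arg_cong[where f="\<lambda>x. scale i * x"] sum.cong refl)
    fix k
    have "(\<integral>\<^sup>+y. indicator {0..} y * occ_n n i k y *
        (ennreal (Coff k j) * ?h (- y) 0 + ennreal (D $ k $ j) * I k y) \<partial>lborel)
      = (\<integral>\<^sup>+y. indicator {0<..} y * ?q k y * f (- y) +
         ennreal (D $ k $ j) * (indicator {0..} y * occ_n n i k y * I k y) \<partial>lborel)"
      by (intro nn_integral_cong) (auto simp: indicator_def distrib_left mult_ac)
    also have "\<dots> = (\<integral>\<^sup>+y. indicator {0<..} y * ?q k y * f (- y) \<partial>lborel) +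
         ennreal (D $ k $ j) * (\<integral>\<^sup>+y. indicator {0..} y * occ_n n i k y * I k y \<partial>lborel)"
      by (simp add: nn_integral_add nn_integral_cmult)
    also have "\<dots> = (\<integral>\<^sup>+y. indicator {0<..} y * ?q k y * f (- y) \<partial>lborel) +
         ennreal (D $ k $ j) * (\<integral>\<^sup>+z. indicator {0<..} z * (\<integral>\<^sup>+u. occ_n n i k (z + u) \<partial>F k j) * f (- z) \<partial>lborel)"
      by (simp only: I_def nn_integral_shift_F[OF measurable_occ_n assms(2)])
    also have "\<dots> = (\<integral>\<^sup>+y. indicator {0<..} y * ?q k y * f (- y) +
         ennreal (D $ k $ j) * (indicator {0<..} y * (\<integral>\<^sup>+u. occ_n n i k (y + u) \<partial>F k j) * f (- y)) \<partial>lborel)"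
      by (simp add: nn_integral_add nn_integral_cmult)
    also have "\<dots> = (\<integral>\<^sup>+z. indicator {0<..} z * (?q k z + ?Q k z) * f (- z) \<partial>lborel)"
      by (intro nn_integral_cong) (auto simp: indicator_def distrib_left distrib_right mult_ac)
    finally show "(\<integral>\<^sup>+y. indicator {0..} y * occ_n n i k y *
        (ennreal (Coff k j) * ?h (- y) 0 + ennreal (D $ k $ j) * I k y) \<partial>lborel)
      = (\<integral>\<^sup>+z. indicator {0<..} z * (?q k z + ?Q k z) * f (- z) \<partial>lborel)" .
  qed
  also have "\<dots> = scale i * (\<integral>\<^sup>+z. (\<Sum>k\<in>UNIV. indicator {0<..} z * (?q k z + ?Q k z) * f (- z)) \<partial>lborel)"
    by (simp add: nn_integral_sum)
  also have "\<dots> = scale i * (\<integral>\<^sup>+z. indicator {0<..} z * inflow (occ_n n i) j z * f (- z) \<partial>lborel)"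
  proof (intro arg_cong[where f="\<lambda>x. scale i * x"] nn_integral_cong)
    fix z
    have "(\<Sum>k\<in>UNIV. ?q k z) = (\<Sum>k\<in>-{j}. ennreal (C $ k $ j) * occ_n n i k z)"
      by (intro sum.mono_neutral_cong_right) (auto simp: Coff_def)
    then have "(\<Sum>k\<in>UNIV. ?q k z + ?Q k z) = inflow (occ_n n i) j z"
      by (simp add: inflow_def sum.distrib)
    then show "(\<Sum>k\<in>UNIV. indicator {0<..} z * (?q k z + ?Q k z) * f (- z))
      = indicator {0<..} z * inflow (occ_n n i) j z * f (- z)"
      by (simp only: sum_distrib_left[symmetric] sum_distrib_right[symmetric])
  qed
  finally show ?thesis .
qed

text \<open>The sojourn after landing spreads the landing density by the kernel \<open>kap\<close>;
  exchanging the integrals leaves \<open>sweep\<close>.\<close>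

lemma level_law_Suc:
  assumes law: "level_law i n"
  shows "level_law i (Suc n)"
  unfolding level_law_def
proof (intro allI ballI)
  fix k and g :: "real \<Rightarrow> ennreal" assume g [measurable]: "g \<in> borel_measurable borel"
  let ?f = "\<lambda>s. \<integral>\<^sup>+t. indicator {..0} (s + v k * t) * g (s + v k * t) \<partial>exp_law (exit_rate C D k)"
  let ?c = "ennreal (exit_rate C D k)"
  let ?r = "inflow (occ_n n i) k"
  interpret E: prob_space "exp_law (exit_rate C D k)" by (rule prob_space_exp_law[OF exit_rate_pos])
  have fm: "?f \<in> borel_measurable borel"
    by (rule E.borel_measurable_nn_integral) measurable
  have rm [measurable]: "?r \<in> borel_measurable borel" by (intro measurable_inflow measurable_occ_n)
  have "(\<integral>\<^sup>+w. indicator {w \<in> base i (Suc n). X (Suc n) w = k} w * ?f (S (Suc n) w) \<partial>P)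
    = scale i * (\<integral>\<^sup>+z. indicator {0<..} z * ?r z * ?f (- z) \<partial>lborel)"
    by (rule next_law[OF law fm])
  also have "\<dots> = scale i * (\<integral>\<^sup>+z. \<integral>\<^sup>+y. ?c * (indicator {0<..} z * kap k z y * ?r z * g (- y)) \<partial>lborel \<partial>lborel)"
  proof (intro arg_cong[where f="\<lambda>x. scale i * x"] nn_integral_cong)
    fix z
    have "indicator {0<..} z * ?r z * ?f (- z) = indicator {0<..} z * ?r z * (?c * (\<integral>\<^sup>+y. kap k z y * g (- y) \<partial>lborel))"
      by (simp only: exp_kernel[OF g])
    also have "\<dots> = ?c * (indicator {0<..} z * ?r z * (\<integral>\<^sup>+y. kap k z y * g (- y) \<partial>lborel))"
      by (simp only: mult_ac)
    also have "\<dots> = (\<integral>\<^sup>+y. ?c * (indicator {0<..} z * ?r z * (kap k z y * g (- y))) \<partial>lborel)"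
      by (simp add: nn_integral_cmult)
    finally show "indicator {0<..} z * ?r z * ?f (- z) = (\<integral>\<^sup>+y. ?c * (indicator {0<..} z * kap k z y * ?r z * g (- y)) \<partial>lborel)"
      by (simp only: mult_ac)
  qed
  also have "\<dots> = scale i * (\<integral>\<^sup>+y. \<integral>\<^sup>+z. ?c * (indicator {0<..} z * kap k z y * ?r z * g (- y)) \<partial>lborel \<partial>lborel)"
    by (intro arg_cong[where f="\<lambda>x. scale i * x"] lborel_pair.Fubini') measurable
  also have "\<dots> = scale i * (\<integral>\<^sup>+y. ?c * (indicator {0..} y * occ_n (Suc n) i k y * g (- y)) \<partial>lborel)"
  proof (intro arg_cong[where f="\<lambda>x. scale i * x"] nn_integral_cong)
    fix y :: real
    have "(\<integral>\<^sup>+z. ?c * (indicator {0<..} z * kap k z y * ?r z * g (- y)) \<partial>lborel)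
      = ?c * ((\<integral>\<^sup>+z. indicator {0<..} z * kap k z y * ?r z \<partial>lborel) * g (- y))"
      by (simp add: nn_integral_cmult nn_integral_multc)
    also have "\<dots> = ?c * (indicator {0..} y * occ_n (Suc n) i k y * g (- y))"
    proof (cases "0 \<le> y")
      case True
      then show ?thesis by (simp add: kap_sweep)
    next
      case False
      then have "kap k z y = 0" for z by (simp add: kap_def)
      then show ?thesis using False by simp
    qed
    finally show "(\<integral>\<^sup>+z. ?c * (indicator {0<..} z * kap k z y * ?r z * g (- y)) \<partial>lborel)
      = ?c * (indicator {0..} y * occ_n (Suc n) i k y * g (- y))" .
  qed
  also have "\<dots> = scale i * ?c * (\<integral>\<^sup>+y. indicator {0..} y * occ_n (Suc n) i k y * g (- y) \<partial>lborel)"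
    unfolding mult.assoc by (subst nn_integral_cmult) (use measurable_occ_n[of "Suc n" i k] in measurable)
  finally show "(\<integral>\<^sup>+w. indicator {w \<in> base i (Suc n). X (Suc n) w = k} w * ?f (S (Suc n) w) \<partial>P)
    = scale i * ?c * (\<integral>\<^sup>+y. indicator {0..} y * occ_n (Suc n) i k y * g (- y) \<partial>lborel)" .
qed

lemma level_law: "v i < 0 \<Longrightarrow> level_law i n"
  by (induction n) (auto intro: level_law_0 level_law_Suc)

text \<open>The next transition is integrated out together with the time, because \<open>markov_nn_integral\<close> fixes its
  type and target; the corresponding probabilities add up to \<open>1\<close>.\<close>

lemma creep_law:
  assumes i: "v i < 0"
  shows "emeasure P {w \<in> base i n. X n w = j \<and> 0 < Z n w}
    = scale i * (if 0 < v j then ennreal (v j) * occ_n n i j 0 else 0)"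
proof -
  let ?c = "exit_rate C D j" and ?H = "{w \<in> base i n. X n w = j}"
  interpret E: prob_space "exp_law ?c" by (rule prob_space_exp_law[OF exit_rate_pos])
  define e where "e s = (\<integral>\<^sup>+t. indicator {0<..} (s + v j * t) \<partial>exp_law ?c)" for s
  have em [measurable]: "e \<in> borel_measurable borel"
    unfolding e_def[abs_def] by (rule E.borel_measurable_nn_integral) measurable
  have H [measurable]: "?H \<in> sets P" by (rule sets_base_Collect) simp
  let ?V = "\<lambda>y \<kappa>. {w \<in> base i n. X n w = j \<and> ty n w = \<kappa> \<and> X (Suc n) w = y}"
  let ?f = "\<lambda>s t u. indicator {0<..} (s + v j * t) :: ennreal"
  have V [measurable]: "?V y \<kappa> \<in> sets P" for y \<kappa> by (rule sets_base_Collect) simp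
  have C: "{w \<in> base i n. X n w = j \<and> 0 < Z n w} \<in> sets P" by (rule sets_base_Collect) simp
  have split: "indicator {w \<in> base i n. X n w = j \<and> 0 < Z n w} w
      = (\<Sum>y\<in>UNIV. \<Sum>\<kappa>\<in>UNIV. indicator (?V y \<kappa>) w * ?f (S n w) (T n w) (J n w))" for w
  proof -
    have "(\<Sum>y\<in>UNIV. \<Sum>\<kappa>\<in>UNIV. indicator (?V y \<kappa>) w * ?f (S n w) (T n w) (J n w))
      = (\<Sum>y\<in>UNIV. \<Sum>\<kappa>\<in>UNIV. if \<kappa> = ty n w then if y = X (Suc n) w then
          indicator {w \<in> base i n. X n w = j \<and> 0 < Z n w} w else 0 else 0)"
      by (intro sum.cong refl) (auto simp: indicator_def Z_def)
    also have "\<dots> = indicator {w \<in> base i n. X n w = j \<and> 0 < Z n w} w"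
      by (simp add: finite_trans_type)
    finally show ?thesis ..
  qed
  have part: "(\<integral>\<^sup>+w. indicator (?V y \<kappa>) w * ?f (S n w) (T n w) (J n w) \<partial>P)
      = ennreal (trans_rate C D \<kappa> j y / ?c) * (\<integral>\<^sup>+w. indicator ?H w * e (S n w) \<partial>P)" for y \<kappa>
  proof -
    interpret Jd: prob_space "jump_dist F \<kappa> j y" by (rule jump_dist_prob)
    have "(\<lambda>(s, t, u). ?f s t u) \<in> borel_measurable (borel \<Otimes>\<^sub>M (borel \<Otimes>\<^sub>M borel))"
      unfolding split_beta' by measurable
    then have "(\<integral>\<^sup>+w. indicator (?V y \<kappa>) w * ?f (S n w) (T n w) (J n w) \<partial>P)
      = (\<integral>\<^sup>+w. indicator ?H w * (ennreal (trans_rate C D \<kappa> j y / ?c) *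
          (\<integral>\<^sup>+t. \<integral>\<^sup>+u. ?f (S n w) t u \<partial>jump_dist F \<kappa> j y \<partial>exp_law ?c)) \<partial>P)"
      by (rule markov_nn_integral[OF base_hist])
    also have "\<dots> = (\<integral>\<^sup>+w. ennreal (trans_rate C D \<kappa> j y / ?c) * (indicator ?H w * e (S n w)) \<partial>P)"
      by (simp add: e_def Jd.emeasure_space_1 mult.left_commute)
    also have "\<dots> = ennreal (trans_rate C D \<kappa> j y / ?c) * (\<integral>\<^sup>+w. indicator ?H w * e (S n w) \<partial>P)"
      by (rule nn_integral_cmult) measurable
    finally show ?thesis .
  qed
  have rates: "(\<Sum>y\<in>UNIV. \<Sum>\<kappa>\<in>UNIV. ennreal (trans_rate C D \<kappa> j y / ?c)) = 1"
  proof -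
    have "(\<Sum>y\<in>UNIV. \<Sum>\<kappa>\<in>UNIV. ennreal (trans_rate C D \<kappa> j y / ?c))
      = ennreal (\<Sum>y\<in>UNIV. \<Sum>\<kappa>\<in>UNIV. trans_rate C D \<kappa> j y / ?c)"
      using trans_rate_nonneg exit_rate_pos[of j] by (simp add: sum_ennreal sum_nonneg less_imp_le)
    also have "(\<Sum>y\<in>UNIV. \<Sum>\<kappa>\<in>UNIV. trans_rate C D \<kappa> j y / ?c)
      = (\<Sum>y\<in>UNIV. (if j = y then 0 else C $ j $ y) + D $ j $ y) / ?c"
      by (simp add: UNIV_trans_type sum_divide_distrib add_divide_distrib)
    also have "(\<Sum>y\<in>UNIV. (if j = y then 0 else C $ j $ y) + D $ j $ y) = ?c"
    proof -
      have "(\<Sum>y\<in>UNIV. if j = y then 0 else C $ j $ y) = (\<Sum>y\<in>-{j}. C $ j $ y)"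
        by (intro sum.mono_neutral_cong_right) auto
      then show ?thesis by (simp add: sum.distrib exit_rate_def)
    qed
    finally show ?thesis using exit_rate_pos[of j] by simp
  qed
  have "emeasure P {w \<in> base i n. X n w = j \<and> 0 < Z n w} = (\<integral>\<^sup>+w. indicator {w \<in> base i n. X n w = j \<and> 0 < Z n w} w \<partial>P)"
    using C by simp
  also have "\<dots> = (\<Sum>y\<in>UNIV. \<Sum>\<kappa>\<in>UNIV. \<integral>\<^sup>+w. indicator (?V y \<kappa>) w * ?f (S n w) (T n w) (J n w) \<partial>P)"
    unfolding split by (simp add: nn_integral_sum)
  also have "\<dots> = (\<integral>\<^sup>+w. indicator ?H w * e (S n w) \<partial>P)"
    unfolding part by (simp only: sum_distrib_right[symmetric] rates mult_1_left)
  finally have main: "emeasure P {w \<in> base i n. X n w = j \<and> 0 < Z n w} = (\<integral>\<^sup>+w. indicator ?H w * e (S n w) \<partial>P)" .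
  have e_neg: "e (- z) = 0" if "0 \<le> z" "v j < 0" for z
  proof -
    have zero: "ennreal (?c * exp (- ?c * t)) * indicator {0..} t * indicator {0<..} (- z + v j * t) = 0" for t
      using that mult_nonpos_nonneg[of "v j" t] by (auto simp: indicator_def)
    have "e (- z) = (\<integral>\<^sup>+t. ennreal (?c * exp (- ?c * t)) * indicator {0..} t * indicator {0<..} (- z + v j * t) \<partial>lborel)"
      unfolding e_def by (rule nn_integral_exp_law) measurable
    then show ?thesis unfolding zero by simp
  qed
  have e_pos: "e (- z) = ennreal (exp (- lam j * z))" if "0 \<le> z" "0 < v j" for z
  proof -
    have "indicator {0<..} (- z + v j * t) = (indicator {z / v j<..} t :: ennreal)" for t
      using that by (auto simp: indicator_def field_simps)
    then have "e (- z) = emeasure (exp_law ?c) {z / v j<..}"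
      unfolding e_def by (simp add: sets_exp_law)
    then show ?thesis using that by (simp add: emeasure_exp_law_greaterThan exit_rate_pos lam_def)
  qed
  show ?thesis
  \<comment> \<open>The first sojourn descends and cannot creep over \<open>0\<close>; every later
    one starts from the landing density of \<open>next_law\<close>.\<close>
  proof (cases n)
    case 0
    show ?thesis
    proof (cases "j = i")
      case True
      then have "e 0 = 0" using e_neg[of 0] i by simp
      then show ?thesis using main 0 i True by (simp add: S_def)
    next
      case False
      then have "?H = {}" using 0 by (auto simp: base_def)
      then show ?thesis using main 0 False by simp
    qed
  next
    case (Suc m)
    let ?r = "inflow (occ_n m i) j"
    have rm [measurable]: "?r \<in> borel_measurable borel" by (intro measurable_inflow measurable_occ_n)
    have n: "(\<integral>\<^sup>+w. indicator ?H w * e (S n w) \<partial>P) = scale i * (\<integral>\<^sup>+z. indicator {0<..} z * ?r z * e (- z) \<partial>lborel)"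
      unfolding Suc by (rule next_law[OF level_law[OF i] em])
    show ?thesis
    proof (cases "v j < 0")
      case True
      then have zero: "indicator {0<..} z * ?r z * e (- z) = 0" for z
        using e_neg[of z] by (auto simp: indicator_def)
      show ?thesis unfolding main n zero using True by simp
    next
      case False
      then have j: "0 < v j" by (simp add: pos_iff)
      \<comment> \<open>From depth \<open>z\<close>, creeping needs a sojourn longer than
        \<open>z / v j\<close>. This has probability \<open>exp (- lam j * z)\<close>, which is
        \<open>v j\<close> times the kernel that leads to depth \<open>0\<close>.\<close>
      have "indicator {0<..} z * ?r z * e (- z) = ennreal (v j) * (indicator {0<..} z * kap j z 0 * ?r z)" for z
      proof (cases "0 < z")
        case True
        then have "kap j z 0 = ennreal (exp (- lam j * z) / v j)" using j by (simp add: kap_def)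
        then have e: "e (- z) = ennreal (v j) * kap j z 0"
          using True j by (simp add: ennreal_mult'[symmetric] e_pos)
        show ?thesis unfolding e by (simp only: mult_ac)
      qed simp
      then have "(\<integral>\<^sup>+z. indicator {0<..} z * ?r z * e (- z) \<partial>lborel) = ennreal (v j) * sweep j ?r 0"
        by (simp add: nn_integral_cmult kap_sweep)
      then show ?thesis unfolding main n using j by (simp add: Suc)
    qed
  qed
qed

lemma jump_law:
  assumes i: "v i < 0"
  shows "emeasure P {w \<in> base i n. X (Suc n) w = j \<and> Z n w \<le> 0 \<and> S (Suc n) w \<in> {0..x}}
    = scale i * (\<Sum>k\<in>UNIV. ennreal (D $ k $ j) *
        (\<integral>\<^sup>+y. indicator {0..} y * occ_n n i k y * emeasure (F k j) {y..y + x} \<partial>lborel))"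
proof -
  let ?h = "\<lambda>a u. indicator {0..x} (a + u) :: ennreal"
  let ?B = "{w \<in> base i n. X (Suc n) w = j \<and> Z n w \<le> 0 \<and> S (Suc n) w \<in> {0..x}}"
  have B: "?B \<in> sets P" by (rule sets_base_Collect) simp
  define I where "I k y = (\<integral>\<^sup>+u. ?h (- y) u \<partial>F k j)" for k y
  have I: "I k y = emeasure (F k j) {y..y + x}" for k y
  proof -
    have "?h (- y) u = indicator {y..y + x} u" for u by (auto simp: indicator_def)
    then show ?thesis by (simp add: I_def sets_F)
  qed
  have mI [measurable]: "I k \<in> borel_measurable borel" for k
    unfolding I_def[abs_def] by (rule sigma_finite_measure.borel_measurable_nn_integral[OF sigma_finite_F]) measurable
  have "emeasure P ?B = (\<integral>\<^sup>+w. indicator {w \<in> base i n. X (Suc n) w = j \<and> Z n w \<le> 0} w * ?h (Z n w) (J n w) \<partial>P)"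
  proof -
    have "indicator ?B w = indicator {w \<in> base i n. X (Suc n) w = j \<and> Z n w \<le> 0} w * ?h (Z n w) (J n w)" for w
      by (auto simp: indicator_def S_Suc)
    then show ?thesis using nn_integral_indicator[OF B] by simp
  qed
  also have "\<dots> = scale i * (\<Sum>k\<in>UNIV. \<integral>\<^sup>+y. indicator {0..} y * occ_n n i k y *
        (ennreal (Coff k j) * ?h (- y) 0 + ennreal (D $ k $ j) * I k y) \<partial>lborel)"
    unfolding I_def by (rule step_law[OF level_law[OF i]]) measurable
  also have "\<dots> = scale i * (\<Sum>k\<in>UNIV. \<integral>\<^sup>+y. ennreal (D $ k $ j) * (indicator {0..} y * occ_n n i k y * I k y) \<partial>lborel)"
  proof (intro arg_cong[where f="\<lambda>x. scale i * x"] sum.cong refl nn_integral_cong_AE)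
    fix k
    \<comment> \<open>Without a jump the level stays at \<open>- y \<le> 0\<close>, which lies in
      \<open>{0..x}\<close> at most for \<open>y = 0\<close>, a null set.\<close>
    show "AE y in lborel. indicator {0..} y * occ_n n i k y * (ennreal (Coff k j) * ?h (- y) 0 + ennreal (D $ k $ j) * I k y)
      = ennreal (D $ k $ j) * (indicator {0..} y * occ_n n i k y * I k y)"
      using AE_lborel_singleton[of 0] by eventually_elim (auto simp: indicator_def mult_ac)
  qed
  also have "\<dots> = scale i * (\<Sum>k\<in>UNIV. ennreal (D $ k $ j) * (\<integral>\<^sup>+y. indicator {0..} y * occ_n n i k y * I k y \<partial>lborel))"
    by (simp add: nn_integral_cmult)
  finally show ?thesis unfolding I .
qed

end

section \<open>First passage\<close>

context MAP_process
begin

definition epoch :: "nat \<Rightarrow> 'w \<Rightarrow> real" where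
  "epoch n w = (\<Sum>m<n. T m w)"

lemma epoch_0 [simp]: "epoch 0 w = 0"
  by (simp add: epoch_def)

lemma epoch_Suc: "epoch (Suc n) w = epoch n w + T n w"
  by (simp add: epoch_def)

lemma epoch_mono: "w \<in> space P \<Longrightarrow> m \<le> n \<Longrightarrow> epoch m w \<le> epoch n w"
  unfolding epoch_def by (intro sum_mono2) (auto intro: less_imp_le T_pos)

lemma ex_sojourn:
  assumes w: "w \<in> space P" and t: "0 \<le> t"
  shows "\<exists>n. epoch n w \<le> t \<and> t < epoch (Suc n) w"
proof -
  have "eventually (\<lambda>n. t + 1 \<le> epoch n w) sequentially"
    using no_explosion[OF w] unfolding filterlim_at_top epoch_def by blast
  then obtain N where "t < epoch N w"
    unfolding eventually_sequentially by (metis less_add_one order_less_le_trans order_refl)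
  then have "\<exists>n. t < epoch n w" ..
  define n where "n = (LEAST n. t < epoch n w)"
  have n: "t < epoch n w" unfolding n_def by (rule LeastI_ex) fact
  then obtain m where m: "n = Suc m" using t by (cases n) auto
  have "\<not> t < epoch m w" using not_less_Least[of m "\<lambda>n. t < epoch n w"] m by (simp add: n_def[symmetric])
  then show ?thesis using n m by (intro exI[of _ m]) auto
qed

lemma sojourn_values:
  assumes "w \<in> space P" "epoch n w \<le> t" "t < epoch (Suc n) w"
  shows "Y t w = S n w + v (X n w) * (t - epoch n w)" "M t w = X n w"
  using Y_path[of w n t] M_path[of w n t] assms unfolding epoch_def S_def by auto

lemma alive_mono: "alive n w \<Longrightarrow> m \<le> n \<Longrightarrow> alive m w"
  by (auto simp: alive_def)

text \<open>Within a sojourn the level is affine, from \<open>S m\<close> towards the left limit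
  \<open>Z m\<close>. Strictness comes from \<open>S m < 0\<close> if the level falls, from the
  excluded right end point if it rises, and from \<open>0 < t\<close> in the first sojourn.\<close>

lemma neg_in_sojourn:
  assumes w: "w \<in> space P" and v0: "v (X 0 w) < 0" and al: "alive m w" and Z: "Z m w \<le> 0"
    and t: "epoch m w \<le> t" "t < epoch (Suc m) w" "0 < t"
  shows "Y t w < 0"
proof -
  let ?s = "t - epoch m w"
  have s: "0 \<le> ?s" "?s < T m w" using t by (auto simp: epoch_Suc)
  have Y: "Y t w = S m w + v (X m w) * ?s" by (rule sojourn_values(1)[OF w t(1,2)])
  show ?thesis
  proof (cases m)
    case 0
    then show ?thesis unfolding Y using v0 t(3) by (simp add: S_def mult_neg_pos)
  next
    case (Suc l)
    then have Sm: "S m w < 0" using al by (simp add: alive_def)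
    show ?thesis
    proof (cases "v (X m w) < 0")
      case True
      then have "v (X m w) * ?s \<le> 0" using s by (simp add: mult_nonpos_nonneg)
      then show ?thesis unfolding Y using Sm by linarith
    next
      case False
      then have "0 < v (X m w)" by (simp add: pos_iff)
      then have "v (X m w) * ?s < v (X m w) * T m w" using s by (intro mult_strict_left_mono)
      then show ?thesis unfolding Y using Z by (simp add: Z_def)
    qed
  qed
qed

lemma neg_before:
  assumes w: "w \<in> space P" and v0: "v (X 0 w) < 0" and al: "alive n w" and t: "0 < t" "t < epoch n w"
  shows "Y t w < 0"
proof -
  obtain m where m: "epoch m w \<le> t" "t < epoch (Suc m) w" using ex_sojourn[OF w, of t] t by auto
  have "m < n"
  proof (rule ccontr)
    assume "\<not> m < n"
    then have "epoch n w \<le> epoch m w" by (intro epoch_mono[OF w]) simp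
    then show False using m t by simp
  qed
  then have "alive m w" "Z m w \<le> 0" using al alive_mono[OF al, of m] by (auto simp: alive_def)
  then show ?thesis by (rule neg_in_sojourn[OF w v0 _ _ m t(1)])
qed

lemma tau_0_plus_eqI:
  assumes "0 < t" "0 \<le> Y t w" "\<And>r. 0 < r \<Longrightarrow> r < t \<Longrightarrow> Y r w < 0"
  shows "tau_0_plus Y w = ereal t"
  unfolding tau_0_plus_def
proof (rule antisym)
  show "Inf (ereal ` {t. 0 < t \<and> 0 \<le> Y t w}) \<le> ereal t"
    using assms by (intro Inf_lower) auto
  show "ereal t \<le> Inf (ereal ` {t. 0 < t \<and> 0 \<le> Y t w})"
  proof (rule Inf_greatest)
    fix r assume "r \<in> ereal ` {t. 0 < t \<and> 0 \<le> Y t w}"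
    then obtain r' where "r = ereal r'" "0 < r'" "0 \<le> Y r' w" by auto
    then show "ereal t \<le> r" using assms(3)[of r'] by (auto simp: not_le[symmetric])
  qed
qed

lemma creep_values:
  assumes w: "w \<in> space P" and v0: "v (X 0 w) < 0" and al: "alive n w" and Z: "0 < Z n w"
  obtains t where "tau_0_plus Y w = ereal t" "M t w = X n w" "Y t w = 0" "0 < v (X n w)"
proof -
  have "n \<noteq> 0"
  proof
    assume "n = 0"
    then have "Z n w = v (X 0 w) * T 0 w" by (simp add: Z_def S_def)
    then show False using Z v0 T_pos[OF w, of 0] by (simp add: mult_less_0_iff zero_less_mult_iff)
  qed
  then obtain m where "n = Suc m" by (cases n) auto
  then have Sn: "S n w < 0" using al by (simp add: alive_def)
  have T: "0 < T n w" by (rule T_pos[OF w])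
  have "0 < v (X n w) * T n w" using Z Sn by (simp add: Z_def)
  then have vn: "0 < v (X n w)" using T by (simp add: zero_less_mult_iff)
  \<comment> \<open>The zero of the affine function that gives the level during this
    sojourn.\<close>
  define t where "t = epoch n w - S n w / v (X n w)"
  have e0: "0 \<le> epoch n w" using epoch_mono[OF w, of 0 n] by simp
  have t1: "epoch n w < t" unfolding t_def using Sn vn by (simp add: divide_neg_pos)
  have t2: "t < epoch (Suc n) w"
    using Z vn by (simp add: t_def epoch_Suc Z_def field_simps)
  have soj: "Y r w = S n w + v (X n w) * (r - epoch n w)" "M r w = X n w" if "epoch n w \<le> r" "r \<le> t" for r
    using sojourn_values[OF w, of n r] that t2 by auto
  have Yt: "Y t w = 0" using soj(1)[of t] t1 vn by (simp add: t_def)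
  have "Y r w < 0" if r: "0 < r" "r < t" for r
  proof (cases "r < epoch n w")
    case True
    then show ?thesis by (rule neg_before[OF w v0 al r(1)])
  next
    case False
    then have "v (X n w) * (r - epoch n w) < v (X n w) * (t - epoch n w)"
      using vn r by (intro mult_strict_left_mono) auto
    then show ?thesis using soj(1)[of r] soj(1)[of t] Yt False r t1 by simp
  qed
  then have "tau_0_plus Y w = ereal t" using Yt t1 e0 by (intro tau_0_plus_eqI) auto
  then show ?thesis using that soj(2)[of t] t1 Yt vn by simp
qed

lemma jump_values:
  assumes w: "w \<in> space P" and v0: "v (X 0 w) < 0" and al: "alive n w" and Z: "Z n w \<le> 0" and S: "0 \<le> S (Suc n) w"
  shows "tau_0_plus Y w = ereal (epoch (Suc n) w)" "M (epoch (Suc n) w) w = X (Suc n) w"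
    "Y (epoch (Suc n) w) w = S (Suc n) w"
proof -
  have "epoch (Suc n) w < epoch (Suc (Suc n)) w" using T_pos[OF w, of "Suc n"] by (simp add: epoch_Suc)
  from sojourn_values[OF w order_refl this]
  show M: "M (epoch (Suc n) w) w = X (Suc n) w" and Y: "Y (epoch (Suc n) w) w = S (Suc n) w" by simp_all
  have e: "0 < epoch (Suc n) w" using epoch_mono[OF w, of 0 n] T_pos[OF w, of n] by (simp add: epoch_Suc)
  have "Y r w < 0" if r: "0 < r" "r < epoch (Suc n) w" for r
  proof (cases "r < epoch n w")
    case True
    then show ?thesis by (rule neg_before[OF w v0 al r(1)])
  next
    case False
    then show ?thesis using neg_in_sojourn[OF w v0 al Z _ r(2,1)] by simp
  qed
  then show "tau_0_plus Y w = ereal (epoch (Suc n) w)"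
    using e S Y by (intro tau_0_plus_eqI) auto
qed

lemma never_values:
  assumes w: "w \<in> space P" and v0: "v (X 0 w) < 0" and al: "\<And>n. alive n w"
  shows "tau_0_plus Y w = \<infinity>"
proof -
  have "Y t w < 0" if t: "0 < t" for t
  proof -
    obtain m where "t < epoch (Suc m) w" using ex_sojourn[OF w, of t] t by auto
    then show ?thesis by (rule neg_before[OF w v0 al t])
  qed
  then have none: "{t. 0 < t \<and> 0 \<le> Y t w} = {}" by (auto simp: not_le[symmetric])
  show ?thesis unfolding tau_0_plus_def none by (simp add: top_ereal_def)
qed

lemma M_0: "w \<in> space P \<Longrightarrow> M 0 w = X 0 w"
  using sojourn_values(2)[of w 0 0] T_pos[of w 0] by (simp add: epoch_Suc)

definition creep_ev :: "'s \<Rightarrow> 's \<Rightarrow> nat \<Rightarrow> 'w set" where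
  "creep_ev i j n = {w \<in> base i n. X n w = j \<and> 0 < Z n w}"

definition jump_ev :: "'s \<Rightarrow> 's \<Rightarrow> real \<Rightarrow> nat \<Rightarrow> 'w set" where
  "jump_ev i j x n = {w \<in> base i n. X (Suc n) w = j \<and> Z n w \<le> 0 \<and> S (Suc n) w \<in> {0..x}}"

text \<open>The index \<open>n\<close> is the last one at which \<open>alive\<close> holds; the
  failure after it is a creep or a jump. A sojourn with \<open>Z n = 0\<close> counts among the
  jumps, because level \<open>0\<close> is then only a left limit and passage occurs at the
  transition epoch.\<close>

lemma event_eq:
  assumes i: "v i < 0" and x: "0 \<le> x"
  shows "{w \<in> space P. (tau_0_plus Y w < \<infinity> \<and> M (real_of_ereal (tau_0_plus Y w)) w = j \<and>
      Y (real_of_ereal (tau_0_plus Y w)) w \<le> x) \<and> M 0 w = i} = (\<Union>n. creep_ev i j n \<union> jump_ev i j x n)"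
    (is "?E = ?U")
proof (intro set_eqI iffI)
  fix w assume "w \<in> ?E"
  then have w: "w \<in> space P" and fin: "tau_0_plus Y w < \<infinity>"
    and Mj: "M (real_of_ereal (tau_0_plus Y w)) w = j" and Yx: "Y (real_of_ereal (tau_0_plus Y w)) w \<le> x"
    and X0: "X 0 w = i" using M_0 by auto
  have v0: "v (X 0 w) < 0" using X0 i by simp
  have "\<not> (\<forall>n. alive n w)" using never_values[OF w v0] fin by auto
  moreover have "alive 0 w" by (simp add: alive_def)
  ultimately obtain n where n: "alive n w" "\<not> alive (Suc n) w" using nat_induct[of "\<lambda>n. alive n w"] by blast
  have b: "w \<in> base i n" using w X0 n(1) by (simp add: base_def)
  show "w \<in> ?U"
  proof (cases "0 < Z n w")
    case True
    obtain t where "tau_0_plus Y w = ereal t" "M t w = X n w"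
      using creep_values[OF w v0 n(1) True] by blast
    then have "w \<in> creep_ev i j n" using Mj b True by (simp add: creep_ev_def)
    then show ?thesis by blast
  next
    case False
    then have Z: "Z n w \<le> 0" by simp
    have S: "0 \<le> S (Suc n) w" using n Z by (auto simp: alive_def less_Suc_eq)
    have "w \<in> jump_ev i j x n"
      using jump_values[OF w v0 n(1) Z S] Mj Yx b Z S by (simp add: jump_ev_def)
    then show ?thesis by blast
  qed
next
  fix w assume "w \<in> ?U"
  then obtain n where n: "w \<in> creep_ev i j n \<or> w \<in> jump_ev i j x n" by blast
  then have b: "w \<in> base i n" by (auto simp: creep_ev_def jump_ev_def)
  then have w: "w \<in> space P" and X0: "X 0 w = i" and al: "alive n w" by (auto simp: base_def)
  have v0: "v (X 0 w) < 0" using X0 i by simp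
  have M0: "M 0 w = i" using M_0[OF w] X0 by simp
  from n show "w \<in> ?E"
  proof
    assume c: "w \<in> creep_ev i j n"
    then have "0 < Z n w" by (simp add: creep_ev_def)
    then obtain t where "tau_0_plus Y w = ereal t" "M t w = X n w" "Y t w = 0"
      using creep_values[OF w v0 al] by blast
    then show ?thesis using c w M0 x by (simp add: creep_ev_def)
  next
    assume c: "w \<in> jump_ev i j x n"
    then have Z: "Z n w \<le> 0" "0 \<le> S (Suc n) w" by (auto simp: jump_ev_def)
    show ?thesis using jump_values[OF w v0 al Z] c w M0 by (simp add: jump_ev_def)
  qed
qed

text \<open>The index of an event is determined by where \<open>alive\<close> stops, so the events
  are disjoint and their probabilities add up; the sum over \<open>n\<close> turns
  \<open>occ_n\<close> into \<open>occ\<close>.\<close>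

lemma emeasure_event:
  assumes i: "v i < 0"
  shows "emeasure P (\<Union>n. creep_ev i j n \<union> jump_ev i j x n)
    = scale i * ((if 0 < v j then ennreal (v j) * occ i j 0 else 0) +
        (\<Sum>k\<in>UNIV. ennreal (D $ k $ j) * (\<integral>\<^sup>+y. indicator {0..} y * occ i k y * emeasure (F k j) {y..y + x} \<partial>lborel)))"
proof -
  have C: "creep_ev i j n \<in> sets P" for n unfolding creep_ev_def by (rule sets_base_Collect) simp
  have Jm: "jump_ev i j x n \<in> sets P" for n unfolding jump_ev_def by (rule sets_base_Collect) simp
  have stop: "alive n w \<and> \<not> alive (Suc n) w" if "w \<in> creep_ev i j n \<union> jump_ev i j x n" for n w
    using that by (auto simp: creep_ev_def jump_ev_def base_def alive_def)
  have dis: "disjoint_family (\<lambda>n. creep_ev i j n \<union> jump_ev i j x n)"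
    unfolding disjoint_family_on_def
  proof (intro ballI impI)
    fix m n :: nat assume mn: "m \<noteq> n"
    show "(creep_ev i j m \<union> jump_ev i j x m) \<inter> (creep_ev i j n \<union> jump_ev i j x n) = {}"
    proof (rule ccontr)
      assume "\<not> ?thesis"
      then obtain w where "w \<in> creep_ev i j m \<union> jump_ev i j x m" "w \<in> creep_ev i j n \<union> jump_ev i j x n" by blast
      then have "alive m w" "\<not> alive (Suc m) w" "alive n w" "\<not> alive (Suc n) w" using stop by blast+
      then show False using alive_mono[of m w "Suc n"] alive_mono[of n w "Suc m"] mn by (cases m n rule: linorder_cases) auto
    qed
  qed
  have "emeasure P (\<Union>n. creep_ev i j n \<union> jump_ev i j x n) = (\<Sum>n. emeasure P (creep_ev i j n \<union> jump_ev i j x n))"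
    using C Jm dis by (intro suminf_emeasure[symmetric]) auto
  also have "\<dots> = (\<Sum>n. emeasure P (creep_ev i j n) + emeasure P (jump_ev i j x n))"
    using C Jm by (intro suminf_cong plus_emeasure[symmetric]) (auto simp: creep_ev_def jump_ev_def)
  also have "\<dots> = (\<Sum>n. scale i * ((if 0 < v j then ennreal (v j) * occ_n n i j 0 else 0) +
      (\<Sum>k\<in>UNIV. ennreal (D $ k $ j) *
        (\<integral>\<^sup>+y. indicator {0..} y * occ_n n i k y * emeasure (F k j) {y..y + x} \<partial>lborel))))"
    unfolding creep_ev_def jump_ev_def creep_law[OF i] jump_law[OF i] distrib_left ..
  also have "\<dots> = scale i * ((\<Sum>n. if 0 < v j then ennreal (v j) * occ_n n i j 0 else 0) +
      (\<Sum>n. \<Sum>k\<in>UNIV. ennreal (D $ k $ j) *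
        (\<integral>\<^sup>+y. indicator {0..} y * occ_n n i k y * emeasure (F k j) {y..y + x} \<partial>lborel)))"
    by (simp add: suminf_add summableI)
  also have "(\<Sum>n. if 0 < v j then ennreal (v j) * occ_n n i j 0 else 0) = (if 0 < v j then ennreal (v j) * occ i j 0 else 0)"
    by (simp add: occ_def)
  also have "(\<Sum>n. \<Sum>k\<in>UNIV. ennreal (D $ k $ j) *
        (\<integral>\<^sup>+y. indicator {0..} y * occ_n n i k y * emeasure (F k j) {y..y + x} \<partial>lborel))
    = (\<Sum>k\<in>UNIV. ennreal (D $ k $ j) * (\<integral>\<^sup>+y. indicator {0..} y * occ i k y * emeasure (F k j) {y..y + x} \<partial>lborel))"
  proof -
    have "(\<Sum>n. \<integral>\<^sup>+y. indicator {0..} y * occ_n n i k y * emeasure (F k j) {y..y + x} \<partial>lborel)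
      = (\<integral>\<^sup>+y. indicator {0..} y * occ i k y * emeasure (F k j) {y..y + x} \<partial>lborel)" for k
    proof -
      have [measurable]: "(\<lambda>y. emeasure (F k j) {y..y + x}) \<in> borel_measurable borel"
      proof -
        have "(\<lambda>y. \<integral>\<^sup>+u. indicator {0..x} (- y + u) \<partial>F k j) \<in> borel_measurable borel"
          by (rule sigma_finite_measure.borel_measurable_nn_integral[OF sigma_finite_F]) measurable
        moreover have "(\<integral>\<^sup>+u. indicator {0..x} (- y + u) \<partial>F k j) = emeasure (F k j) {y..y + x}" for y
        proof -
          have "indicator {0..x} (- y + u) = (indicator {y..y + x} u :: ennreal)" for u by (auto simp: indicator_def)
          then show ?thesis by (simp add: sets_F)
        qed
        ultimately show ?thesis by simp
      qed
      have "(\<Sum>n. \<integral>\<^sup>+y. indicator {0..} y * occ_n n i k y * emeasure (F k j) {y..y + x} \<partial>lborel)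
        = (\<integral>\<^sup>+y. (\<Sum>n. indicator {0..} y * occ_n n i k y * emeasure (F k j) {y..y + x}) \<partial>lborel)"
        by (rule nn_integral_suminf[symmetric]) (use measurable_occ_n[of _ i k] in measurable)
      then show ?thesis by (simp add: occ_def)
    qed
    then show ?thesis by (simp add: suminf_sum summableI)
  qed
  finally show ?thesis .
qed

end

section \<open>The overshoot as an iterated integral\<close>

context MAP_data
begin

text \<open>A jump of size \<open>u\<close> from depth \<open>z\<close> overshoots by
  \<open>y = u - z\<close>. Fubini exchanges the description by overshoot on the left with the one
  by starting depth on the right.\<close>

lemma overshoot_integral:
  assumes q [measurable]: "q \<in> borel_measurable borel"
  shows "(\<integral>\<^sup>+y. indicator {0..x} y * (\<integral>\<^sup>+u. q (u - y) * indicator {y..} u \<partial>F k j) \<partial>lborel)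
    = (\<integral>\<^sup>+z. indicator {0..} z * q z * emeasure (F k j) {z..z + x} \<partial>lborel)"
proof -
  interpret Fk: prob_space "F k j" by (rule prob_space_F)
  interpret FL: pair_sigma_finite "F k j" "lborel :: real measure" ..
  have "(\<integral>\<^sup>+y. indicator {0..x} y * (\<integral>\<^sup>+u. q (u - y) * indicator {y..} u \<partial>F k j) \<partial>lborel)
    = (\<integral>\<^sup>+y. indicator {0..x} y * (\<integral>\<^sup>+u. q (u - y) * indicator {0..} (u - y) \<partial>F k j) \<partial>lborel)"
    by (simp add: indicator_def)
  also have "\<dots> = (\<integral>\<^sup>+y. \<integral>\<^sup>+u. indicator {0..x} y * (q (u - y) * indicator {0..} (u - y)) \<partial>F k j \<partial>lborel)"
    by (intro nn_integral_cong nn_integral_cmult[symmetric]) measurable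
  also have "\<dots> = (\<integral>\<^sup>+u. \<integral>\<^sup>+y. indicator {0..x} y * (q (u - y) * indicator {0..} (u - y)) \<partial>lborel \<partial>F k j)"
    by (rule FL.Fubini') measurable
  also have "\<dots> = (\<integral>\<^sup>+u. \<integral>\<^sup>+z. indicator {0..x} (u - z) * (q z * indicator {0..} z) \<partial>lborel \<partial>F k j)"
  proof (rule nn_integral_cong)
    fix u :: real
    have "(\<integral>\<^sup>+y. indicator {0..x} y * (q (u - y) * indicator {0..} (u - y)) \<partial>lborel)
      = ennreal \<bar>- 1\<bar> * (\<integral>\<^sup>+z. indicator {0..x} (u + - 1 * z) * (q (u - (u + - 1 * z)) * indicator {0..} (u - (u + - 1 * z))) \<partial>lborel)"
      by (rule nn_integral_real_affine) simp_all
    then show "(\<integral>\<^sup>+y. indicator {0..x} y * (q (u - y) * indicator {0..} (u - y)) \<partial>lborel)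
      = (\<integral>\<^sup>+z. indicator {0..x} (u - z) * (q z * indicator {0..} z) \<partial>lborel)" by simp
  qed
  also have "\<dots> = (\<integral>\<^sup>+z. \<integral>\<^sup>+u. indicator {0..x} (u - z) * (q z * indicator {0..} z) \<partial>F k j \<partial>lborel)"
    by (rule FL.Fubini'[symmetric]) measurable
  also have "\<dots> = (\<integral>\<^sup>+z. indicator {0..} z * q z * emeasure (F k j) {z..z + x} \<partial>lborel)"
  proof (rule nn_integral_cong)
    fix z :: real
    have "indicator {0..x} (u - z) = (indicator {z..z + x} u :: ennreal)" for u by (auto simp: indicator_def)
    then have "(\<integral>\<^sup>+u. indicator {0..x} (u - z) * (q z * indicator {0..} z) \<partial>F k j)
      = emeasure (F k j) {z..z + x} * (q z * indicator {0..} z)"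
      by (simp add: nn_integral_multc sets_F)
    then show "(\<integral>\<^sup>+u. indicator {0..x} (u - z) * (q z * indicator {0..} z) \<partial>F k j)
      = indicator {0..} z * q z * emeasure (F k j) {z..z + x}" by (simp only: mult_ac)
  qed
  finally show ?thesis .
qed

text \<open>The inner integral may diverge at some \<open>y\<close>, where the Bochner integral
  would be \<open>0\<close>; by \<open>fin\<close> such \<open>y\<close> form a null set in
  \<open>{0..x}\<close>.\<close>

lemma overshoot_set_integral:
  fixes g :: "'s \<Rightarrow> real \<Rightarrow> real"
  assumes g [measurable]: "\<And>k. g k \<in> borel_measurable borel" and g0: "\<And>k z. 0 \<le> z \<Longrightarrow> 0 \<le> g k z"
    and fin: "(\<Sum>k\<in>UNIV. ennreal (D $ k $ j) * (\<integral>\<^sup>+z. indicator {0..} z * ennreal (g k z) * emeasure (F k j) {z..z + x} \<partial>lborel)) < \<infinity>"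
  shows "(LINT y:{0..x}|lborel. (\<Sum>k\<in>UNIV. LINT u:{y..}|D_meas D F k j. g k (u - y)))
    = enn2real (\<Sum>k\<in>UNIV. ennreal (D $ k $ j) * (\<integral>\<^sup>+z. indicator {0..} z * ennreal (g k z) * emeasure (F k j) {z..z + x} \<partial>lborel))"
proof -
  define t where "t k y = ennreal (D $ k $ j) * (\<integral>\<^sup>+u. ennreal (g k (u - y)) * indicator {y..} u \<partial>F k j)" for k y
  have m [measurable]: "(\<lambda>y. \<integral>\<^sup>+u. ennreal (g k (u - y)) * indicator {y..} u \<partial>F k j) \<in> borel_measurable borel" for k
  proof -
    have "(\<lambda>y. \<integral>\<^sup>+u. ennreal (g k (u - y)) * indicator {0..} (u - y) \<partial>F k j) \<in> borel_measurable borel"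
      by (rule sigma_finite_measure.borel_measurable_nn_integral[OF sigma_finite_F]) measurable
    moreover have "indicator {0..} (u - y) = (indicator {y..} u :: ennreal)" for u y :: real by (simp add: indicator_def)
    ultimately show ?thesis by simp
  qed
  have [measurable]: "t k \<in> borel_measurable borel" for k
    unfolding t_def[abs_def] by measurable
  have part: "(LINT u:{y..}|D_meas D F k j. g k (u - y)) = enn2real (t k y)" for k y
    unfolding t_def by (rule set_integral_D_meas) (auto intro: g0)
  have int: "(\<integral>\<^sup>+y. indicator {0..x} y * t k y \<partial>lborel)
    = ennreal (D $ k $ j) * (\<integral>\<^sup>+z. indicator {0..} z * ennreal (g k z) * emeasure (F k j) {z..z + x} \<partial>lborel)" for k
  proof -
    have "(\<integral>\<^sup>+y. indicator {0..x} y * t k y \<partial>lborel)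
      = (\<integral>\<^sup>+y. ennreal (D $ k $ j) * (indicator {0..x} y * (\<integral>\<^sup>+u. ennreal (g k (u - y)) * indicator {y..} u \<partial>F k j)) \<partial>lborel)"
      unfolding t_def by (simp only: mult.left_commute)
    also have "\<dots> = ennreal (D $ k $ j) * (\<integral>\<^sup>+y. indicator {0..x} y * (\<integral>\<^sup>+u. ennreal (g k (u - y)) * indicator {y..} u \<partial>F k j) \<partial>lborel)"
      using m by (intro nn_integral_cmult) measurable
    finally show ?thesis unfolding overshoot_integral[of "\<lambda>z. ennreal (g k z)", OF measurable_compose[OF g measurable_ennreal]] .
  qed
  have tot: "(\<integral>\<^sup>+y. indicator {0..x} y * (\<Sum>k\<in>UNIV. t k y) \<partial>lborel)
    = (\<Sum>k\<in>UNIV. ennreal (D $ k $ j) * (\<integral>\<^sup>+z. indicator {0..} z * ennreal (g k z) * emeasure (F k j) {z..z + x} \<partial>lborel))"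
    unfolding sum_distrib_left by (subst nn_integral_sum) (simp_all add: int)
  have "AE y in lborel. indicator {0..x} y * (\<Sum>k\<in>UNIV. t k y) \<noteq> \<infinity>"
    using fin unfolding tot[symmetric] by (intro nn_integral_noteq_infinite) auto
  then have AE: "AE y in lborel. ennreal (indicator {0..x} y *\<^sub>R (\<Sum>k\<in>UNIV. enn2real (t k y))) = indicator {0..x} y * (\<Sum>k\<in>UNIV. t k y)"
  proof eventually_elim
    case (elim y)
    show ?case
    proof (cases "y \<in> {0..x}")
      case True
      then have "t k y \<noteq> \<infinity>" for k using elim by simp
      then have "(\<Sum>k\<in>UNIV. t k y) = (\<Sum>k\<in>UNIV. ennreal (enn2real (t k y)))"
        by (intro sum.cong refl) (simp add: less_top)
      also have "\<dots> = ennreal (\<Sum>k\<in>UNIV. enn2real (t k y))" by (rule sum_ennreal) simp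
      finally show ?thesis using True by simp
    qed simp
  qed
  have "(LINT y:{0..x}|lborel. (\<Sum>k\<in>UNIV. LINT u:{y..}|D_meas D F k j. g k (u - y)))
    = enn2real (\<integral>\<^sup>+y. ennreal (indicator {0..x} y *\<^sub>R (\<Sum>k\<in>UNIV. enn2real (t k y))) \<partial>lborel)"
    unfolding set_lebesgue_integral_def[of lborel] part
    by (rule integral_eq_nn_integral) (auto intro!: AE_I2 sum_nonneg mult_nonneg_nonneg)
  also have "\<dots> = enn2real (\<integral>\<^sup>+y. indicator {0..x} y * (\<Sum>k\<in>UNIV. t k y) \<partial>lborel)"
    by (rule arg_cong[where f=enn2real], rule nn_integral_cong_AE[OF AE])
  finally show ?thesis unfolding tot .
qed

end

theorem theorem3p1:
  fixes C D K L :: "real^'s^('s::finite)"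
    and F :: "'s \<Rightarrow> 's \<Rightarrow> real measure"
    and v :: "'s \<Rightarrow> real"
    and p :: "real^'s"
    and P :: "'w measure"
    and X :: "nat \<Rightarrow> 'w \<Rightarrow> 's"
    and T :: "nat \<Rightarrow> 'w \<Rightarrow> real"
    and ty :: "nat \<Rightarrow> 'w \<Rightarrow> trans_type"
    and J :: "nat \<Rightarrow> 'w \<Rightarrow> real"
    and M :: "real \<Rightarrow> 'w \<Rightarrow> 's"
    and Y :: "real \<Rightarrow> 'w \<Rightarrow> real"
    and i j :: 's and x :: real
  assumes "MAP_process C D F v p P X T ty J M Y"
    and "KL_minimal_solution C D F v K L"
    and "i \<in> neg_states v"
    and "0 < \<P>(w in P. M 0 w = i)"
    and "0 \<le> x"
  shows "\<P>(w in P. tau_0_plus Y w < \<infinity> \<and> M (real_of_ereal (tau_0_plus Y w)) w = j \<and>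
             Y (real_of_ereal (tau_0_plus Y w)) w \<le> x \<bar> M 0 w = i) =
         1 / (- v i) *
           ((LINT y:{0..x}|lborel.
               mat_integral {y..} (\<lambda>u. mat_exp ((u - y) *\<^sub>R K) ** IL v L) (D_meas D F) $ i $ j) +
            (if j \<in> pos_states v then L $ i $ j * v j else 0))"
proof -
  interpret MAP_process C D F v p P X T ty J M Y by fact
  have i: "v i < 0" using assms(3) by (simp add: neg_states_def)
  define p0 where "p0 = prob {w \<in> space P. X 0 w = i}"
  have init: "{w \<in> space P. M 0 w = i} = {w \<in> space P. X 0 w = i}" using M_0 by auto
  have p0: "0 < p0" using assms(4) by (simp add: p0_def init)
  define g where "g k y = (mat_exp (y *\<^sub>R K) ** IL v L) $ i $ k" for k y
  have occ: "occ i k y = ennreal (g k y)" and g0: "0 \<le> g k y" if "0 \<le> y" for k y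
    using occ_eq_mat_exp[OF assms(2) i that] by (simp_all add: g_def)
  have KL: "KL_solution C D F v K L" using assms(2) by (simp add: KL_minimal_solution_def)
  have "g k = (\<lambda>y. flow (K + L) y i k)" for k
    by (simp add: fun_eq_iff g_def flow_def solves_KL[OF KL])
  then have gm [measurable]: "g k \<in> borel_measurable borel" for k by simp
  define A where "A = (if j \<in> pos_states v then L $ i $ j * v j else 0)"
  define B where "B = (\<Sum>k\<in>UNIV. ennreal (D $ k $ j) *
    (\<integral>\<^sup>+z. indicator {0..} z * ennreal (g k z) * emeasure (F k j) {z..z + x} \<partial>lborel))"
  let ?E = "{w \<in> space P. (tau_0_plus Y w < \<infinity> \<and> M (real_of_ereal (tau_0_plus Y w)) w = j \<and>
      Y (real_of_ereal (tau_0_plus Y w)) w \<le> x) \<and> M 0 w = i}"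
  have A0: "0 \<le> A"
    using g0[of 0 j] i by (auto simp: A_def g_def IL_def neg_states_def pos_states_def split: if_splits)
  have creep: "(if 0 < v j then ennreal (v j) * occ i j 0 else 0) = ennreal A"
  proof (cases "0 < v j")
    case True
    then have "g j 0 = L $ i $ j" using i by (simp add: g_def IL_def neg_states_def)
    then show ?thesis using True occ[of 0 j] by (simp add: A_def pos_states_def ennreal_mult' mult.commute)
  qed (simp add: A_def pos_states_def)
  have "(\<integral>\<^sup>+y. indicator {0..} y * occ i k y * emeasure (F k j) {y..y + x} \<partial>lborel)
    = (\<integral>\<^sup>+z. indicator {0..} z * ennreal (g k z) * emeasure (F k j) {z..z + x} \<partial>lborel)" for k
    by (intro nn_integral_cong) (simp add: indicator_def occ)
  then have E: "emeasure P ?E = ennreal (p0 / \<bar>v i\<bar>) * (ennreal A + B)"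
    unfolding event_eq[OF i assms(5)] emeasure_event[OF i] creep by (simp add: B_def scale_def p0_def)
  \<comment> \<open>The factor in front of \<open>B\<close> is positive and the product is bounded
    by a probability.\<close>
  have Bfin: "B < \<infinity>"
  proof (rule ccontr)
    assume "\<not> B < \<infinity>"
    then have "B = \<top>" by (cases B) auto
    moreover have "ennreal (p0 / \<bar>v i\<bar>) \<noteq> 0"
      unfolding ennreal_eq_0_iff not_le using p0 i by (intro divide_pos_pos) auto
    ultimately have "emeasure P ?E = \<top>" unfolding E by (simp add: ennreal_mult_top)
    then show False using emeasure_finite[of ?E] by simp
  qed
  have "prob ?E = p0 / \<bar>v i\<bar> * (A + enn2real B)"
  proof -
    have "ennreal (prob ?E) = ennreal (p0 / \<bar>v i\<bar> * (A + enn2real B))"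
      unfolding emeasure_eq_measure[symmetric] E using Bfin A0 p0
      by (subst ennreal_mult) (simp_all add: less_imp_le)
    then show ?thesis using A0 p0 by (subst (asm) ennreal_inj) auto
  qed
  moreover have "enn2real B = (LINT y:{0..x}|lborel.
      mat_integral {y..} (\<lambda>u. mat_exp ((u - y) *\<^sub>R K) ** IL v L) (D_meas D F) $ i $ j)"
    using overshoot_set_integral[OF gm g0 Bfin[unfolded B_def]]
    by (simp add: B_def mat_integral_def g_def)
  ultimately show ?thesis
    unfolding cond_prob_def init A_def[symmetric] p0_def[symmetric] using p0 i
    by (simp add: divide_simps)
qed

end
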